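(* Let $\mathcal{G}=(S,E)$ be a simple undirected graph, $c>1$ an integer, $L/K$ a Galois extension of subfields of $\mathbb{C}$ and $\rho:\mathrm{Gal}(L/K)\to\mathrm{Aut}(\overline{\mathcal{G}})$ a continuous group morphism. The Lie algebra $\mathfrak{n}_{\rho,c}^K$ is indecomposable if and only if the action of $\mathrm{Gal}(L/K)$ on the set $\mathcal{C}(\mathcal{G})$ of connected components of $\mathcal{G}$ given by $\chi\circ\rho$ is transitive.
   Context: A simple undirected graph is a pair $\mathcal{G}=(S,E)$ with $S$ a finite set and $E$ a set of two-element subsets of $S$. For a field $K\subset\mathbb{C}$, let $\mathfrak{f}^K(S)$ be the free Lie algebra on $S$ over $K$, let $I_{\mathcal{G}}$ be its ideal generated by $\{[\alpha,\beta]\mid \alpha,\beta\in S,\ \{\alpha,\beta\}\notin E\}$, and put $\mathfrak{g}_{\mathcal{G}}^K=\mathfrak{f}^K(S)/I_{\mathcal{G}}$. With the lower central series $\gamma_1(\mathfrak{g})=\mathfrak{g}$, $\gamma_{i+1}(\mathfrak{g})=[\mathfrak{g},\gamma_i(\mathfrak{g})]$, define for $c>1$: $\mathfrak{n}_{\mathcal{G},c}^K=\mathfrak{g}_{\mathcal{G}}^K/\gamma_{c+1}(\mathfrak{g}_{\mathcal{G}}^K)$. A Lie algebra is decomposable if it is the direct sum $\mathfrak{h}\oplus\mathfrak{k}$ of two non-trivial (i.e. nonzero) ideals; it is indecomposable if it is not decomposable. Galois extensions are algebraic but may have infinite degree; $\mathrm{Gal}(L/K)$ has the Krull topology and $\mathrm{Aut}(\overline{\mathcal{G}})$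 the discrete topology. Quotient graph: for $\alpha\in S$ let $\Omega'(\alpha)=\{\beta\in S\mid\{\alpha,\beta\}\in E\}$ and $\Omega(\alpha)=\Omega'(\alpha)\cup\{\alpha\}$. Write $\alpha\prec\beta$ if $\Omega'(\alpha)\subset\Omega(\beta)$ and $\alpha\sim\beta$ if $\alpha\prec\beta$ and $\beta\prec\alpha$. This is an equivalence relation; its classes are the coherent components and $\Lambda=S/\!\sim$. Set $\overline{\mathcal{G}}=(\Lambda,\overline{E},\Phi)$ with $\overline{E}=\{\{\lambda,\mu\}\mid\exists\alpha\in\lambda,\beta\in\mu:\{\alpha,\beta\}\in E\}$ (loops $\lambda=\mu$ allowed) and $\Phi(\lambda)=|\lambda|$. $\mathrm{Aut}(\overline{\mathcal{G}})$ is the group of permutations $\varphi$ of $\Lambda$ with $e\in\overline{E}\Leftrightarrow\varphi(e)\in\overline{E}$ and $\Phi\circ\varphi=\Phi$. The morphism $i$: fix once and for all an ordering $\lambda=\{\alpha_{\lambda,1},\dots,\alpha_{\lambda,|\lambda|}\}$ of the vertices in each coherent component. For any field $K\subset\mathbb{C}$, $i:\mathrm{Aut}(\overline{\mathcal{G}})\to\mathrm{Aut}(\mathfrak{n}_{\mathcal{G},c}^K)$ is the group morphism sending $\varphi$ to the unique Lie algebra automorphism with $i(\varphi)(\alpha_{\lambda,j})=\alpha_{\varphi(\lambda),j}$ for all $\lambda\in\Lambda$ and $1\le j\le|\lambda|$. The forms: $\mathrm{Gal}(L/K)$ acts on $\mathfrak{n}_{\mathcal{G},c}^L=\mathfrak{n}_{\mathcal{G},c}^K\otimes_K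 L$ by ${}^\sigma(v\otimes l)=v\otimes\sigma(l)$, and $$\mathfrak{n}_{\rho,c}^K=\{v\in\mathfrak{n}_{\mathcal{G},c}^L\mid\forall\sigma\in\mathrm{Gal}(L/K):\ i(\rho_\sigma)({}^\sigma v)=v\}, \qquad \rho_\sigma=\rho(\sigma),$$ a $K$-Lie algebra under the restricted operations. The morphism $\chi$: connected components of $\mathcal{G}$ are the equivalence classes of $S$ under being joined by a path of edges. Every connected component with at least two vertices is a disjoint union of coherent components, and every $\varphi\in\mathrm{Aut}(\overline{\mathcal{G}})$ maps coherent components lying in the same connected component to coherent components lying in the same connected component. Define $\chi:\mathrm{Aut}(\overline{\mathcal{G}})\to\mathrm{Perm}(\mathcal{C}(\mathcal{G}))$ by $\chi(\varphi)(C)=\varphi(\lambda_1)\sqcup\dots\sqcup\varphi(\lambda_k)$ if $|C|\ge 2$ and $C=\lambda_1\sqcup\dots\sqcup\lambda_k$ with $\lambda_j\in\Lambda$, and $\chi(\varphi)(C)=C$ if $C$ is a singleton. Transitive means that for any two connected components $C,C'$ there is $\sigma\in\mathrm{Gal}(L/K)$ with $\chi(\rho_\sigma)(C)=C'$. *)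

theory Defs
  imports "HOL-Algebra.Algebraic_Closure_Type" "HOL-Algebra.Bij" "HOL-Analysis.Abstract_Topology"
begin

section \<open>Galois extensions of subfields of the complex numbers\<close>

abbreviation \<C> :: "complex ring" where
  "\<C> \<equiv> ring_of_type_algebra"

definition galois_group :: "complex set \<Rightarrow> complex set \<Rightarrow> (complex \<Rightarrow> complex) monoid" where
  "galois_group L K = (BijGroup L)
     \<lparr>carrier := {\<sigma> \<in> Bij L. \<sigma> \<in> ring_hom (\<C>\<lparr>carrier := L\<rparr>) (\<C>\<lparr>carrier := L\<rparr>) \<and> (\<forall>x\<in>K. \<sigma> x = x)}\<rparr>"

text \<open>Galois means algebraic with fixed field \<open>K\<close>; the degree may be infinite.\<close>

definition galois_extension :: "complex set \<Rightarrow> complex set \<Rightarrow> bool" where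
  "galois_extension L K \<longleftrightarrow>
     subfield K \<C> \<and> subfield L \<C> \<and> K \<subseteq> L \<and>
     (\<forall>x\<in>L. (ring.algebraic \<C> over K) x) \<and>
     {x \<in> L. \<forall>\<sigma>\<in>carrier (galois_group L K). \<sigma> x = x} = K"

text \<open>The generating sets are the cosets of the subgroups fixing a finite intermediate extension
  \<open>F\<close>; they form a base of the Krull topology.\<close>

definition krull_topology :: "complex set \<Rightarrow> complex set \<Rightarrow> (complex \<Rightarrow> complex) topology" where
  "krull_topology L K = topology_generated_by
     {{\<tau> \<in> carrier (galois_group L K). \<forall>x\<in>F. \<tau> x = \<sigma> x} | \<sigma> F.
        \<sigma> \<in> carrier (galois_group L K) \<and>
        subfield F \<C> \<and> K \<subseteq> F \<and> F \<subseteq> L \<and> ring.finite_dimension \<C> K F}"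


section \<open>Algebras over a field of complex numbers\<close>

text \<open>A not necessarily associative algebra over \<open>K\<close> is a record of type
  \<^typ>\<open>(complex, 'v) module\<close> whose field \<^const>\<open>mult\<close> is the product, that is the bracket if
  the algebra is a Lie algebra. The field \<^const>\<open>one\<close> is never used.\<close>

definition alg_ideal :: "complex set \<Rightarrow> (complex, 'v) module \<Rightarrow> 'v set \<Rightarrow> bool" where
  "alg_ideal K A I \<longleftrightarrow> submodule I (\<C>\<lparr>carrier := K\<rparr>) A \<and>
     (\<forall>x\<in>carrier A. \<forall>y\<in>I. x \<otimes>\<^bsub>A\<^esub> y \<in> I \<and> y \<otimes>\<^bsub>A\<^esub> x \<in> I)"

definition ideal_generated :: "complex set \<Rightarrow> (complex, 'v) module \<Rightarrow> 'v set \<Rightarrow> 'v set" where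
  "ideal_generated K A B = \<Inter> {I. alg_ideal K A I \<and> B \<subseteq> I}"

definition span_in :: "complex set \<Rightarrow> (complex, 'v) module \<Rightarrow> 'v set \<Rightarrow> 'v set" where
  "span_in K A B = \<Inter> {N. submodule N (\<C>\<lparr>carrier := K\<rparr>) A \<and> B \<subseteq> N}"

definition quotient_algebra :: "(complex, 'v) module \<Rightarrow> 'v set \<Rightarrow> (complex, 'v set) module" where
  "quotient_algebra A I =
     \<lparr>carrier = a_rcosets\<^bsub>A\<^esub> I, monoid.mult = rcoset_mult A I, monoid.one = I +>\<^bsub>A\<^esub> \<one>\<^bsub>A\<^esub>,
      ring.zero = I, add = set_add A, module.smult = (\<lambda>a B. \<Union>x\<in>B. I +>\<^bsub>A\<^esub> (a \<odot>\<^bsub>A\<^esub> x))\<rparr>"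

text \<open>The terms of the lower central series are numbered from 1; the value at 0 is irrelevant.\<close>

fun lower_central :: "complex set \<Rightarrow> (complex, 'v) module \<Rightarrow> nat \<Rightarrow> 'v set" where
  "lower_central K A 0 = carrier A"
| "lower_central K A (Suc 0) = carrier A"
| "lower_central K A (Suc (Suc i)) =
     span_in K A {x \<otimes>\<^bsub>A\<^esub> y | x y. x \<in> carrier A \<and> y \<in> lower_central K A (Suc i)}"

definition algebra_aut :: "complex set \<Rightarrow> (complex, 'v) module \<Rightarrow> ('v \<Rightarrow> 'v) set" where
  "algebra_aut K A = {f \<in> Bij (carrier A).
     (\<forall>x\<in>carrier A. \<forall>y\<in>carrier A. f (x \<oplus>\<^bsub>A\<^esub> y) = f x \<oplus>\<^bsub>A\<^esub> f y) \<and>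
     (\<forall>x\<in>carrier A. \<forall>y\<in>carrier A. f (x \<otimes>\<^bsub>A\<^esub> y) = f x \<otimes>\<^bsub>A\<^esub> f y) \<and>
     (\<forall>a\<in>K. \<forall>x\<in>carrier A. f (a \<odot>\<^bsub>A\<^esub> x) = a \<odot>\<^bsub>A\<^esub> f x)}"

definition decomposable :: "complex set \<Rightarrow> (complex, 'v) module \<Rightarrow> bool" where
  "decomposable K A \<longleftrightarrow> (\<exists>H J. alg_ideal K A H \<and> alg_ideal K A J \<and>
     H \<noteq> {\<zero>\<^bsub>A\<^esub>} \<and> J \<noteq> {\<zero>\<^bsub>A\<^esub>} \<and> H \<inter> J = {\<zero>\<^bsub>A\<^esub>} \<and> H <+>\<^bsub>A\<^esub> J = carrier A)"


section \<open>The free Lie algebra\<close>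

datatype 'a magma = Gen 'a | Mul "'a magma" "'a magma"

text \<open>The free nonassociative algebra: finitely supported functions on the free magma over \<open>S\<close>.
  Every element of the magma that is not a generator is a product in exactly one way, so the
  convolution product needs no sum.\<close>

definition magma_algebra :: "complex set \<Rightarrow> 'a set \<Rightarrow> (complex, 'a magma \<Rightarrow> complex) module" where
  "magma_algebra K S =
     \<lparr>carrier = {f. finite {t. f t \<noteq> 0} \<and> (\<forall>t. f t \<in> K) \<and> (\<forall>t. f t \<noteq> 0 \<longrightarrow> set_magma t \<subseteq> S)},
      monoid.mult = (\<lambda>f g t. case t of Gen a \<Rightarrow> 0 | Mul u v \<Rightarrow> f u * g v),
      monoid.one = undefined,
      ring.zero = (\<lambda>t. 0),
      add = (\<lambda>f g t. f t + g t),
      module.smult = (\<lambda>a f t. a * f t)\<rparr>"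

definition lie_relators :: "(complex, 'v) module \<Rightarrow> 'v set" where
  "lie_relators A = {x \<otimes>\<^bsub>A\<^esub> x | x. x \<in> carrier A} \<union>
     {x \<otimes>\<^bsub>A\<^esub> (y \<otimes>\<^bsub>A\<^esub> z) \<oplus>\<^bsub>A\<^esub> y \<otimes>\<^bsub>A\<^esub> (z \<otimes>\<^bsub>A\<^esub> x) \<oplus>\<^bsub>A\<^esub> z \<otimes>\<^bsub>A\<^esub> (x \<otimes>\<^bsub>A\<^esub> y) | x y z.
        x \<in> carrier A \<and> y \<in> carrier A \<and> z \<in> carrier A}"

definition lie_ideal :: "complex set \<Rightarrow> 'a set \<Rightarrow> ('a magma \<Rightarrow> complex) set" where
  "lie_ideal K S = ideal_generated K (magma_algebra K S) (lie_relators (magma_algebra K S))"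

definition free_lie_algebra ::
  "complex set \<Rightarrow> 'a set \<Rightarrow> (complex, ('a magma \<Rightarrow> complex) set) module" where
  "free_lie_algebra K S = quotient_algebra (magma_algebra K S) (lie_ideal K S)"

definition free_vertex :: "complex set \<Rightarrow> 'a set \<Rightarrow> 'a \<Rightarrow> ('a magma \<Rightarrow> complex) set" where
  "free_vertex K S \<alpha> =
     lie_ideal K S +>\<^bsub>magma_algebra K S\<^esub> (\<lambda>t. if t = Gen \<alpha> then 1 else 0)"


section \<open>Simple graphs and their Lie algebras\<close>

definition simple_graph :: "'a set \<Rightarrow> 'a set set \<Rightarrow> bool" where
  "simple_graph S E \<longleftrightarrow> finite S \<and> E \<subseteq> {e. e \<subseteq> S \<and> card e = 2}"

definition graph_ideal ::
  "complex set \<Rightarrow> 'a set \<Rightarrow> 'a set set \<Rightarrow> ('a magma \<Rightarrow> complex) set set" where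
  "graph_ideal K S E = ideal_generated K (free_lie_algebra K S)
     {free_vertex K S \<alpha> \<otimes>\<^bsub>free_lie_algebra K S\<^esub> free_vertex K S \<beta> | \<alpha> \<beta>.
        \<alpha> \<in> S \<and> \<beta> \<in> S \<and> {\<alpha>, \<beta>} \<notin> E}"

definition graph_lie_algebra ::
  "complex set \<Rightarrow> 'a set \<Rightarrow> 'a set set \<Rightarrow> (complex, ('a magma \<Rightarrow> complex) set set) module" where
  "graph_lie_algebra K S E = quotient_algebra (free_lie_algebra K S) (graph_ideal K S E)"

definition nilpotent_lie_algebra ::
  "complex set \<Rightarrow> 'a set \<Rightarrow> 'a set set \<Rightarrow> nat \<Rightarrow>
    (complex, ('a magma \<Rightarrow> complex) set set set) module" where
  "nilpotent_lie_algebra K S E c =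
     quotient_algebra (graph_lie_algebra K S E) (lower_central K (graph_lie_algebra K S E) (c + 1))"

definition nilpotent_vertex ::
  "complex set \<Rightarrow> 'a set \<Rightarrow> 'a set set \<Rightarrow> nat \<Rightarrow> 'a \<Rightarrow> ('a magma \<Rightarrow> complex) set set set" where
  "nilpotent_vertex K S E c \<alpha> =
     lower_central K (graph_lie_algebra K S E) (c + 1) +>\<^bsub>graph_lie_algebra K S E\<^esub>
       (graph_ideal K S E +>\<^bsub>free_lie_algebra K S\<^esub> free_vertex K S \<alpha>)"


section \<open>Coherent components, the quotient graph and connected components\<close>

definition open_nbhd :: "'a set \<Rightarrow> 'a set set \<Rightarrow> 'a \<Rightarrow> 'a set" where
  "open_nbhd S E \<alpha> = {\<beta> \<in> S. {\<alpha>, \<beta>} \<in> E}"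

definition closed_nbhd :: "'a set \<Rightarrow> 'a set set \<Rightarrow> 'a \<Rightarrow> 'a set" where
  "closed_nbhd S E \<alpha> = open_nbhd S E \<alpha> \<union> {\<alpha>}"

definition dominated :: "'a set \<Rightarrow> 'a set set \<Rightarrow> 'a \<Rightarrow> 'a \<Rightarrow> bool" where
  "dominated S E \<alpha> \<beta> \<longleftrightarrow> open_nbhd S E \<alpha> \<subseteq> closed_nbhd S E \<beta>"

definition coherent_components :: "'a set \<Rightarrow> 'a set set \<Rightarrow> 'a set set" where
  "coherent_components S E = S // {(\<alpha>, \<beta>) \<in> S \<times> S. dominated S E \<alpha> \<beta> \<and> dominated S E \<beta> \<alpha>}"

definition quotient_edges :: "'a set \<Rightarrow> 'a set set \<Rightarrow> 'a set set set" where
  "quotient_edges S E = {{l, m} | l m. l \<in> coherent_components S E \<and> m \<in> coherent_components S E \<and>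
     (\<exists>\<alpha>\<in>l. \<exists>\<beta>\<in>m. {\<alpha>, \<beta>} \<in> E)}"

definition quotient_graph_aut :: "'a set \<Rightarrow> 'a set set \<Rightarrow> ('a set \<Rightarrow> 'a set) monoid" where
  "quotient_graph_aut S E = (BijGroup (coherent_components S E))
     \<lparr>carrier := {\<phi> \<in> Bij (coherent_components S E).
        (\<forall>e. e \<subseteq> coherent_components S E \<longrightarrow> (e \<in> quotient_edges S E \<longleftrightarrow> \<phi> ` e \<in> quotient_edges S E)) \<and>
        (\<forall>l\<in>coherent_components S E. card (\<phi> l) = card l)}\<rparr>"

definition connected_comps :: "'a set \<Rightarrow> 'a set set \<Rightarrow> 'a set set" where
  "connected_comps S E = S // {(\<alpha>, \<beta>) \<in> S \<times> S. (\<alpha>, \<beta>) \<in> {(x, y). {x, y} \<in> E}\<^sup>*}"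

text \<open>The permutation of the connected components induced by an automorphism of the quotient graph;
  a component with at least two vertices is a union of coherent components.\<close>

definition comp_perm :: "'a set \<Rightarrow> 'a set set \<Rightarrow> ('a set \<Rightarrow> 'a set) \<Rightarrow> 'a set \<Rightarrow> 'a set" where
  "comp_perm S E \<phi> C =
     (if 2 \<le> card C then \<Union> {\<phi> l | l. l \<in> coherent_components S E \<and> l \<subseteq> C} else C)"


section \<open>Rational forms\<close>

definition vertex_enumeration :: "'a set \<Rightarrow> 'a set set \<Rightarrow> ('a set \<Rightarrow> nat \<Rightarrow> 'a) \<Rightarrow> bool" where
  "vertex_enumeration S E vtx \<longleftrightarrow> (\<forall>l\<in>coherent_components S E. bij_betw (vtx l) {1..card l} l)"

definition lift_aut ::
  "complex set \<Rightarrow> 'a set \<Rightarrow> 'a set set \<Rightarrow> nat \<Rightarrow> ('a set \<Rightarrow> nat \<Rightarrow> 'a) \<Rightarrow> ('a set \<Rightarrow> 'a set) \<Rightarrow>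
    ('a magma \<Rightarrow> complex) set set set \<Rightarrow> ('a magma \<Rightarrow> complex) set set set" where
  "lift_aut K S E c vtx \<phi> = (THE f. f \<in> algebra_aut K (nilpotent_lie_algebra K S E c) \<and>
     (\<forall>l\<in>coherent_components S E. \<forall>j\<in>{1..card l}.
        f (nilpotent_vertex K S E c (vtx l j)) = nilpotent_vertex K S E c (vtx (\<phi> l) j)))"

text \<open>An element of the algebra over \<open>L\<close> is the class of a finite sum of terms \<open>l t\<close> with \<open>l \<in> L\<close>
  and \<open>t\<close> in the free magma, corresponding to the sum of the tensors of \<open>t\<close> and \<open>l\<close> in the scalar
  extension of the algebra over \<open>K\<close>. So a Galois automorphism acts by applying it to all
  coefficients of all representatives.\<close>

definition galois_action ::
  "(complex \<Rightarrow> complex) \<Rightarrow> ('a magma \<Rightarrow> complex) set set set \<Rightarrow> ('a magma \<Rightarrow> complex) set set set" where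
  "galois_action \<sigma> v = (`) ((`) (\<lambda>f. \<sigma> \<circ> f)) ` v"

definition rational_form ::
  "complex set \<Rightarrow> complex set \<Rightarrow> 'a set \<Rightarrow> 'a set set \<Rightarrow> nat \<Rightarrow> ('a set \<Rightarrow> nat \<Rightarrow> 'a) \<Rightarrow>
    ((complex \<Rightarrow> complex) \<Rightarrow> 'a set \<Rightarrow> 'a set) \<Rightarrow> (complex, ('a magma \<Rightarrow> complex) set set set) module" where
  "rational_form L K S E c vtx \<rho> = (nilpotent_lie_algebra L S E c)
     \<lparr>carrier := {v \<in> carrier (nilpotent_lie_algebra L S E c).
        \<forall>\<sigma>\<in>carrier (galois_group L K). lift_aut L S E c vtx (\<rho> \<sigma>) (galois_action \<sigma> v) = v}\<rparr>"

end

theory Submission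
  imports Defs "HOL-Library.Function_Algebras"
begin

text \<open>Write the nilpotent algebra over \<open>L\<close> as the free nonassociative algebra \<open>M\<close> modulo an ideal \<open>N\<close>, so
  that the form consists of the classes of those \<open>f\<close> whose twisted conjugates are congruent to \<open>f\<close>.
  If an orbit \<open>V\<close> of connected components is not everything, monomials mixing \<open>V\<close> and \<open>S - V\<close>
  vanish, and projecting to the monomials in \<open>V\<close> and in \<open>S - V\<close> splits the form.
  Conversely let the form be the sum of ideals \<open>H\<close> and \<open>J\<close>. As their product is zero, the linear
  parts of elements of \<open>H\<close> and of \<open>J\<close> are parallel at the two ends of every edge; as together they
  span over \<open>L\<close>, one of the two ideals has no linear part at that edge, hence none on the
  whole connected component. By transitivity and Galois invariance one ideal, say \<open>J\<close>, has no linear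
  part at all. Then \<open>H\<close> spans everything modulo \<open>\<gamma>\<^sub>2\<close>, so everything by nilpotency, and by
  descent \<open>J\<close> is contained in \<open>H\<close>, which is absurd.\<close>

section \<open>Algebras over subfields of the complex numbers\<close>

text \<open>No basis of the Lie algebra is ever computed. Its elements are triply nested cosets, so
  the work is done with coefficient functions on the magma, modulo \<open>N\<close>. The only
  explicit knowledge of \<open>N\<close> needed is in low degree: its elements have no linear
  coefficients, and at an edge their coefficients at the two products of its ends agree. The second
  fact turns a vanishing product into parallel linear parts. The obstacle to descent is that
  \<open>L\<close> may have infinite degree over \<open>K\<close>, so there is no trace. Continuity
  makes the vertex permutations depend on finitely many values of an automorphism, and algebraicity
  leaves finitely many possibilities for these values. Sums over finitely many representatives then
  show that the fixed vectors span over \<open>L\<close>. Isolated vertices have no edge along which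
  \<open>H\<close> and \<open>J\<close> could be compared. The group fixes each of them, however, so
  transitivity leaves only the graph with one vertex, where the linear parts of fixed vectors lie in
  a line over \<open>K\<close>.\<close>

lemma complex_ring_simps [simp]:
  "carrier \<C> = UNIV" "monoid.mult \<C> = (*)" "monoid.one \<C> = 1" "ring.zero \<C> = 0" "add \<C> = (+)"
  by (auto simp: ring_of_type_algebra_def fun_eq_iff)

lemma field_complex: "field \<C>"
  by (rule field_from_type_algebra)

lemma ring_complex: "ring \<C>"
  by (rule ring_from_type_algebra)

lemma complex_a_inv [simp]: "\<ominus>\<^bsub>\<C>\<^esub> x = - x"
  by (rule abelian_group.minus_equality[OF ring.is_abelian_group[OF ring_complex]]) auto

lemma complex_m_inv [simp]: "x \<noteq> 0 \<Longrightarrow> inv\<^bsub>\<C>\<^esub> x = inverse x"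
  by (rule comm_monoid.comm_inv_char[OF cring.axioms(2)[OF cring_from_type_algebra]]) auto

lemma complex_nat_pow [simp]: "x [^]\<^bsub>\<C>\<^esub> (n::nat) = x ^ n"
  by (induction n) (auto simp: nat_pow_def mult.commute)

lemma subfield_complex_closed:
  assumes "subfield K \<C>"
  shows "0 \<in> K" "1 \<in> K" "\<And>a b. a \<in> K \<Longrightarrow> b \<in> K \<Longrightarrow> a + b \<in> K"
    "\<And>a b. a \<in> K \<Longrightarrow> b \<in> K \<Longrightarrow> a * b \<in> K" "\<And>a. a \<in> K \<Longrightarrow> - a \<in> K"
    "\<And>a b. a \<in> K \<Longrightarrow> b \<in> K \<Longrightarrow> a - b \<in> K" "\<And>a. a \<in> K \<Longrightarrow> inverse a \<in> K"
    "\<And>a b. a \<in> K \<Longrightarrow> b \<in> K \<Longrightarrow> a / b \<in> K" "-1 \<in> K"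
proof -
  interpret subfield K \<C> by fact
  interpret K: subring K \<C> by (rule subring_axioms)
  have K: "subring K \<C>" by (rule subring_axioms)
  show *: "0 \<in> K" "1 \<in> K" using subringE(2,3)[OF K] by auto
  show add: "a + b \<in> K" if "a \<in> K" "b \<in> K" for a b
    using subringE(7)[OF K] that by auto
  show mult: "a * b \<in> K" if "a \<in> K" "b \<in> K" for a b
    using subringE(6)[OF K] that by auto
  show neg: "- a \<in> K" if "a \<in> K" for a
    using subringE(5)[OF K] that by auto
  show "-1 \<in> K" using neg[OF *(2)] .
  show "a - b \<in> K" if "a \<in> K" "b \<in> K" for a b
    using add[OF that(1) neg[OF that(2)]] by simp
  show inv: "inverse a \<in> K" if "a \<in> K" for a
  proof (cases "a = 0")
    case False
    then have "inv\<^bsub>\<C>\<^esub> a \<in> K - {\<zero>\<^bsub>\<C>\<^esub>}"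
      using ring.subfield_m_inv(1)[OF ring_complex assms, of a] that by auto
    then show ?thesis using False by simp
  qed (use * in auto)
  show "a / b \<in> K" if "a \<in> K" "b \<in> K" for a b
    using mult[OF that(1) inv[OF that(2)]] by (simp add: divide_inverse)
qed

text \<open>Additive inverses are given by the scalar \<open>-1\<close>, so that all axioms are identities and pass
  to homomorphic images.\<close>

locale complex_algebra =
  fixes K :: "complex set" and A :: "(complex, 'v) module" (structure)
  assumes subfield: "subfield K \<C>"
    and zero_closed [simp, intro]: "\<zero> \<in> carrier A"
    and add_closed [simp, intro]: "x \<in> carrier A \<Longrightarrow> y \<in> carrier A \<Longrightarrow> x \<oplus> y \<in> carrier A"
    and smult_closed [simp, intro]: "a \<in> K \<Longrightarrow> x \<in> carrier A \<Longrightarrow> a \<odot> x \<in> carrier A"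
    and mult_closed [simp, intro]: "x \<in> carrier A \<Longrightarrow> y \<in> carrier A \<Longrightarrow> x \<otimes> y \<in> carrier A"
    and add_assoc: "x \<in> carrier A \<Longrightarrow> y \<in> carrier A \<Longrightarrow> z \<in> carrier A \<Longrightarrow>
      x \<oplus> y \<oplus> z = x \<oplus> (y \<oplus> z)"
    and add_commute: "x \<in> carrier A \<Longrightarrow> y \<in> carrier A \<Longrightarrow> x \<oplus> y = y \<oplus> x"
    and add_zero [simp]: "x \<in> carrier A \<Longrightarrow> \<zero> \<oplus> x = x"
    and smult_zero [simp]: "x \<in> carrier A \<Longrightarrow> 0 \<odot> x = \<zero>"
    and smult_one [simp]: "x \<in> carrier A \<Longrightarrow> 1 \<odot> x = x"
    and smult_smult: "a \<in> K \<Longrightarrow> b \<in> K \<Longrightarrow> x \<in> carrier A \<Longrightarrow> a \<odot> (b \<odot> x) = (a * b) \<odot> x"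
    and smult_add_left: "a \<in> K \<Longrightarrow> b \<in> K \<Longrightarrow> x \<in> carrier A \<Longrightarrow> (a + b) \<odot> x = a \<odot> x \<oplus> b \<odot> x"
    and smult_add_right: "a \<in> K \<Longrightarrow> x \<in> carrier A \<Longrightarrow> y \<in> carrier A \<Longrightarrow>
      a \<odot> (x \<oplus> y) = a \<odot> x \<oplus> a \<odot> y"
    and mult_add_left: "x \<in> carrier A \<Longrightarrow> y \<in> carrier A \<Longrightarrow> z \<in> carrier A \<Longrightarrow>
      (x \<oplus> y) \<otimes> z = x \<otimes> z \<oplus> y \<otimes> z"
    and mult_add_right: "x \<in> carrier A \<Longrightarrow> y \<in> carrier A \<Longrightarrow> z \<in> carrier A \<Longrightarrow>
      x \<otimes> (y \<oplus> z) = x \<otimes> y \<oplus> x \<otimes> z"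
    and smult_mult_left: "a \<in> K \<Longrightarrow> x \<in> carrier A \<Longrightarrow> y \<in> carrier A \<Longrightarrow>
      (a \<odot> x) \<otimes> y = a \<odot> (x \<otimes> y)"
    and smult_mult_right: "a \<in> K \<Longrightarrow> x \<in> carrier A \<Longrightarrow> y \<in> carrier A \<Longrightarrow>
      x \<otimes> (a \<odot> y) = a \<odot> (x \<otimes> y)"
begin

lemmas K_closed = subfield_complex_closed[OF subfield]

abbreviation neg :: "'v \<Rightarrow> 'v" where "neg x \<equiv> (-1) \<odot> x"

lemma neg_closed [simp, intro]: "x \<in> carrier A \<Longrightarrow> neg x \<in> carrier A"
  using K_closed(9) by simp

lemma add_neg: "x \<in> carrier A \<Longrightarrow> x \<oplus> neg x = \<zero>"
  using smult_add_left[of 1 "-1" x] K_closed by simp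

lemma neg_add: "x \<in> carrier A \<Longrightarrow> neg x \<oplus> x = \<zero>"
  using add_neg[of x] add_commute[of x "neg x"] by simp

lemma zero_add_right [simp]: "x \<in> carrier A \<Longrightarrow> x \<oplus> \<zero> = x"
  using add_commute[of x \<zero>] by simp

lemma add_group: "group (add_monoid A)"
  by (rule groupI) (auto simp: add_assoc intro!: bexI[of _ "neg _"] neg_add)

lemma add_inv: "x \<in> carrier A \<Longrightarrow> inv\<^bsub>add_monoid A\<^esub> x = neg x"
  using group.inv_equality[OF add_group, of "neg x" x] by (simp add: neg_add)

text \<open>Closure under additive inverses comes from the scalar \<open>-1\<close>, which lies in
  every subfield.\<close>

lemma submodule_iff:
  "submodule N (\<C>\<lparr>carrier := K\<rparr>) A \<longleftrightarrow> N \<subseteq> carrier A \<and> \<zero> \<in> N \<and>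
     (\<forall>x\<in>N. \<forall>y\<in>N. x \<oplus> y \<in> N) \<and> (\<forall>a\<in>K. \<forall>x\<in>N. a \<odot> x \<in> N)"
proof
  assume "submodule N (\<C>\<lparr>carrier := K\<rparr>) A"
  then interpret N: submodule N "\<C>\<lparr>carrier := K\<rparr>" A .
  show "N \<subseteq> carrier A \<and> \<zero> \<in> N \<and>
     (\<forall>x\<in>N. \<forall>y\<in>N. x \<oplus> y \<in> N) \<and> (\<forall>a\<in>K. \<forall>x\<in>N. a \<odot> x \<in> N)"
    using N.subset N.one_closed N.m_closed N.smult_closed by auto
next
  assume *: "N \<subseteq> carrier A \<and> \<zero> \<in> N \<and>
     (\<forall>x\<in>N. \<forall>y\<in>N. x \<oplus> y \<in> N) \<and> (\<forall>a\<in>K. \<forall>x\<in>N. a \<odot> x \<in> N)"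
  show "submodule N (\<C>\<lparr>carrier := K\<rparr>) A"
  proof (intro submodule.intro subgroup.intro)
    show "inv\<^bsub>add_monoid A\<^esub> x \<in> N" if "x \<in> N" for x
      using that * add_inv[of x] K_closed(9) by auto
  qed (use * in \<open>auto simp: submodule_axioms_def\<close>)
qed

lemma alg_ideal_iff:
  "alg_ideal K A I \<longleftrightarrow> I \<subseteq> carrier A \<and> \<zero> \<in> I \<and> (\<forall>x\<in>I. \<forall>y\<in>I. x \<oplus> y \<in> I) \<and>
     (\<forall>a\<in>K. \<forall>x\<in>I. a \<odot> x \<in> I) \<and> (\<forall>x\<in>carrier A. \<forall>y\<in>I. x \<otimes> y \<in> I \<and> y \<otimes> x \<in> I)"
  by (auto simp: alg_ideal_def submodule_iff)

section \<open>Generated ideals and linear spans\<close>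

lemma alg_ideal_carrier: "alg_ideal K A (carrier A)"
  by (auto simp: alg_ideal_iff)

lemma alg_ideal_ideal_generated:
  assumes "B \<subseteq> carrier A"
  shows "alg_ideal K A (ideal_generated K A B)"
  unfolding alg_ideal_iff
proof (intro conjI)
  show "ideal_generated K A B \<subseteq> carrier A"
    using alg_ideal_carrier assms unfolding ideal_generated_def by blast
qed (auto simp: ideal_generated_def alg_ideal_iff)

lemma ideal_generated_base: "x \<in> B \<Longrightarrow> x \<in> ideal_generated K A B"
  by (auto simp: ideal_generated_def)

lemma ideal_generated_least: "alg_ideal K A I \<Longrightarrow> B \<subseteq> I \<Longrightarrow> ideal_generated K A B \<subseteq> I"
  by (auto simp: ideal_generated_def)

lemma submodule_span_in:
  assumes "B \<subseteq> carrier A"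
  shows "submodule (span_in K A B) (\<C>\<lparr>carrier := K\<rparr>) A"
  unfolding submodule_iff
proof (intro conjI)
  have "submodule (carrier A) (\<C>\<lparr>carrier := K\<rparr>) A" by (auto simp: submodule_iff)
  then show "span_in K A B \<subseteq> carrier A"
    using assms unfolding span_in_def by blast
qed (auto simp: span_in_def submodule_iff)

lemma span_in_base: "x \<in> B \<Longrightarrow> x \<in> span_in K A B"
  by (auto simp: span_in_def)

lemma span_in_least: "submodule N (\<C>\<lparr>carrier := K\<rparr>) A \<Longrightarrow> B \<subseteq> N \<Longrightarrow> span_in K A B \<subseteq> N"
  by (auto simp: span_in_def)

section \<open>The lower central series\<close>

lemma lower_central_Suc:
  "k \<noteq> 0 \<Longrightarrow> lower_central K A (Suc k) =
     span_in K A {x \<otimes> y | x y. x \<in> carrier A \<and> y \<in> lower_central K A k}"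
  by (cases k) auto

lemma submodule_lower_central: "submodule (lower_central K A k) (\<C>\<lparr>carrier := K\<rparr>) A"
proof (induction k)
  case 0
  show ?case by (auto simp: submodule_iff)
next
  case (Suc k)
  show ?case
  proof (cases "k = 0")
    case True
    then show ?thesis by (auto simp: submodule_iff)
  next
    case False
    have "{x \<otimes> y | x y. x \<in> carrier A \<and> y \<in> lower_central K A k} \<subseteq> carrier A"
      using Suc by (auto simp: submodule_iff)
    then show ?thesis
      by (simp add: lower_central_Suc[OF False] submodule_span_in)
  qed
qed

lemma lower_central_mult:
  "k \<noteq> 0 \<Longrightarrow> x \<in> carrier A \<Longrightarrow> y \<in> lower_central K A k \<Longrightarrow> x \<otimes> y \<in> lower_central K A (Suc k)"
  unfolding lower_central_Suc by (rule span_in_base) auto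

lemma lower_central_antimono:
  "k \<noteq> 0 \<Longrightarrow> lower_central K A (Suc k) \<subseteq> lower_central K A k"
proof (induction k)
  case (Suc k)
  show ?case
  proof (cases "k = 0")
    case True
    then show ?thesis
      using submodule_lower_central[of "Suc (Suc 0)"] by (auto simp: submodule_iff)
  next
    case False
    then have "{x \<otimes> y | x y. x \<in> carrier A \<and> y \<in> lower_central K A (Suc k)} \<subseteq>
      {x \<otimes> y | x y. x \<in> carrier A \<and> y \<in> lower_central K A k}"
      using Suc by auto
    then have "span_in K A {x \<otimes> y | x y. x \<in> carrier A \<and> y \<in> lower_central K A (Suc k)} \<subseteq>
      span_in K A {x \<otimes> y | x y. x \<in> carrier A \<and> y \<in> lower_central K A k}"
      by (auto simp: span_in_def)
    then show ?thesis using lower_central_Suc[of "Suc k"] lower_central_Suc[OF False] by simp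
  qed
qed simp

lemma lower_central_mult_left:
  "k \<noteq> 0 \<Longrightarrow> x \<in> carrier A \<Longrightarrow> y \<in> lower_central K A k \<Longrightarrow> x \<otimes> y \<in> lower_central K A k"
  using lower_central_mult lower_central_antimono by blast

text \<open>Polarisation: the square of \<open>x \<oplus> y\<close> vanishes along with the squares
  of \<open>x\<close> and \<open>y\<close>.\<close>

lemma mult_anticommute:
  assumes alt: "\<And>x. x \<in> carrier A \<Longrightarrow> x \<otimes> x = \<zero>" and "x \<in> carrier A" "y \<in> carrier A"
  shows "y \<otimes> x = neg (x \<otimes> y)"
proof -
  have "\<zero> = (x \<oplus> y) \<otimes> (x \<oplus> y)" using assms by simp
  also have "\<dots> = (x \<otimes> x \<oplus> x \<otimes> y) \<oplus> (y \<otimes> x \<oplus> y \<otimes> y)"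
    using assms(2,3) by (simp only: mult_add_left[OF _ _ add_closed] mult_add_right)
  also have "\<dots> = x \<otimes> y \<oplus> y \<otimes> x" using assms by simp
  finally have "neg (x \<otimes> y) = neg (x \<otimes> y) \<oplus> (x \<otimes> y \<oplus> y \<otimes> x)"
    using assms(2,3) by (metis mult_closed neg_closed zero_add_right)
  also have "\<dots> = y \<otimes> x" using assms by (simp add: add_assoc[symmetric] neg_add)
  finally show ?thesis by simp
qed

text \<open>The series is built from products with an arbitrary left factor, so closure on the right
  has to come from anticommutativity.\<close>

lemma alg_ideal_lower_central:
  assumes alt: "\<And>x. x \<in> carrier A \<Longrightarrow> x \<otimes> x = \<zero>" and "k \<noteq> 0"
  shows "alg_ideal K A (lower_central K A k)"
proof -
  have sub: "submodule (lower_central K A k) (\<C>\<lparr>carrier := K\<rparr>) A"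
    by (rule submodule_lower_central)
  then have "y \<otimes> x \<in> lower_central K A k" if "x \<in> carrier A" "y \<in> lower_central K A k" for x y
    using mult_anticommute[OF alt, of x y] lower_central_mult_left[OF assms(2) that] that K_closed(9)
    by (auto simp: submodule_iff)
  then show ?thesis
    using sub lower_central_mult_left[OF assms(2)] by (auto simp: alg_ideal_def)
qed

end

subsection \<open>Surjective homomorphisms\<close>

text \<open>Only the source is assumed to be an algebra. The laws of the target are identities
  between images and are inherited, so a quotient is an algebra as soon as the projection is
  compatible with the operations.\<close>

locale algebra_epi = A: complex_algebra K A
  for K :: "complex set" and A :: "(complex, 'v) module" (structure) +
  fixes B :: "(complex, 'w) module" and \<pi> :: "'v \<Rightarrow> 'w"
  assumes image: "\<pi> ` carrier A = carrier B"
    and map_zero: "\<pi> \<zero> = \<zero>\<^bsub>B\<^esub>"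
    and map_add: "x \<in> carrier A \<Longrightarrow> y \<in> carrier A \<Longrightarrow> \<pi> (x \<oplus> y) = \<pi> x \<oplus>\<^bsub>B\<^esub> \<pi> y"
    and map_smult: "a \<in> K \<Longrightarrow> x \<in> carrier A \<Longrightarrow> \<pi> (a \<odot> x) = a \<odot>\<^bsub>B\<^esub> \<pi> x"
    and map_mult: "x \<in> carrier A \<Longrightarrow> y \<in> carrier A \<Longrightarrow> \<pi> (x \<otimes> y) = \<pi> x \<otimes>\<^bsub>B\<^esub> \<pi> y"
begin

lemma image_closed [simp, intro]: "x \<in> carrier A \<Longrightarrow> \<pi> x \<in> carrier B"
  using image by auto

lemma carrier_cases:
  assumes "y \<in> carrier B" obtains x where "x \<in> carrier A" "y = \<pi> x"
  using assms image by auto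

lemma complex_algebra_image: "complex_algebra K B"
proof (rule complex_algebra.intro)
  show "\<zero>\<^bsub>B\<^esub> \<in> carrier B" using map_zero A.zero_closed by (metis image_closed)
  fix x y assume "x \<in> carrier B" "y \<in> carrier B"
  then obtain x' y' where xy: "x' \<in> carrier A" "x = \<pi> x'" "y' \<in> carrier A" "y = \<pi> y'"
    by (auto elim!: carrier_cases)
  show "x \<oplus>\<^bsub>B\<^esub> y \<in> carrier B" "x \<otimes>\<^bsub>B\<^esub> y \<in> carrier B"
    using xy by (auto simp: map_add[symmetric] map_mult[symmetric])
  show "x \<oplus>\<^bsub>B\<^esub> y = y \<oplus>\<^bsub>B\<^esub> x"
    using xy A.add_commute[of x' y'] by (auto simp: map_add[symmetric])
  show "\<zero>\<^bsub>B\<^esub> \<oplus>\<^bsub>B\<^esub> x = x" "0 \<odot>\<^bsub>B\<^esub> x = \<zero>\<^bsub>B\<^esub>" "1 \<odot>\<^bsub>B\<^esub> x = x"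
    using xy map_add[of \<zero> x'] map_smult[of 0 x'] map_smult[of 1 x'] A.K_closed(1,2)
    by (auto simp: map_zero)
  fix a assume a: "a \<in> K"
  show "a \<odot>\<^bsub>B\<^esub> x \<in> carrier B" using xy a by (auto simp: map_smult[symmetric])
  show "a \<odot>\<^bsub>B\<^esub> (x \<oplus>\<^bsub>B\<^esub> y) = a \<odot>\<^bsub>B\<^esub> x \<oplus>\<^bsub>B\<^esub> a \<odot>\<^bsub>B\<^esub> y"
    using xy a arg_cong[OF A.smult_add_right[of a x' y'], of \<pi>] by (simp add: map_add map_smult)
  show "(a \<odot>\<^bsub>B\<^esub> x) \<otimes>\<^bsub>B\<^esub> y = a \<odot>\<^bsub>B\<^esub> (x \<otimes>\<^bsub>B\<^esub> y)" "x \<otimes>\<^bsub>B\<^esub> (a \<odot>\<^bsub>B\<^esub> y) = a \<odot>\<^bsub>B\<^esub> (x \<otimes>\<^bsub>B\<^esub> y)"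
    using xy a arg_cong[OF A.smult_mult_left[of a x' y'], of \<pi>]
      arg_cong[OF A.smult_mult_right[of a x' y'], of \<pi>] by (simp_all add: map_mult map_smult)
  fix b assume b: "b \<in> K"
  show "a \<odot>\<^bsub>B\<^esub> (b \<odot>\<^bsub>B\<^esub> x) = (a * b) \<odot>\<^bsub>B\<^esub> x" "(a + b) \<odot>\<^bsub>B\<^esub> x = a \<odot>\<^bsub>B\<^esub> x \<oplus>\<^bsub>B\<^esub> b \<odot>\<^bsub>B\<^esub> x"
    using xy a b arg_cong[OF A.smult_smult[of a b x'], of \<pi>]
      arg_cong[OF A.smult_add_left[of a b x'], of \<pi>] A.K_closed(3,4)
    by (simp_all add: map_add map_smult)
next
  fix x y z assume "x \<in> carrier B" "y \<in> carrier B" "z \<in> carrier B"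
  then obtain x' y' z' where xy: "x' \<in> carrier A" "x = \<pi> x'" "y' \<in> carrier A" "y = \<pi> y'"
      "z' \<in> carrier A" "z = \<pi> z'"
    by (auto elim!: carrier_cases)
  show "x \<oplus>\<^bsub>B\<^esub> y \<oplus>\<^bsub>B\<^esub> z = x \<oplus>\<^bsub>B\<^esub> (y \<oplus>\<^bsub>B\<^esub> z)"
    "(x \<oplus>\<^bsub>B\<^esub> y) \<otimes>\<^bsub>B\<^esub> z = x \<otimes>\<^bsub>B\<^esub> z \<oplus>\<^bsub>B\<^esub> y \<otimes>\<^bsub>B\<^esub> z"
    "x \<otimes>\<^bsub>B\<^esub> (y \<oplus>\<^bsub>B\<^esub> z) = x \<otimes>\<^bsub>B\<^esub> y \<oplus>\<^bsub>B\<^esub> x \<otimes>\<^bsub>B\<^esub> z"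
    using xy arg_cong[OF A.add_assoc[of x' y' z'], of \<pi>]
      arg_cong[OF A.mult_add_left[of x' y' z'], of \<pi>]
      arg_cong[OF A.mult_add_right[of x' y' z'], of \<pi>] by (simp_all add: map_add map_mult)
qed (rule A.subfield)

sublocale B: complex_algebra K B
  by (rule complex_algebra_image)

definition ker :: "'v set" where "ker = {x \<in> carrier A. \<pi> x = \<zero>\<^bsub>B\<^esub>}"

lemma map_eq_iff:
  assumes "x \<in> carrier A" "y \<in> carrier A"
  shows "\<pi> x = \<pi> y \<longleftrightarrow> x \<oplus> A.neg y \<in> ker"
proof
  assume "\<pi> x = \<pi> y"
  then show "x \<oplus> A.neg y \<in> ker"
    using assms A.K_closed(9) by (auto simp: ker_def map_add map_smult B.add_neg)
next
  assume "x \<oplus> A.neg y \<in> ker"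
  then have "\<pi> (x \<oplus> A.neg y \<oplus> y) = \<pi> y"
    using assms by (simp add: ker_def map_add)
  then show "\<pi> x = \<pi> y" using assms by (simp add: A.add_assoc A.neg_add)
qed

lemma submodule_vimage:
  assumes "submodule J (\<C>\<lparr>carrier := K\<rparr>) B"
  shows "submodule {x \<in> carrier A. \<pi> x \<in> J} (\<C>\<lparr>carrier := K\<rparr>) A"
  using assms by (auto simp: A.submodule_iff B.submodule_iff map_zero map_add map_smult map_mult)

lemma submodule_image:
  assumes "submodule I (\<C>\<lparr>carrier := K\<rparr>) A"
  shows "submodule (\<pi> ` I) (\<C>\<lparr>carrier := K\<rparr>) B"
  unfolding B.submodule_iff
proof (intro conjI ballI)
  show "\<zero>\<^bsub>B\<^esub> \<in> \<pi> ` I" using assms map_zero by (force simp: A.submodule_iff)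
next
  fix x y assume "x \<in> \<pi> ` I" "y \<in> \<pi> ` I"
  then obtain x' y' where xy: "x = \<pi> x'" "x' \<in> I" "y = \<pi> y'" "y' \<in> I" by auto
  then have "x' \<oplus> y' \<in> I" "x' \<in> carrier A" "y' \<in> carrier A" using assms by (auto simp: A.submodule_iff)
  then show "x \<oplus>\<^bsub>B\<^esub> y \<in> \<pi> ` I" using xy by (auto simp: map_add[symmetric])
next
  fix a y assume "a \<in> K" "y \<in> \<pi> ` I"
  then obtain y' where xy: "y = \<pi> y'" "y' \<in> I" by auto
  then have "a \<odot> y' \<in> I" "y' \<in> carrier A" using assms \<open>a \<in> K\<close> by (auto simp: A.submodule_iff)
  then show "a \<odot>\<^bsub>B\<^esub> y \<in> \<pi> ` I" using xy \<open>a \<in> K\<close> by (auto simp: map_smult[symmetric])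
qed (use assms in \<open>auto simp: A.submodule_iff\<close>)

lemma alg_ideal_vimage:
  assumes "alg_ideal K B J"
  shows "alg_ideal K A {x \<in> carrier A. \<pi> x \<in> J}"
  using assms submodule_vimage by (auto simp: alg_ideal_def map_mult)

lemma alg_ideal_image:
  assumes "alg_ideal K A I"
  shows "alg_ideal K B (\<pi> ` I)"
  unfolding alg_ideal_def
proof (intro conjI ballI)
  show "submodule (\<pi> ` I) (\<C>\<lparr>carrier := K\<rparr>) B"
    using assms by (intro submodule_image) (simp add: alg_ideal_def)
  fix x y assume "x \<in> carrier B" "y \<in> \<pi> ` I"
  then obtain x' y' where xy: "x = \<pi> x'" "x' \<in> carrier A" "y = \<pi> y'" "y' \<in> I"
    by (auto elim: carrier_cases)
  then have "x' \<otimes> y' \<in> I" "y' \<otimes> x' \<in> I" "y' \<in> carrier A" using assms by (auto simp: A.alg_ideal_iff)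
  then show "x \<otimes>\<^bsub>B\<^esub> y \<in> \<pi> ` I" "y \<otimes>\<^bsub>B\<^esub> x \<in> \<pi> ` I" using xy
    by (auto simp: map_mult[symmetric])
qed

text \<open>A surjection maps the generating products onto the generating products and spans onto
  spans. This allows the last quotient to be described by the lower central series of the magma
  algebra.\<close>

lemma lower_central_image: "\<pi> ` lower_central K A k = lower_central K B k"
proof (induction k)
  case (Suc k)
  show ?case
  proof (cases "k = 0")
    case False
    let ?A = "{x \<otimes> y | x y. x \<in> carrier A \<and> y \<in> lower_central K A k}"
    let ?B = "{x \<otimes>\<^bsub>B\<^esub> y | x y. x \<in> carrier B \<and> y \<in> lower_central K B k}"
    have sub: "lower_central K A k \<subseteq> carrier A"
      using A.submodule_lower_central[of k] by (auto simp: A.submodule_iff)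
    then have A: "?A \<subseteq> carrier A" by auto
    have AB: "\<pi> ` ?A = ?B"
    proof
      show "\<pi> ` ?A \<subseteq> ?B" using sub by (force simp: map_mult Suc[symmetric] subset_iff)
      show "?B \<subseteq> \<pi> ` ?A"
      proof
        fix z assume "z \<in> ?B"
        then obtain x y where "x \<in> carrier A" "y \<in> lower_central K A k" "z = \<pi> x \<otimes>\<^bsub>B\<^esub> \<pi> y"
          by (auto simp: Suc[symmetric] image[symmetric])
        then show "z \<in> \<pi> ` ?A" using sub by (auto simp: map_mult[symmetric] subset_iff)
      qed
    qed
    have B: "?B \<subseteq> carrier B" using A AB image by blast
    have "\<pi> ` span_in K A ?A = span_in K B ?B"
    proof
      have "span_in K A ?A \<subseteq> {x \<in> carrier A. \<pi> x \<in> span_in K B ?B}"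
      proof (rule A.span_in_least)
        show "submodule {x \<in> carrier A. \<pi> x \<in> span_in K B ?B} (\<C>\<lparr>carrier := K\<rparr>) A"
          by (intro submodule_vimage B.submodule_span_in B)
        show "?A \<subseteq> {x \<in> carrier A. \<pi> x \<in> span_in K B ?B}"
          using A AB B.span_in_base[of _ ?B] by blast
      qed
      then show "\<pi> ` span_in K A ?A \<subseteq> span_in K B ?B" by auto
      show "span_in K B ?B \<subseteq> \<pi> ` span_in K A ?A"
      proof (rule B.span_in_least)
        show "submodule (\<pi> ` span_in K A ?A) (\<C>\<lparr>carrier := K\<rparr>) B"
          by (intro submodule_image A.submodule_span_in A)
        show "?B \<subseteq> \<pi> ` span_in K A ?A"
          using AB A.span_in_base[of _ ?A] by blast
      qed
    qed
    then show ?thesis by (simp add: A.lower_central_Suc[OF False] B.lower_central_Suc[OF False])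
  qed (simp add: image)
qed (simp add: image)

end

subsection \<open>Quotients\<close>

context complex_algebra
begin

lemma add_left_commute:
  "x \<in> carrier A \<Longrightarrow> y \<in> carrier A \<Longrightarrow> z \<in> carrier A \<Longrightarrow> x \<oplus> (y \<oplus> z) = y \<oplus> (x \<oplus> z)"
  by (metis add_assoc add_commute)

lemma coset_eq: "I +> x = {h \<oplus> x | h. h \<in> I}"
  by (auto simp: a_r_coset_def')

lemma coset_absorb:
  assumes I: "alg_ideal K A I" and x: "x \<in> carrier A" and h: "h \<in> I"
  shows "I +> (h \<oplus> x) = I +> x"
proof -
  have I': "I \<subseteq> carrier A" "\<And>x y. x \<in> I \<Longrightarrow> y \<in> I \<Longrightarrow> x \<oplus> y \<in> I" "neg h \<in> I"
    using I h K_closed(9) by (auto simp: alg_ideal_iff)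
  have "k \<oplus> (h \<oplus> x) = (k \<oplus> h) \<oplus> x" if "k \<in> I" for k
    using that I' h x by (auto simp: add_assoc subset_iff)
  moreover have "k \<oplus> x = (k \<oplus> neg h) \<oplus> (h \<oplus> x)" if "k \<in> I" for k
  proof -
    have c: "k \<in> carrier A" "h \<in> carrier A" using that I' h by auto
    then have "(k \<oplus> neg h) \<oplus> (h \<oplus> x) = k \<oplus> ((neg h \<oplus> h) \<oplus> x)"
      using x by (simp add: add_assoc)
    then show ?thesis using c x by (simp add: neg_add)
  qed
  ultimately show ?thesis
    unfolding coset_eq using I' h by blast
qed

lemma self_mem_coset: "alg_ideal K A I \<Longrightarrow> x \<in> carrier A \<Longrightarrow> x \<in> I +> x"
  using add_zero unfolding coset_eq alg_ideal_iff by force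

lemma coset_eq_self_iff:
  assumes I: "alg_ideal K A I" and x: "x \<in> carrier A"
  shows "I +> x = I \<longleftrightarrow> x \<in> I"
proof
  show "x \<in> I" if "I +> x = I" using self_mem_coset[OF I x] that by simp
  assume "x \<in> I"
  moreover have "I +> \<zero> = I" using I by (force simp: coset_eq alg_ideal_iff)
  ultimately show "I +> x = I" using coset_absorb[OF I zero_closed, of x] x by simp
qed

text \<open>Products and multiples of cosets are unions over representatives. The point is that all
  representatives give the same coset and that there is at least one.\<close>

lemma algebra_epi_quotient:
  assumes I: "alg_ideal K A I"
  shows "algebra_epi K A (quotient_algebra A I) ((+>) I)"
proof -
  have I': "I \<subseteq> carrier A" "\<zero> \<in> I" "\<And>x y. x \<in> I \<Longrightarrow> y \<in> I \<Longrightarrow> x \<oplus> y \<in> I"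
    "\<And>a x. a \<in> K \<Longrightarrow> x \<in> I \<Longrightarrow> a \<odot> x \<in> I"
    "\<And>x y. x \<in> carrier A \<Longrightarrow> y \<in> I \<Longrightarrow> x \<otimes> y \<in> I" "\<And>x y. x \<in> carrier A \<Longrightarrow> y \<in> I \<Longrightarrow> y \<otimes> x \<in> I"
    using I by (auto simp: alg_ideal_iff)
  have ne: "I +> x \<noteq> {}" for x using I' by (auto simp: coset_eq)
  show ?thesis
  proof (rule algebra_epi.intro[OF complex_algebra_axioms], unfold_locales, goal_cases)
    case 1
    show ?case by (auto simp: quotient_algebra_def A_RCOSETS_def')
  next
    case 2
    show ?case using coset_eq_self_iff[OF I] I' by (simp add: quotient_algebra_def)
  next
    case (3 x y)
    have eq: "h \<oplus> x \<oplus> (k \<oplus> y) = (h \<oplus> k) \<oplus> (x \<oplus> y)" if "h \<in> I" "k \<in> I" for h k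
      using that I'(1) 3 by (auto simp: add_assoc add_left_commute subset_iff)
    have "I +> (x \<oplus> y) = (I +> x) <+> (I +> y)"
    proof
      show "I +> (x \<oplus> y) \<subseteq> (I +> x) <+> (I +> y)"
      proof
        fix z assume "z \<in> I +> (x \<oplus> y)"
        then obtain h where h: "h \<in> I" "z = h \<oplus> (x \<oplus> y)" by (auto simp: coset_eq)
        then have "z = (h \<oplus> x) \<oplus> (\<zero> \<oplus> y)"
          using 3 I'(1) by (auto simp: add_assoc)
        then show "z \<in> (I +> x) <+> (I +> y)"
          using h(1) I'(2) unfolding set_add_def' coset_eq by blast
      qed
      show "(I +> x) <+> (I +> y) \<subseteq> I +> (x \<oplus> y)"
        using eq I'(3) by (auto simp: set_add_def' coset_eq)
    qed
    then show ?case by (simp add: quotient_algebra_def)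
  next
    case (4 a x)
    have "I +> (a \<odot> z) = I +> (a \<odot> x)" if "z \<in> I +> x" for z
    proof -
      from that obtain h where "h \<in> I" "z = h \<oplus> x" by (auto simp: coset_eq)
      then show ?thesis
        using coset_absorb[OF I, of "a \<odot> x" "a \<odot> h"] 4 I' by (auto simp: smult_add_right)
    qed
    then show ?case using ne by (auto simp: quotient_algebra_def)
  next
    case (5 x y)
    have "I +> (z \<otimes> w) = I +> (x \<otimes> y)" if zw: "z \<in> I +> x" "w \<in> I +> y" for z w
    proof -
      obtain h where h: "h \<in> I" "z = h \<oplus> x" using zw by (auto simp: coset_eq)
      obtain k where k: "k \<in> I" "w = k \<oplus> y" using zw by (auto simp: coset_eq)
      have c: "h \<in> carrier A" "k \<in> carrier A" using h k I' by auto
      have "z \<otimes> w = ((h \<oplus> x) \<otimes> k \<oplus> h \<otimes> y) \<oplus> x \<otimes> y"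
        using h k c 5 by (simp add: mult_add_right mult_add_left add_assoc)
      moreover have "(h \<oplus> x) \<otimes> k \<oplus> h \<otimes> y \<in> I" using h k c 5 I' by auto
      ultimately show ?thesis using coset_absorb[OF I, of "x \<otimes> y"] 5 by simp
    qed
    then show ?case using ne by (auto simp: quotient_algebra_def rcoset_mult_def)
  qed
qed

lemma ker_quotient:
  "alg_ideal K A I \<Longrightarrow> algebra_epi.ker A (quotient_algebra A I) ((+>) I) = I"
  using algebra_epi.ker_def[OF algebra_epi_quotient, of I] coset_eq_self_iff[of I]
  by (auto simp: quotient_algebra_def alg_ideal_iff)

text \<open>The map is only asked to be additive, since Galois conjugation is not linear over the
  field of coefficients.\<close>

lemma image_coset:
  assumes I: "alg_ideal K A I" and x: "x \<in> carrier A" and f: "f ` I = I"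
    and add: "\<And>x y. x \<in> carrier A \<Longrightarrow> y \<in> carrier A \<Longrightarrow> f (x \<oplus> y) = f x \<oplus> f y"
  shows "f ` (I +> x) = I +> f x"
proof -
  have "f ` (I +> x) = {f h \<oplus> f x | h. h \<in> I}"
  proof -
    have "f (h \<oplus> x) = f h \<oplus> f x" if "h \<in> I" for h
      using that I x add by (auto simp: alg_ideal_iff)
    then show ?thesis unfolding coset_eq by (auto intro!: image_eqI)
  qed
  also have "\<dots> = {h \<oplus> f x | h. h \<in> f ` I}" by auto
  finally show ?thesis by (simp add: f coset_eq)
qed

end

lemma algebra_epi_trans:
  assumes "algebra_epi K A B \<pi>" "algebra_epi K B D \<pi>'"
  shows "algebra_epi K A D (\<lambda>x. \<pi>' (\<pi> x))"
proof -
  interpret p: algebra_epi K A B \<pi> by fact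
  interpret q: algebra_epi K B D \<pi>' by fact
  show ?thesis
    by unfold_locales (auto simp: p.map_zero p.map_add p.map_smult p.map_mult q.map_zero q.map_add
        q.map_smult q.map_mult p.image q.image image_image[symmetric])
qed

context algebra_epi
begin

text \<open>This flattens iterated quotients: generators of an ideal of the quotient are lifted and
  joined to generators of the kernel. Elements with the same image differ by the kernel, which the
  ideal generated upstairs contains.\<close>

lemma vimage_ideal_generated:
  assumes G: "G \<subseteq> carrier A" and G': "ker = ideal_generated K A G'" "G' \<subseteq> carrier A"
  shows "{x \<in> carrier A. \<pi> x \<in> ideal_generated K B (\<pi> ` G)} = ideal_generated K A (G' \<union> G)"
    (is "?l = ?r")
proof
  have r: "alg_ideal K A ?r" using G G' by (intro A.alg_ideal_ideal_generated) auto
  show "?l \<subseteq> ?r"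
  proof
    fix x assume "x \<in> ?l"
    moreover have "ideal_generated K B (\<pi> ` G) \<subseteq> \<pi> ` ?r"
      by (intro B.ideal_generated_least alg_ideal_image r image_mono) (auto intro: A.ideal_generated_base)
    ultimately obtain y where y: "x \<in> carrier A" "y \<in> ?r" "\<pi> x = \<pi> y" by auto
    then have "y \<in> carrier A" using r by (auto simp: A.alg_ideal_iff)
    then have "x \<oplus> A.neg y \<in> ideal_generated K A G'" using y by (simp add: map_eq_iff G')
    moreover have "ideal_generated K A G' \<subseteq> ?r" by (auto simp: ideal_generated_def)
    ultimately have "x \<oplus> A.neg y \<oplus> y \<in> ?r" using r y by (auto simp: A.alg_ideal_iff)
    then show "x \<in> ?r" using \<open>y \<in> carrier A\<close> y by (simp add: A.add_assoc A.neg_add)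
  qed
  have GB: "\<pi> ` G \<subseteq> carrier B" using G by auto
  have "ker \<subseteq> ?l"
    using B.alg_ideal_ideal_generated[OF GB] by (auto simp: ker_def B.alg_ideal_iff)
  moreover have "G' \<subseteq> ker" using A.ideal_generated_base G'(1) by blast
  moreover have "G \<subseteq> ?l" using G B.ideal_generated_base[of _ "\<pi> ` G"] by auto
  ultimately have "G' \<union> G \<subseteq> ?l" by blast
  then show "?r \<subseteq> ?l"
    by (intro A.ideal_generated_least alg_ideal_vimage B.alg_ideal_ideal_generated GB)
qed

end

lemma algebra_epi_quotient_trans:
  assumes "algebra_epi K A B \<pi>" "alg_ideal K B J"
  shows "algebra_epi K A (quotient_algebra B J) (\<lambda>x. J +>\<^bsub>B\<^esub> \<pi> x)"
    and "algebra_epi.ker A (quotient_algebra B J) (\<lambda>x. J +>\<^bsub>B\<^esub> \<pi> x) = {x \<in> carrier A. \<pi> x \<in> J}"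
proof -
  interpret p: algebra_epi K A B \<pi> by fact
  have q: "algebra_epi K B (quotient_algebra B J) ((+>\<^bsub>B\<^esub>) J)"
    by (rule p.B.algebra_epi_quotient) fact
  show *: "algebra_epi K A (quotient_algebra B J) (\<lambda>x. J +>\<^bsub>B\<^esub> \<pi> x)"
    by (rule algebra_epi_trans[OF assms(1) q])
  show "algebra_epi.ker A (quotient_algebra B J) (\<lambda>x. J +>\<^bsub>B\<^esub> \<pi> x) = {x \<in> carrier A. \<pi> x \<in> J}"
    using p.B.coset_eq_self_iff[OF assms(2)] algebra_epi.ker_def[OF *]
    by (auto simp: quotient_algebra_def)
qed

section \<open>The free magma algebra\<close>

definition scale :: "complex \<Rightarrow> ('b \<Rightarrow> complex) \<Rightarrow> 'b \<Rightarrow> complex" where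
  "scale a f = (\<lambda>t. a * f t)"

definition conv :: "('a magma \<Rightarrow> complex) \<Rightarrow> ('a magma \<Rightarrow> complex) \<Rightarrow> 'a magma \<Rightarrow> complex" where
  "conv f g = (\<lambda>t. case t of Gen a \<Rightarrow> 0 | Mul u v \<Rightarrow> f u * g v)"

definition single :: "'a magma \<Rightarrow> 'a magma \<Rightarrow> complex" where
  "single t = (\<lambda>s. if s = t then 1 else 0)"

definition free_carrier :: "complex set \<Rightarrow> 'a set \<Rightarrow> ('a magma \<Rightarrow> complex) set" where
  "free_carrier K S = {f. finite {t. f t \<noteq> 0} \<and> (\<forall>t. f t \<in> K) \<and> (\<forall>t. f t \<noteq> 0 \<longrightarrow> set_magma t \<subseteq> S)}"

lemma magma_algebra_simps [simp]:
  "carrier (magma_algebra K S) = free_carrier K S"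
  "monoid.mult (magma_algebra K S) = conv"
  "ring.zero (magma_algebra K S) = 0"
  "add (magma_algebra K S) = (+)"
  "module.smult (magma_algebra K S) = scale"
  by (auto simp: magma_algebra_def free_carrier_def conv_def scale_def fun_eq_iff)

lemma conv_simps [simp]: "conv f g (Gen a) = 0" "conv f g (Mul u v) = f u * g v"
  by (auto simp: conv_def)

lemma scale_apply [simp]: "scale a f t = a * f t"
  by (auto simp: scale_def)

lemma single_Mul: "single (Mul u v) = conv (single u) (single v)"
  by (rule ext, case_tac x) (auto simp: single_def)

lemma magma_fun_eqI:
  "(\<And>a. f (Gen a) = g (Gen a)) \<Longrightarrow> (\<And>u v. f (Mul u v) = g (Mul u v)) \<Longrightarrow> f = g"
  by (rule ext, case_tac x) auto

lemma conv_add_left: "conv (f + g) h = conv f h + conv g h"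
  and conv_add_right: "conv f (g + h) = conv f g + conv f h"
  and conv_scale_left: "conv (scale a f) g = scale a (conv f g)"
  and conv_scale_right: "conv f (scale a g) = scale a (conv f g)"
  and conv_zero_left [simp]: "conv 0 f = 0"
  and conv_zero_right [simp]: "conv f 0 = 0"
  by (rule magma_fun_eqI; simp add: algebra_simps)+

lemma scale_add: "scale a (f + g) = scale a f + scale a g"
  and scale_add_left: "scale (a + b) f = scale a f + scale b f"
  and scale_scale: "scale a (scale b f) = scale (a * b) f"
  and scale_one [simp]: "scale 1 f = f"
  and scale_zero [simp]: "scale 0 f = 0"
  and scale_zero_right [simp]: "scale a 0 = 0"
  and scale_minus_one: "scale (-1) f = - f"
  by (auto simp: fun_eq_iff algebra_simps)

lemma complex_algebra_magma:
  assumes K: "subfield K \<C>"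
  shows "complex_algebra K (magma_algebra K S)"
proof -
  note cl = subfield_complex_closed[OF K]
  have conv: "conv f g \<in> free_carrier K S" if "f \<in> free_carrier K S" "g \<in> free_carrier K S" for f g
  proof -
    have "{t. conv f g t \<noteq> 0} \<subseteq> (\<lambda>(u, v). Mul u v) ` ({t. f t \<noteq> 0} \<times> {t. g t \<noteq> 0})"
    proof
      fix t assume "t \<in> {t. conv f g t \<noteq> 0}"
      then show "t \<in> (\<lambda>(u, v). Mul u v) ` ({t. f t \<noteq> 0} \<times> {t. g t \<noteq> 0})"
        by (cases t) auto
    qed
    then have "finite {t. conv f g t \<noteq> 0}"
      using that by (auto simp: free_carrier_def intro: finite_subset)
    moreover have "conv f g t \<in> K" for t
      using that cl by (cases t) (auto simp: free_carrier_def)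
    moreover have "set_magma t \<subseteq> S" if "conv f g t \<noteq> 0" for t
      using that \<open>f \<in> _\<close> \<open>g \<in> _\<close> by (cases t) (auto simp: free_carrier_def)
    ultimately show ?thesis by (auto simp: free_carrier_def)
  qed
  have add: "f + g \<in> free_carrier K S" if "f \<in> free_carrier K S" "g \<in> free_carrier K S" for f g
  proof -
    have "{t. (f + g) t \<noteq> 0} \<subseteq> {t. f t \<noteq> 0} \<union> {t. g t \<noteq> 0}" by auto
    then have "finite {t. (f + g) t \<noteq> 0}"
      using that by (auto simp: free_carrier_def intro: finite_subset)
    moreover have "set_magma t \<subseteq> S" if "(f + g) t \<noteq> 0" for t
      using that \<open>f \<in> _\<close> \<open>g \<in> _\<close> by (cases "f t = 0") (auto simp: free_carrier_def)
    ultimately show ?thesis using cl that by (auto simp: free_carrier_def)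
  qed
  show ?thesis
  proof (rule complex_algebra.intro)
    show "a \<odot>\<^bsub>magma_algebra K S\<^esub> x \<in> carrier (magma_algebra K S)"
      if "a \<in> K" "x \<in> carrier (magma_algebra K S)" for a x
      using that cl by (auto simp: free_carrier_def elim!: finite_subset[rotated])
    show "\<zero>\<^bsub>magma_algebra K S\<^esub> \<in> carrier (magma_algebra K S)" using cl by (auto simp: free_carrier_def)
  qed (auto simp: K conv add algebra_simps conv_add_left conv_add_right conv_scale_left
      conv_scale_right scale_add scale_add_left scale_scale)
qed

lemma single_in_carrier [simp]:
  "subfield K \<C> \<Longrightarrow> set_magma t \<subseteq> S \<Longrightarrow> single t \<in> free_carrier K S"
  using subfield_complex_closed(1,2)[of K] by (auto simp: free_carrier_def single_def)

text \<open>One monomial of the support is removed at a time. The case of a monomial keeps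
  \<open>f t \<noteq> 0\<close>, so that restrictions on the support of \<open>f\<close> can be used
  there.\<close>

lemma free_carrier_span_induct [consumes 2, case_names zero add scale single]:
  assumes K: "subfield K \<C>" and f: "f \<in> free_carrier K S"
    and zero: "P 0"
    and add: "\<And>f g. f \<in> free_carrier K S \<Longrightarrow> g \<in> free_carrier K S \<Longrightarrow> P f \<Longrightarrow> P g \<Longrightarrow> P (f + g)"
    and scale: "\<And>a f. a \<in> K \<Longrightarrow> f \<in> free_carrier K S \<Longrightarrow> P f \<Longrightarrow> P (scale a f)"
    and single: "\<And>t. set_magma t \<subseteq> S \<Longrightarrow> f t \<noteq> 0 \<Longrightarrow> P (single t)"
  shows "P f"
proof -
  interpret complex_algebra K "magma_algebra K S" by (rule complex_algebra_magma[OF K])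
  have "P g" if "finite T" "g \<in> free_carrier K S" "{t. g t \<noteq> 0} \<subseteq> T" "\<And>t. g t \<noteq> 0 \<Longrightarrow> f t \<noteq> 0"
    for T g
    using that
  proof (induction T arbitrary: g)
    case empty
    then have "g = 0" by (auto simp: fun_eq_iff)
    then show ?case using zero by (simp only:)
  next
    case (insert t T)
    let ?h = "g(t := 0)"
    show ?case
    proof (cases "g t = 0")
      case True
      then show ?thesis using insert.IH[of g] insert.prems by auto
    next
      case False
      have t: "set_magma t \<subseteq> S" "g t \<in> K" using False insert.prems(1) by (auto simp: free_carrier_def)
      have "{s. ?h s \<noteq> 0} \<subseteq> {s. g s \<noteq> 0}" by auto
      then have h: "?h \<in> free_carrier K S"
        using insert.prems(1) K_closed(1) by (auto simp: free_carrier_def intro: finite_subset)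
      have "{s. ?h s \<noteq> 0} \<subseteq> T" "\<And>s. ?h s \<noteq> 0 \<Longrightarrow> f s \<noteq> 0"
        using insert.prems by (auto split: if_splits)
      then have "P ?h" by (rule insert.IH[OF h])
      moreover have "P (scale (g t) (single t))"
        using t False insert.prems(3) by (intro scale single) (auto simp: K)
      moreover have "scale (g t) (single t) \<in> free_carrier K S"
        using t smult_closed[of "g t" "single t"] K by simp
      ultimately have "P (?h + scale (g t) (single t))" using h by (intro add)
      also have "?h + scale (g t) (single t) = g" by (auto simp: fun_eq_iff single_def)
      finally show ?thesis .
    qed
  qed
  from this[of "{t. f t \<noteq> 0}" f] show ?thesis using f by (auto simp: free_carrier_def)
qed

lemma free_carrier_induct [consumes 2, case_names zero add scale conv Gen]:
  assumes K: "subfield K \<C>" and f: "f \<in> free_carrier K S"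
    and zero: "P 0"
    and add: "\<And>f g. f \<in> free_carrier K S \<Longrightarrow> g \<in> free_carrier K S \<Longrightarrow> P f \<Longrightarrow> P g \<Longrightarrow> P (f + g)"
    and scale: "\<And>a f. a \<in> K \<Longrightarrow> f \<in> free_carrier K S \<Longrightarrow> P f \<Longrightarrow> P (scale a f)"
    and conv: "\<And>f g. f \<in> free_carrier K S \<Longrightarrow> g \<in> free_carrier K S \<Longrightarrow> P f \<Longrightarrow> P g \<Longrightarrow> P (conv f g)"
    and Gen: "\<And>\<alpha>. \<alpha> \<in> S \<Longrightarrow> P (single (Gen \<alpha>))"
  shows "P f"
  using K f
proof (induction rule: free_carrier_span_induct)
  case (single t)
  from single(1) show ?case
  proof (induction t)
    case (Mul u v)
    then show ?case unfolding single_Mul by (intro conv) (auto simp: K)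
  qed (auto intro: Gen)
qed (blast intro: zero add scale)+

section \<open>The nilpotent Lie algebra as a quotient of the magma algebra\<close>

definition nonedge_brackets :: "'a set \<Rightarrow> 'a set set \<Rightarrow> ('a magma \<Rightarrow> complex) set" where
  "nonedge_brackets S E =
     {conv (single (Gen \<alpha>)) (single (Gen \<beta>)) | \<alpha> \<beta>. \<alpha> \<in> S \<and> \<beta> \<in> S \<and> {\<alpha>, \<beta>} \<notin> E}"

definition graph_kernel :: "complex set \<Rightarrow> 'a set \<Rightarrow> 'a set set \<Rightarrow> ('a magma \<Rightarrow> complex) set" where
  "graph_kernel K S E = ideal_generated K (magma_algebra K S)
     (lie_relators (magma_algebra K S) \<union> nonedge_brackets S E)"

text \<open>The term of the lower central series is in general not an ideal of the magma algebra, as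
  its products are nested to the right; it only contributes generators.\<close>

definition nil_kernel ::
  "complex set \<Rightarrow> 'a set \<Rightarrow> 'a set set \<Rightarrow> nat \<Rightarrow> ('a magma \<Rightarrow> complex) set" where
  "nil_kernel K S E c = ideal_generated K (magma_algebra K S)
     (lie_relators (magma_algebra K S) \<union> nonedge_brackets S E \<union> lower_central K (magma_algebra K S) (c + 1))"

definition graph_class where
  "graph_class K S E f = graph_ideal K S E +>\<^bsub>free_lie_algebra K S\<^esub> (lie_ideal K S +>\<^bsub>magma_algebra K S\<^esub> f)"

definition nil_class where
  "nil_class K S E c f =
     lower_central K (graph_lie_algebra K S E) (c + 1) +>\<^bsub>graph_lie_algebra K S E\<^esub> graph_class K S E f"

lemma nilpotent_vertex_eq: "nilpotent_vertex K S E c \<alpha> = nil_class K S E c (single (Gen \<alpha>))"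
  by (simp add: nilpotent_vertex_def nil_class_def graph_class_def free_vertex_def single_def)

locale nilpotent_graph_algebra =
  fixes K :: "complex set" and S :: "'a set" and E :: "'a set set" and c :: nat
  assumes subfield: "subfield K \<C>" and c_gt_1: "1 < c"
begin

abbreviation M where "M \<equiv> free_carrier K S"
abbreviation MA where "MA \<equiv> magma_algebra K S"
abbreviation LC where "LC \<equiv> lower_central K MA"
abbreviation NLA where "NLA \<equiv> nilpotent_lie_algebra K S E c"
abbreviation FLA where "FLA \<equiv> free_lie_algebra K S"
abbreviation GLA where "GLA \<equiv> graph_lie_algebra K S E"
abbreviation fcls where "fcls \<equiv> (+>\<^bsub>MA\<^esub>) (lie_ideal K S)"
abbreviation gcls where "gcls \<equiv> graph_class K S E"
abbreviation cls where "cls \<equiv> nil_class K S E c"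
abbreviation N where "N \<equiv> nil_kernel K S E c"

sublocale M: complex_algebra K MA
  rewrites "carrier MA = free_carrier K S"
    and "monoid.mult MA = conv"
    and "ring.zero MA = 0"
    and "add MA = (+)"
    and "module.smult MA = scale"
  using complex_algebra_magma[OF subfield] by simp_all

lemma lie_relators_subset: "lie_relators MA \<subseteq> M"
  by (auto simp: lie_relators_def)

lemma nonedge_brackets_subset: "nonedge_brackets S E \<subseteq> M"
  by (auto simp: nonedge_brackets_def subfield)

lemma lower_central_subset: "LC k \<subseteq> M"
  using M.submodule_lower_central[of k] by (auto simp: M.submodule_iff)

lemma alg_ideal_lie_ideal: "alg_ideal K MA (lie_ideal K S)"
  unfolding lie_ideal_def by (rule M.alg_ideal_ideal_generated[OF lie_relators_subset])

lemma alg_ideal_graph_kernel: "alg_ideal K MA (graph_kernel K S E)"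
  unfolding graph_kernel_def
  using lie_relators_subset nonedge_brackets_subset by (intro M.alg_ideal_ideal_generated) auto

lemma alg_ideal_nil_kernel: "alg_ideal K MA N"
  unfolding nil_kernel_def
  using lie_relators_subset nonedge_brackets_subset lower_central_subset
  by (intro M.alg_ideal_ideal_generated) auto

lemma free_epi: "algebra_epi K MA FLA fcls"
  unfolding free_lie_algebra_def by (rule M.algebra_epi_quotient[OF alg_ideal_lie_ideal])

lemma graph_ideal_eq:
  "graph_ideal K S E = ideal_generated K FLA
     (fcls ` nonedge_brackets S E)"
proof -
  interpret p: algebra_epi K MA FLA fcls
    by (rule free_epi)
  have "free_vertex K S \<alpha> \<otimes>\<^bsub>FLA\<^esub> free_vertex K S \<beta> =
    lie_ideal K S +>\<^bsub>MA\<^esub> conv (single (Gen \<alpha>)) (single (Gen \<beta>))"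
    if "\<alpha> \<in> S" "\<beta> \<in> S" for \<alpha> \<beta>
  proof -
    have *: "free_vertex K S \<alpha> = lie_ideal K S +>\<^bsub>MA\<^esub> single (Gen \<alpha>)" for \<alpha>
      by (simp add: free_vertex_def single_def)
    have "single (Gen \<alpha>) \<in> M" "single (Gen \<beta>) \<in> M" using that subfield by simp_all
    from p.map_mult[unfolded magma_algebra_simps, OF this] show ?thesis by (simp add: *)
  qed
  then have "{free_vertex K S \<alpha> \<otimes>\<^bsub>FLA\<^esub> free_vertex K S \<beta> | \<alpha> \<beta>.
        \<alpha> \<in> S \<and> \<beta> \<in> S \<and> {\<alpha>, \<beta>} \<notin> E} =
      {lie_ideal K S +>\<^bsub>MA\<^esub> conv (single (Gen \<alpha>)) (single (Gen \<beta>)) | \<alpha> \<beta>.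
        \<alpha> \<in> S \<and> \<beta> \<in> S \<and> {\<alpha>, \<beta>} \<notin> E}"
    by (intro Collect_cong) metis
  also have "\<dots> = fcls ` nonedge_brackets S E"
    unfolding nonedge_brackets_def by blast
  finally have "{free_vertex K S \<alpha> \<otimes>\<^bsub>FLA\<^esub> free_vertex K S \<beta> | \<alpha> \<beta>.
        \<alpha> \<in> S \<and> \<beta> \<in> S \<and> {\<alpha>, \<beta>} \<notin> E} =
      fcls ` nonedge_brackets S E" .
  then show ?thesis by (simp add: graph_ideal_def)
qed

lemma graph_ideal_vimage: "{f \<in> M. lie_ideal K S +>\<^bsub>MA\<^esub> f \<in> graph_ideal K S E} = graph_kernel K S E"
  and alg_ideal_graph_ideal: "alg_ideal K FLA (graph_ideal K S E)"
proof -
  interpret p: algebra_epi K MA FLA fcls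
    by (rule free_epi)
  have ker: "p.ker = ideal_generated K MA (lie_relators MA)"
    using M.ker_quotient[OF alg_ideal_lie_ideal]
    unfolding free_lie_algebra_def by (simp add: lie_ideal_def)
  show "{f \<in> M. lie_ideal K S +>\<^bsub>MA\<^esub> f \<in> graph_ideal K S E} = graph_kernel K S E"
    using p.vimage_ideal_generated[OF _ ker, of "nonedge_brackets S E"] lie_relators_subset nonedge_brackets_subset
    by (simp add: graph_ideal_eq graph_kernel_def)
  show "alg_ideal K FLA (graph_ideal K S E)"
    unfolding graph_ideal_eq using nonedge_brackets_subset
    by (intro p.B.alg_ideal_ideal_generated) auto
qed

lemma graph_epi: "algebra_epi K MA GLA (gcls)"
  and graph_epi_ker: "algebra_epi.ker MA GLA (gcls) = graph_kernel K S E"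
  using algebra_epi_quotient_trans[OF free_epi alg_ideal_graph_ideal] graph_ideal_vimage
  by (simp_all add: graph_lie_algebra_def graph_class_def[abs_def])

text \<open>Squares are relators in the magma algebra, so they vanish in the graph algebra, and
  there the terms of the series are ideals.\<close>

lemma alg_ideal_graph_lower_central:
  "alg_ideal K GLA (lower_central K GLA (c + 1))"
proof -
  interpret p: algebra_epi K MA GLA gcls
    by (rule graph_epi)
  have "conv f f \<in> p.ker" if "f \<in> M" for f
    unfolding graph_epi_ker graph_kernel_def using that
    by (intro M.ideal_generated_base) (auto simp: lie_relators_def)
  then have "x \<otimes>\<^bsub>GLA\<^esub> x = \<zero>\<^bsub>GLA\<^esub>"
    if "x \<in> carrier GLA" for x
    using that p.map_mult by (elim p.carrier_cases) (auto simp: p.ker_def)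
  then show ?thesis by (intro p.B.alg_ideal_lower_central) auto
qed

text \<open>As an ideal, this term is generated by itself, and it is the image of the corresponding
  term of the magma algebra. Hence the rule for pulling back generated ideals applies.\<close>

lemma graph_lower_central_vimage:
  "{f \<in> M. gcls f \<in> lower_central K GLA (c + 1)} = N"
proof -
  interpret p: algebra_epi K MA GLA gcls
    by (rule graph_epi)
  let ?I = "lower_central K GLA (c + 1)"
  have "ideal_generated K GLA ?I = ?I"
    using p.B.ideal_generated_least[OF alg_ideal_graph_lower_central order_refl]
      p.B.ideal_generated_base[of _ ?I] by blast
  then show ?thesis
    using p.vimage_ideal_generated[of "LC (c + 1)"
        "lie_relators MA \<union> nonedge_brackets S E"]
      lie_relators_subset nonedge_brackets_subset lower_central_subset[of "c + 1"]
    by (simp add: p.lower_central_image graph_epi_ker graph_kernel_def nil_kernel_def del: lower_central.simps)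
qed

lemma nil_epi: "algebra_epi K MA NLA (cls)"
  and nil_epi_ker: "algebra_epi.ker MA NLA (cls) = N"
  using algebra_epi_quotient_trans[OF graph_epi alg_ideal_graph_lower_central] graph_lower_central_vimage
  by (simp_all add: nilpotent_lie_algebra_def nil_class_def[abs_def])

sublocale nil: algebra_epi K MA NLA cls
  rewrites "carrier MA = free_carrier K S"
    and "monoid.mult MA = conv"
    and "ring.zero MA = 0"
    and "add MA = (+)"
    and "module.smult MA = scale"
    and "algebra_epi.ker MA NLA (cls) = N"
  using nil_epi nil_epi_ker by simp_all

section \<open>Calculation modulo the relations\<close>

lemma N_subset: "f \<in> N \<Longrightarrow> f \<in> M"
  and N_zero [simp]: "0 \<in> N"
  and N_add: "f \<in> N \<Longrightarrow> g \<in> N \<Longrightarrow> f + g \<in> N"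
  and N_scale: "a \<in> K \<Longrightarrow> f \<in> N \<Longrightarrow> scale a f \<in> N"
  and N_conv_right: "f \<in> M \<Longrightarrow> g \<in> N \<Longrightarrow> conv f g \<in> N"
  and N_conv_left: "f \<in> N \<Longrightarrow> g \<in> M \<Longrightarrow> conv f g \<in> N"
  using alg_ideal_nil_kernel by (auto simp: M.alg_ideal_iff)

lemma M_diff: "f \<in> M \<Longrightarrow> g \<in> M \<Longrightarrow> f - g \<in> M"
  and N_diff: "f \<in> N \<Longrightarrow> g \<in> N \<Longrightarrow> f - g \<in> N"
  using M.neg_closed[of g] N_scale[of "-1" g] M.K_closed(9) M.add_closed[of f "- g"] N_add[of f "- g"]
  by (auto simp: scale_minus_one)

lemma N_relator:
  "f \<in> lie_relators MA \<union> nonedge_brackets S E \<union>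
     LC (c + 1) \<Longrightarrow> f \<in> N"
  unfolding nil_kernel_def by (rule M.ideal_generated_base)

lemma N_square: "f \<in> M \<Longrightarrow> conv f f \<in> N"
  by (rule N_relator) (auto simp: lie_relators_def)

lemma N_jacobi: "f \<in> M \<Longrightarrow> g \<in> M \<Longrightarrow> h \<in> M \<Longrightarrow>
    conv f (conv g h) + conv g (conv h f) + conv h (conv f g) \<in> N"
  by (rule N_relator, rule UnI1, rule UnI1) (simp add: lie_relators_def, blast)

lemma N_nonedge:
  "\<alpha> \<in> S \<Longrightarrow> \<beta> \<in> S \<Longrightarrow> {\<alpha>, \<beta>} \<notin> E \<Longrightarrow> conv (single (Gen \<alpha>)) (single (Gen \<beta>)) \<in> N"
  by (rule N_relator) (auto simp: nonedge_brackets_def)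

lemma N_lower_central: "f \<in> LC (c + 1) \<Longrightarrow> f \<in> N"
  by (rule N_relator) blast

lemma N_anticommute:
  assumes "f \<in> M" "g \<in> M"
  shows "conv f g + conv g f \<in> N"
proof -
  have "conv (f + g) (f + g) - conv f f - conv g g \<in> N"
    using assms by (intro N_diff N_square) auto
  then show ?thesis by (simp add: conv_add_left conv_add_right algebra_simps)
qed

lemma N_swap: "f \<in> M \<Longrightarrow> g \<in> M \<Longrightarrow> conv f g \<in> N \<Longrightarrow> conv g f \<in> N"
  using N_diff[OF N_anticommute[of f g], of "conv f g"] by simp

lemma nil_class_eq_iff: "f \<in> M \<Longrightarrow> g \<in> M \<Longrightarrow> cls f = cls g \<longleftrightarrow> f - g \<in> N"
  using nil.map_eq_iff[of f g] by (simp add: scale_minus_one)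

section \<open>Coefficients of degree one and two\<close>

text \<open>From the second term on the series is spanned by products, and a product has no
  coefficient at a generator.\<close>

lemma lower_central_2: "f \<in> LC (Suc (Suc k)) \<Longrightarrow> f (Gen \<alpha>) = 0"
proof -
  have "submodule {f \<in> M. f (Gen \<alpha>) = 0} (\<C>\<lparr>carrier := K\<rparr>) MA"
    by (auto simp: M.submodule_iff)
  then have "LC (Suc (Suc k)) \<subseteq> {f \<in> M. f (Gen \<alpha>) = 0}"
    unfolding lower_central.simps using lower_central_subset[of "Suc k"] by (intro M.span_in_least) auto
  then show "f \<in> LC (Suc (Suc k)) \<Longrightarrow> f (Gen \<alpha>) = 0" by auto
qed

text \<open>At a product of two generators, a product of elements sees only the linear part of its
  right factor. That factor lies in the second or a later term, so it has no linear part.\<close>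

lemma lower_central_3:
  "f \<in> LC (Suc (Suc (Suc k))) \<Longrightarrow> f (Mul (Gen \<alpha>) (Gen \<beta>)) = 0"
proof -
  have "submodule {f \<in> M. f (Mul (Gen \<alpha>) (Gen \<beta>)) = 0} (\<C>\<lparr>carrier := K\<rparr>) MA"
    by (auto simp: M.submodule_iff)
  then have "LC (Suc (Suc (Suc k))) \<subseteq> {f \<in> M. f (Mul (Gen \<alpha>) (Gen \<beta>)) = 0}"
    unfolding lower_central.simps(3)[of _ _ "Suc k"]
    using lower_central_subset[of "Suc (Suc k)"] lower_central_2[of _ k]
    by (intro M.span_in_least) (auto simp del: lower_central.simps)
  then show "f \<in> LC (Suc (Suc (Suc k))) \<Longrightarrow> f (Mul (Gen \<alpha>) (Gen \<beta>)) = 0"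
    by auto
qed

text \<open>This is where \<open>c > 1\<close> is used.\<close>

lemma N_low_degree:
  assumes "f \<in> N"
  shows "f (Gen \<alpha>) = 0" "{\<alpha>, \<beta>} \<in> E \<Longrightarrow> f (Mul (Gen \<alpha>) (Gen \<beta>)) = f (Mul (Gen \<beta>) (Gen \<alpha>))"
proof -
  \<comment> \<open>This is an ideal: if one factor has no linear part, the product has no
    coefficient at a generator or at a product of two generators. It remains to inspect the
    generators of \<open>N\<close>.\<close>
  let ?Q = "{f \<in> M. (\<forall>\<alpha>. f (Gen \<alpha>) = 0) \<and>
    (\<forall>\<alpha> \<beta>. {\<alpha>, \<beta>} \<in> E \<longrightarrow> f (Mul (Gen \<alpha>) (Gen \<beta>)) = f (Mul (Gen \<beta>) (Gen \<alpha>)))}"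
  obtain k where k: "c + 1 = Suc (Suc (Suc k))" using c_gt_1 by (cases c; cases "c - 1") auto
  have "N \<subseteq> ?Q"
    unfolding nil_kernel_def
  proof (rule M.ideal_generated_least)
    show "alg_ideal K MA ?Q"
      unfolding M.alg_ideal_iff by (auto; metis)
    have "lie_relators MA \<subseteq> ?Q"
      using lie_relators_subset by (auto simp: lie_relators_def)
    moreover have "nonedge_brackets S E \<subseteq> ?Q"
      using nonedge_brackets_subset by (auto simp: nonedge_brackets_def single_def insert_commute)
    moreover have "LC (c + 1) \<subseteq> ?Q"
    proof
      fix f assume f: "f \<in> LC (c + 1)"
      show "f \<in> ?Q"
        using subsetD[OF lower_central_subset f] lower_central_2[OF f[unfolded k]]
          lower_central_3[OF f[unfolded k]] by simp
    qed
    ultimately show "lie_relators MA \<union> nonedge_brackets S E \<union>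
      LC (c + 1) \<subseteq> ?Q" by blast
  qed
  then show "f (Gen \<alpha>) = 0" "{\<alpha>, \<beta>} \<in> E \<Longrightarrow> f (Mul (Gen \<alpha>) (Gen \<beta>)) = f (Mul (Gen \<beta>) (Gen \<alpha>))"
    using assms by auto
qed

section \<open>Brackets across a separation of the vertices\<close>

text \<open>By the Jacobi identity, bracketing with a fixed element is a derivation modulo
  \<open>N\<close>. For a single vertex on the left, induction on \<open>t\<close> starts from the
  non-edges; induction on \<open>s\<close> with \<open>t\<close> fixed repeats the argument.\<close>

lemma N_disconnected:
  assumes U: "U \<subseteq> S" and disc: "\<And>\<alpha> \<beta>. \<alpha> \<in> U \<Longrightarrow> \<beta> \<in> S - U \<Longrightarrow> {\<alpha>, \<beta>} \<notin> E"
    and s: "set_magma s \<subseteq> U" and t: "set_magma t \<subseteq> S - U"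
  shows "conv (single s) (single t) \<in> N"
  using s
proof (induction s)
  case (Gen \<alpha>)
  then have \<alpha>: "\<alpha> \<in> U" "\<alpha> \<in> S" using U by auto
  let ?a = "single (Gen \<alpha>)"
  from t show ?case
  proof (induction t)
    case (Gen \<beta>)
    then show ?case using \<alpha> disc[of \<alpha> \<beta>] by (intro N_nonedge) auto
  next
    case (Mul u v)
    have M: "?a \<in> M" "single u \<in> M" "single v \<in> M"
      using Mul.prems \<alpha> by (auto intro!: single_in_carrier subfield)
    have "conv ?a (single u) \<in> N" "conv ?a (single v) \<in> N" using Mul by auto
    then have "conv (single v) (conv ?a (single u)) \<in> N" "conv (single u) (conv (single v) ?a) \<in> N"
      using N_conv_right[OF M(3)] N_conv_right[OF M(2) N_swap[OF M(1,3)]] by auto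
    from N_diff[OF N_diff[OF N_jacobi[of ?a "single u" "single v"] this(1)] this(2)]
    show ?case using M by (simp add: single_Mul algebra_simps)
  qed
next
  case (Mul u v)
  let ?t = "single t"
  have M: "?t \<in> M" "single u \<in> M" "single v \<in> M"
    using Mul.prems U t by (auto intro!: single_in_carrier subfield)
  have "conv (single u) ?t \<in> N" "conv (single v) ?t \<in> N" using Mul by auto
  then have "conv (single u) (conv (single v) ?t) \<in> N" "conv (single v) (conv ?t (single u)) \<in> N"
    using N_conv_right[OF M(2)] N_conv_right[OF M(3) N_swap[OF M(2,1)]] by auto
  from N_diff[OF N_diff[OF N_jacobi[of ?t "single u" "single v"] this(1)] this(2)]
  have "conv ?t (single (Mul u v)) \<in> N" using M by (simp add: single_Mul algebra_simps)
  then show ?case using M by (auto simp: single_Mul intro: N_swap[OF M(1)])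
qed

text \<open>Descend in the tree of a mixed monomial as long as some factor is mixed. At the end the
  two factors lie on opposite sides, so their product is in \<open>N\<close>, and the ideal property
  carries this back to the root.\<close>

lemma N_mixed:
  assumes U: "U \<subseteq> S" and disc: "\<And>\<alpha> \<beta>. \<alpha> \<in> U \<Longrightarrow> \<beta> \<in> S - U \<Longrightarrow> {\<alpha>, \<beta>} \<notin> E"
    and f: "f \<in> M" and mixed: "\<And>t. f t \<noteq> 0 \<Longrightarrow> \<not> set_magma t \<subseteq> U \<and> \<not> set_magma t \<subseteq> S - U"
  shows "f \<in> N"
  using subfield f
proof (induction rule: free_carrier_span_induct)
  case (single t)
  have "\<not> set_magma t \<subseteq> U \<and> \<not> set_magma t \<subseteq> S - U" using mixed single by auto
  with single(1) show ?case
  proof (induction t)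
    case (Mul u v)
    have M: "single u \<in> M" "single v \<in> M" using Mul.prems by (auto simp: subfield)
    consider "\<not> set_magma u \<subseteq> U \<and> \<not> set_magma u \<subseteq> S - U" | "\<not> set_magma v \<subseteq> U \<and> \<not> set_magma v \<subseteq> S - U"
      | "set_magma u \<subseteq> U" "set_magma v \<subseteq> S - U" | "set_magma v \<subseteq> U" "set_magma u \<subseteq> S - U"
      using Mul.prems by auto
    then have "conv (single u) (single v) \<in> N"
    proof cases
      case 1
      then show ?thesis using Mul M by (intro N_conv_left) auto
    next
      case 2
      then show ?thesis using Mul M by (intro N_conv_right) auto
    next
      case 3
      then show ?thesis by (intro N_disconnected[OF U disc])
    next
      case 4
      then have "conv (single v) (single u) \<in> N" by (intro N_disconnected[OF U disc])
      then show ?thesis by (rule N_swap[OF M(2,1)])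
    qed
    then show ?case by (simp add: single_Mul)
  qed auto
qed (blast intro: N_zero N_add N_scale)+

end

section \<open>Substitutions\<close>

text \<open>One operator for the three maps needed: Galois conjugation of the coefficients, relabelling
  of the vertices along the inverse of \<open>q\<close>, and projection onto the monomials in \<open>U\<close>.\<close>

definition subst ::
  "(complex \<Rightarrow> complex) \<Rightarrow> 'a set \<Rightarrow> ('a \<Rightarrow> 'a) \<Rightarrow> ('a magma \<Rightarrow> complex) \<Rightarrow> 'a magma \<Rightarrow> complex" where
  "subst \<sigma> U q f = (\<lambda>t. if set_magma t \<subseteq> U then \<sigma> (f (map_magma q t)) else 0)"

text \<open>The conditions concern \<open>K\<close> only, where all coefficients lie. Automorphisms
  of a subfield are given as functions on all complex numbers, with no algebraic meaning outside the
  subfield.\<close>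

definition endo_on :: "complex set \<Rightarrow> (complex \<Rightarrow> complex) \<Rightarrow> bool" where
  "endo_on K \<sigma> \<longleftrightarrow> (\<forall>x\<in>K. \<sigma> x \<in> K) \<and> (\<forall>x\<in>K. \<forall>y\<in>K. \<sigma> (x + y) = \<sigma> x + \<sigma> y \<and> \<sigma> (x * y) = \<sigma> x * \<sigma> y) \<and>
     \<sigma> 0 = 0 \<and> \<sigma> 1 = 1"

definition inverse_on :: "'a set \<Rightarrow> ('a \<Rightarrow> 'a) \<Rightarrow> ('a \<Rightarrow> 'a) \<Rightarrow> bool" where
  "inverse_on S p q \<longleftrightarrow> (\<forall>\<alpha>\<in>S. p \<alpha> \<in> S \<and> q \<alpha> \<in> S \<and> p (q \<alpha>) = \<alpha> \<and> q (p \<alpha>) = \<alpha>)"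

lemma inverse_on_sym: "inverse_on S p q \<Longrightarrow> inverse_on S q p"
  by (auto simp: inverse_on_def)

lemma map_magma_inverse_on:
  assumes "inverse_on S p q" "set_magma t \<subseteq> S"
  shows "map_magma p (map_magma q t) = t" "set_magma (map_magma q t) \<subseteq> S"
proof -
  have "map_magma (p \<circ> q) t = map_magma id t"
    using assms by (intro magma.map_cong) (auto simp: inverse_on_def)
  then show "map_magma p (map_magma q t) = t" by (simp add: magma.map_comp magma.map_id)
  show "set_magma (map_magma q t) \<subseteq> S" using assms by (auto simp: inverse_on_def magma.set_map)
qed

lemma subst_single:
  assumes "inverse_on S p q" "U \<subseteq> S" "\<alpha> \<in> S" "\<sigma> 0 = 0" "\<sigma> 1 = 1"
  shows "subst \<sigma> U q (single (Gen \<alpha>)) = (if p \<alpha> \<in> U then single (Gen (p \<alpha>)) else 0)"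
proof (rule ext)
  fix t
  show "subst \<sigma> U q (single (Gen \<alpha>)) t = (if p \<alpha> \<in> U then single (Gen (p \<alpha>)) else 0) t"
    using assms by (cases t) (auto simp: subst_def single_def inverse_on_def)
qed

lemma subst_conv: "endo_on K \<sigma> \<Longrightarrow> (\<And>t. f t \<in> K) \<Longrightarrow> (\<And>t. g t \<in> K) \<Longrightarrow>
    subst \<sigma> U q (conv f g) = conv (subst \<sigma> U q f) (subst \<sigma> U q g)"
  by (rule magma_fun_eqI) (auto simp: subst_def endo_on_def)

lemma subst_add: "endo_on K \<sigma> \<Longrightarrow> (\<And>t. f t \<in> K) \<Longrightarrow> (\<And>t. g t \<in> K) \<Longrightarrow>
    subst \<sigma> U q (f + g) = subst \<sigma> U q f + subst \<sigma> U q g"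
  by (auto simp: subst_def endo_on_def fun_eq_iff)

lemma subst_scale: "endo_on K \<sigma> \<Longrightarrow> a \<in> K \<Longrightarrow> (\<And>t. f t \<in> K) \<Longrightarrow>
    subst \<sigma> U q (scale a f) = scale (\<sigma> a) (subst \<sigma> U q f)"
  by (auto simp: subst_def endo_on_def fun_eq_iff)

lemma subst_zero: "endo_on K \<sigma> \<Longrightarrow> subst \<sigma> U q 0 = 0"
  by (auto simp: subst_def endo_on_def fun_eq_iff)

lemma image_vimage_on: "B \<subseteq> f ` A \<Longrightarrow> B = f ` {x \<in> A. f x \<in> B}"
  by blast

lemma free_carrierD:
  "f \<in> free_carrier K S \<Longrightarrow> f t \<in> K" "f \<in> free_carrier K S \<Longrightarrow> f t \<noteq> 0 \<Longrightarrow> set_magma t \<subseteq> S"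
  by (auto simp: free_carrier_def)

lemma subst_closed:
  assumes K: "subfield K \<C>" and \<sigma>: "endo_on K \<sigma>" and U: "U \<subseteq> S" and pq: "inverse_on S p q"
    and f: "f \<in> free_carrier K S"
  shows "subst \<sigma> U q f \<in> free_carrier K S"
proof -
  have "{t. subst \<sigma> U q f t \<noteq> 0} \<subseteq> map_magma p ` {t. f t \<noteq> 0}"
  proof
    fix t assume "t \<in> {t. subst \<sigma> U q f t \<noteq> 0}"
    then have "set_magma t \<subseteq> S" "f (map_magma q t) \<noteq> 0"
      using U \<sigma> by (auto simp: subst_def endo_on_def split: if_splits)
    then show "t \<in> map_magma p ` {t. f t \<noteq> 0}"
      using map_magma_inverse_on(1)[OF pq] by (force intro: image_eqI[of _ _ "map_magma q t"])
  qed
  then have "finite {t. subst \<sigma> U q f t \<noteq> 0}"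
    using f by (auto simp: free_carrier_def intro: finite_subset)
  moreover have "subst \<sigma> U q f t \<in> K" "subst \<sigma> U q f t \<noteq> 0 \<Longrightarrow> set_magma t \<subseteq> S" for t
    using f \<sigma> U subfield_complex_closed(1)[OF K]
    by (simp_all add: free_carrier_def subst_def endo_on_def split: if_splits)
  ultimately show ?thesis by (auto simp: free_carrier_def)
qed

context nilpotent_graph_algebra
begin

text \<open>As \<open>subst\<close> reads coefficients along \<open>q\<close>, it sends the
  generator of \<open>\<alpha>\<close> to that of \<open>p \<alpha>\<close>, or to zero if
  \<open>p \<alpha>\<close> lies outside \<open>U\<close>. The condition on non-edges is therefore
  put on \<open>p\<close>; it keeps the relators of the graph among the relators or kills
  them.\<close>

definition admissible where
  "admissible \<sigma> U p q \<longleftrightarrow> endo_on K \<sigma> \<and> U \<subseteq> S \<and> inverse_on S p q \<and>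
     (\<forall>\<alpha>\<in>S. \<forall>\<beta>\<in>S. {\<alpha>, \<beta>} \<notin> E \<longrightarrow> {p \<alpha>, p \<beta>} \<notin> E)"

context
  fixes \<sigma> U p q
  assumes adm: "admissible \<sigma> U p q"
begin

abbreviation "\<theta> \<equiv> subst \<sigma> U q"

lemma subst_M [simp]: "f \<in> M \<Longrightarrow> \<theta> f \<in> M"
  using adm subst_closed[OF subfield, of \<sigma> U S p q f] by (auto simp: admissible_def)

lemma subst_M_hom:
  shows subst_M_conv: "f \<in> M \<Longrightarrow> g \<in> M \<Longrightarrow> \<theta> (conv f g) = conv (\<theta> f) (\<theta> g)"
    and subst_M_add: "f \<in> M \<Longrightarrow> g \<in> M \<Longrightarrow> \<theta> (f + g) = \<theta> f + \<theta> g"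
    and subst_M_scale: "a \<in> K \<Longrightarrow> f \<in> M \<Longrightarrow> \<theta> (scale a f) = scale (\<sigma> a) (\<theta> f)"
    and subst_M_zero: "\<theta> 0 = 0"
  using adm subst_conv[of K \<sigma> f g U q] subst_add[of K \<sigma> f g U q] subst_scale[of K \<sigma> a f U q]
    subst_zero[of K \<sigma> U q]
  by (auto simp: admissible_def free_carrierD)

lemma subst_M_diff: "f \<in> M \<Longrightarrow> g \<in> M \<Longrightarrow> \<theta> (f - g) = \<theta> f - \<theta> g"
  using subst_M_add[of "f - g" g] M_diff[of f g] by simp

lemma subst_M_single:
  "\<alpha> \<in> S \<Longrightarrow> \<theta> (single (Gen \<alpha>)) = (if p \<alpha> \<in> U then single (Gen (p \<alpha>)) else 0)"
  using adm by (intro subst_single) (auto simp: admissible_def endo_on_def)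

lemma subst_lie_relators: "f \<in> lie_relators MA \<Longrightarrow> \<theta> f \<in> lie_relators MA"
  unfolding lie_relators_def magma_algebra_simps
proof (elim UnE CollectE exE conjE)
  fix x assume "f = conv x x" "x \<in> M"
  then have "\<theta> f = conv (\<theta> x) (\<theta> x)" "\<theta> x \<in> M" by (auto simp: subst_M_conv)
  then show "\<theta> f \<in> {conv x x |x. x \<in> M} \<union> {conv x (conv y z) + conv y (conv z x) + conv z (conv x y) |x y z.
      x \<in> M \<and> y \<in> M \<and> z \<in> M}" by blast
next
  fix x y z assume "f = conv x (conv y z) + conv y (conv z x) + conv z (conv x y)" "x \<in> M" "y \<in> M" "z \<in> M"
  then have "\<theta> f = conv (\<theta> x) (conv (\<theta> y) (\<theta> z)) + conv (\<theta> y) (conv (\<theta> z) (\<theta> x)) + conv (\<theta> z) (conv (\<theta> x) (\<theta> y))"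
    "\<theta> x \<in> M" "\<theta> y \<in> M" "\<theta> z \<in> M"
    by (simp_all add: subst_M_conv subst_M_add)
  then show "\<theta> f \<in> {conv x x |x. x \<in> M} \<union> {conv x (conv y z) + conv y (conv z x) + conv z (conv x y) |x y z.
      x \<in> M \<and> y \<in> M \<and> z \<in> M}" by blast
qed

lemma subst_nonedge_brackets: "f \<in> nonedge_brackets S E \<Longrightarrow> \<theta> f \<in> insert 0 (nonedge_brackets S E)"
proof -
  assume "f \<in> nonedge_brackets S E"
  then obtain \<alpha> \<beta> where ab: "\<alpha> \<in> S" "\<beta> \<in> S" "{\<alpha>, \<beta>} \<notin> E" and f: "f = conv (single (Gen \<alpha>)) (single (Gen \<beta>))"
    by (auto simp: nonedge_brackets_def)
  then have pq: "p \<alpha> \<in> S" "p \<beta> \<in> S" "{p \<alpha>, p \<beta>} \<notin> E"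
    using adm by (auto simp: admissible_def inverse_on_def)
  have "\<theta> f = conv (\<theta> (single (Gen \<alpha>))) (\<theta> (single (Gen \<beta>)))"
    using ab unfolding f by (intro subst_M_conv) (auto simp: subfield)
  then show ?thesis using pq ab by (auto simp: subst_M_single nonedge_brackets_def)
qed

text \<open>Semilinearity is enough: a scalar \<open>a\<close> comes out as
  \<open>\<sigma> a\<close>, which again lies in \<open>K\<close>.\<close>

lemma alg_ideal_subst_vimage:
  assumes "alg_ideal K MA I"
  shows "alg_ideal K MA {f \<in> M. \<theta> f \<in> I}"
  using assms adm
  by (auto simp: M.alg_ideal_iff subst_M_zero subst_M_add subst_M_scale subst_M_conv admissible_def endo_on_def)

lemma subst_lower_central:
  "f \<in> LC k \<Longrightarrow> \<theta> f \<in> LC k"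
proof (induction k arbitrary: f)
  case (Suc k)
  show ?case
  proof (cases "k = 0")
    case False
    let ?I = "LC (Suc k)"
    have sub: "submodule ?I (\<C>\<lparr>carrier := K\<rparr>) MA"
      by (rule M.submodule_lower_central)
    have "?I \<subseteq> {f \<in> M. \<theta> f \<in> ?I}"
      unfolding M.lower_central_Suc[OF False]
    proof (rule M.span_in_least; unfold M.lower_central_Suc[OF False, symmetric])
      show "submodule {f \<in> M. \<theta> f \<in> ?I} (\<C>\<lparr>carrier := K\<rparr>) MA"
        using sub adm
        by (auto simp: M.submodule_iff subst_M_zero subst_M_add subst_M_scale admissible_def endo_on_def)
      show "{conv x y |x y. x \<in> M \<and> y \<in> LC k} \<subseteq> {f \<in> M. \<theta> f \<in> ?I}"
      proof clarify
        fix x y assume xy: "x \<in> M" "y \<in> LC k"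
        then have "y \<in> M" using lower_central_subset by blast
        with xy show "conv x y \<in> M \<and> \<theta> (conv x y) \<in> ?I"
          using M.lower_central_mult[OF False, of "\<theta> x" "\<theta> y"] Suc.IH[OF xy(2)]
          by (simp add: subst_M_conv del: lower_central.simps)
      qed
    qed
    then show ?thesis using Suc.prems by blast
  qed (use Suc.prems in auto)
qed auto

lemma subst_ideal_generated:
  assumes "B \<subseteq> M" "\<And>f. f \<in> B \<Longrightarrow> \<theta> f \<in> insert 0 B" "f \<in> ideal_generated K MA B"
  shows "\<theta> f \<in> ideal_generated K MA B"
proof -
  let ?I = "ideal_generated K MA B"
  have I: "alg_ideal K MA ?I" by (rule M.alg_ideal_ideal_generated) fact
  then have "insert 0 B \<subseteq> ?I" using M.ideal_generated_base[of _ B] by (auto simp: M.alg_ideal_iff)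
  then have "?I \<subseteq> {f \<in> M. \<theta> f \<in> ?I}"
    using assms by (intro M.ideal_generated_least alg_ideal_subst_vimage I) blast
  then show ?thesis using assms(3) by blast
qed

lemma subst_lie_ideal: "f \<in> lie_ideal K S \<Longrightarrow> \<theta> f \<in> lie_ideal K S"
  unfolding lie_ideal_def
  by (rule subst_ideal_generated[OF lie_relators_subset]) (auto dest: subst_lie_relators)

lemma subst_graph_kernel: "f \<in> graph_kernel K S E \<Longrightarrow> \<theta> f \<in> graph_kernel K S E"
  unfolding graph_kernel_def using lie_relators_subset nonedge_brackets_subset
  by (elim subst_ideal_generated[rotated 2])
    (auto dest: subst_lie_relators subst_nonedge_brackets)

lemma subst_N: "f \<in> N \<Longrightarrow> \<theta> f \<in> N"
  unfolding nil_kernel_def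
  using lie_relators_subset nonedge_brackets_subset lower_central_subset[of "c + 1"]
  by (elim subst_ideal_generated[rotated 2])
    (auto dest: subst_lie_relators subst_nonedge_brackets subst_lower_central simp del: lower_central.simps)

end

subsection \<open>The Galois action\<close>

context
  fixes \<sigma> \<tau> :: "complex \<Rightarrow> complex"
  assumes \<sigma>: "endo_on K \<sigma>" and \<tau>: "endo_on K \<tau>" and \<sigma>\<tau>: "inverse_on K \<sigma> \<tau>"
begin

lemma comp_eq_subst:
  assumes "endo_on K \<sigma>'" "f \<in> M"
  shows "\<sigma>' \<circ> f = subst \<sigma>' S id f"
proof (rule ext)
  fix t
  have "\<not> set_magma t \<subseteq> S \<Longrightarrow> f t = 0" using free_carrierD(2)[OF assms(2)] by blast
  then show "(\<sigma>' \<circ> f) t = subst \<sigma>' S id f t"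
    using assms(1) by (simp add: subst_def magma.map_id endo_on_def)
qed

lemma admissible_conjugation: "endo_on K \<sigma>' \<Longrightarrow> admissible \<sigma>' S id id"
  by (auto simp: admissible_def inverse_on_def)

lemma conjugation_M: "f \<in> M \<Longrightarrow> \<sigma> \<circ> f \<in> M"
  using subst_M[OF admissible_conjugation[OF \<sigma>]] by (simp add: comp_eq_subst \<sigma>)

text \<open>The image of a coset is a coset only if the ideal is mapped onto itself; for the reverse
  inclusion, conjugate by the inverse \<open>\<tau>\<close>.\<close>

lemma conjugation_image:
  assumes "I \<subseteq> M" and inv: "\<And>\<sigma>' f. endo_on K \<sigma>' \<Longrightarrow> f \<in> I \<Longrightarrow> subst \<sigma>' S id f \<in> I"
  shows "(\<lambda>f. \<sigma> \<circ> f) ` I = I"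
proof
  show "(\<lambda>f. \<sigma> \<circ> f) ` I \<subseteq> I" using assms \<sigma> by (auto simp: comp_eq_subst subset_iff)
  show "I \<subseteq> (\<lambda>f. \<sigma> \<circ> f) ` I"
  proof
    fix f assume f: "f \<in> I"
    then have "\<tau> \<circ> f \<in> I" using assms \<tau> by (auto simp: comp_eq_subst subset_iff)
    moreover have "\<sigma> \<circ> (\<tau> \<circ> f) = f"
      using \<sigma>\<tau> assms f by (auto simp: fun_eq_iff inverse_on_def free_carrierD(1) subset_iff)
    ultimately show "f \<in> (\<lambda>f. \<sigma> \<circ> f) ` I" by (metis imageI)
  qed
qed

text \<open>The action takes images at three levels of nesting. At each level the ideal divided out
  is mapped onto itself, so cosets go to cosets of the images. At the upper two levels that ideal is
  the image of \<open>graph_kernel\<close> or of \<open>N\<close>, whose invariance is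
  known.\<close>

lemma galois_action_nil_class:
  assumes f: "f \<in> M"
  shows "galois_action \<sigma> (cls f) = cls (\<sigma> \<circ> f)"
proof -
  let ?F = "\<lambda>f. \<sigma> \<circ> f"
  let ?p1 = fcls
  interpret p1: algebra_epi K MA FLA ?p1
    by (rule free_epi)
  interpret p2: algebra_epi K MA GLA gcls
    by (rule graph_epi)
  have add: "?F (f + g) = ?F f + ?F g" if "f \<in> M" "g \<in> M" for f g
    using that \<sigma> by (auto simp: fun_eq_iff endo_on_def free_carrierD(1))
  have LI: "?F ` lie_ideal K S = lie_ideal K S"
    using alg_ideal_lie_ideal
    by (intro conjugation_image subst_lie_ideal[OF admissible_conjugation]) (auto simp: M.alg_ideal_iff)
  have GK: "?F ` graph_kernel K S E = graph_kernel K S E"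
    using alg_ideal_graph_kernel
    by (intro conjugation_image subst_graph_kernel[OF admissible_conjugation]) (auto simp: M.alg_ideal_iff)
  have N: "?F ` N = N"
    by (intro conjugation_image subst_N[OF admissible_conjugation]) (auto simp: N_subset)
  have 1: "(`) ?F (?p1 f) = ?p1 (?F f)" if "f \<in> M" for f
    using M.image_coset[OF alg_ideal_lie_ideal that LI] add by simp
  have GI: "(`) ((`) ?F) (graph_ideal K S E) = graph_ideal K S E"
  proof -
    have "graph_ideal K S E \<subseteq> carrier FLA"
      using alg_ideal_graph_ideal by (auto simp: p1.B.alg_ideal_iff)
    then have "graph_ideal K S E \<subseteq> ?p1 ` M" using p1.image by auto
    from image_vimage_on[OF this] have eq: "graph_ideal K S E = ?p1 ` graph_kernel K S E"
      by (simp only: graph_ideal_vimage)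
    have "(`) ((`) ?F) (graph_ideal K S E) = (\<lambda>f. ?p1 (?F f)) ` graph_kernel K S E"
      unfolding eq image_image
    proof (rule image_cong[OF refl])
      show "(`) ?F (?p1 f) = ?p1 (?F f)" if "f \<in> graph_kernel K S E" for f
        using alg_ideal_graph_kernel that by (intro 1) (auto simp: M.alg_ideal_iff)
    qed
    also have "\<dots> = ?p1 ` (?F ` graph_kernel K S E)" by (rule image_image[symmetric])
    also have "\<dots> = graph_ideal K S E" unfolding GK by (rule eq[symmetric])
    finally show ?thesis .
  qed
  have 2: "(`) ((`) ?F) (gcls f) = gcls (?F f)" if "f \<in> M" for f
    unfolding graph_class_def 1[OF that, symmetric]
  proof (rule p1.B.image_coset[OF alg_ideal_graph_ideal _ GI])
    show "?p1 f \<in> carrier FLA" using that by (auto intro: p1.image_closed)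
    fix x y assume "x \<in> carrier FLA" "y \<in> carrier FLA"
    then obtain f g where fg: "f \<in> M" "g \<in> M" "x = ?p1 f" "y = ?p1 g"
      unfolding p1.image[symmetric] magma_algebra_simps by (elim imageE)
    then have "(`) ?F (x \<oplus>\<^bsub>FLA\<^esub> y) = ?p1 (?F f + ?F g)"
      using p1.map_add[of f g] 1[of "f + g"] add[of f g] by simp
    also have "\<dots> = (`) ?F x \<oplus>\<^bsub>FLA\<^esub> (`) ?F y"
      using fg p1.map_add[of "?F f" "?F g"] 1 conjugation_M by simp
    finally show "(`) ?F (x \<oplus>\<^bsub>FLA\<^esub> y) = (`) ?F x \<oplus>\<^bsub>FLA\<^esub> (`) ?F y" .
  qed
  let ?LC = "lower_central K GLA (c + 1)"
  have LC: "(`) ((`) ((`) ?F)) ?LC = ?LC"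
  proof -
    have "?LC \<subseteq> carrier GLA"
      using alg_ideal_graph_lower_central by (auto simp: p2.B.alg_ideal_iff)
    then have "?LC \<subseteq> gcls ` M" using p2.image by auto
    from image_vimage_on[OF this] have eq: "?LC = gcls ` N"
      by (simp only: graph_lower_central_vimage)
    have "(`) ((`) ((`) ?F)) ?LC = (\<lambda>f. gcls (?F f)) ` N"
      unfolding eq image_image
    proof (rule image_cong[OF refl])
      show "(`) ((`) ?F) (gcls f) = gcls (?F f)" if "f \<in> N" for f
        using that by (intro 2 N_subset)
    qed
    also have "\<dots> = gcls ` (?F ` N)" by (rule image_image[symmetric])
    also have "\<dots> = ?LC" unfolding N by (rule eq[symmetric])
    finally show ?thesis .
  qed
  show ?thesis
    unfolding galois_action_def nil_class_def 2[OF f, symmetric]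
  proof (rule p2.B.image_coset[OF alg_ideal_graph_lower_central _ LC])
    let ?p2 = gcls
    show "?p2 f \<in> carrier GLA" using f by (auto intro: p2.image_closed)
    fix x y assume "x \<in> carrier GLA" "y \<in> carrier GLA"
    then obtain f g where fg: "f \<in> M" "g \<in> M" "x = ?p2 f" "y = ?p2 g"
      unfolding p2.image[symmetric] magma_algebra_simps by (elim imageE)
    then have "(`) ((`) ?F) (x \<oplus>\<^bsub>GLA\<^esub> y) = ?p2 (?F f + ?F g)"
      using p2.map_add[of f g] 2[of "f + g"] add[of f g] by simp
    also have "\<dots> = (`) ((`) ?F) x \<oplus>\<^bsub>GLA\<^esub> (`) ((`) ?F) y"
      using fg p2.map_add[of "?F f" "?F g"] 2 conjugation_M by simp
    finally show "(`) ((`) ?F) (x \<oplus>\<^bsub>GLA\<^esub> y) =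
        (`) ((`) ?F) x \<oplus>\<^bsub>GLA\<^esub> (`) ((`) ?F) y" .
  qed
qed

end

subsection \<open>Automorphisms induced by graph automorphisms\<close>

text \<open>The vertices generate the algebra, and membership in \<open>Bij\<close> fixes the values
  outside the carrier, so the functions are equal everywhere. This is the uniqueness behind the
  definite description in \<open>lift_aut\<close>.\<close>

lemma algebra_aut_eqI:
  assumes F: "F \<in> algebra_aut K NLA" and G: "G \<in> algebra_aut K NLA"
    and eq: "\<And>\<alpha>. \<alpha> \<in> S \<Longrightarrow> F (nilpotent_vertex K S E c \<alpha>) = G (nilpotent_vertex K S E c \<alpha>)"
  shows "F = G"
proof (rule extensionalityI)
  show "F \<in> extensional (carrier NLA)" "G \<in> extensional (carrier NLA)"
    using F G by (auto simp: algebra_aut_def Bij_def)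
  fix v assume "v \<in> carrier NLA"
  then obtain f where f: "f \<in> M" "v = cls f" by (rule nil.carrier_cases)
  have smult: "F (a \<odot>\<^bsub>NLA\<^esub> x) = a \<odot>\<^bsub>NLA\<^esub> F x"
    "G (a \<odot>\<^bsub>NLA\<^esub> x) = a \<odot>\<^bsub>NLA\<^esub> G x"
    if "a \<in> K" "x \<in> carrier NLA" for a x
    using F G that by (auto simp: algebra_aut_def)
  from subfield f(1) have "F (cls f) = G (cls f)"
  proof (induction rule: free_carrier_induct)
    case zero
    have "H \<zero>\<^bsub>NLA\<^esub> = \<zero>\<^bsub>NLA\<^esub>" if "H \<in> algebra_aut K NLA" for H
    proof -
      have "H \<zero>\<^bsub>NLA\<^esub> \<in> carrier NLA"
        using that nil.B.zero_closed by (auto simp: algebra_aut_def Bij_def bij_betw_def)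
      moreover have "H (0 \<odot>\<^bsub>NLA\<^esub> \<zero>\<^bsub>NLA\<^esub>) = 0 \<odot>\<^bsub>NLA\<^esub> H \<zero>\<^bsub>NLA\<^esub>"
        using that M.K_closed(1) nil.B.zero_closed unfolding algebra_aut_def by blast
      ultimately show ?thesis
        using nil.B.smult_zero[of "H \<zero>\<^bsub>NLA\<^esub>"] nil.B.smult_zero[OF nil.B.zero_closed] by simp
    qed
    from this[OF F] this[OF G] have "F \<zero>\<^bsub>NLA\<^esub> = G \<zero>\<^bsub>NLA\<^esub>" by simp
    then show ?case by (simp only: nil.map_zero)
  next
    case (add f g)
    then show ?case using F G nil.image_closed[of f] nil.image_closed[of g]
      by (simp only: nil.map_add) (simp add: algebra_aut_def)
  next
    case (scale a f)
    then show ?case using smult nil.image_closed[of f]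
      by (simp only: nil.map_smult)
  next
    case (conv f g)
    then show ?case using F G nil.image_closed[of f] nil.image_closed[of g]
      by (simp only: nil.map_mult) (simp add: algebra_aut_def)
  next
    case (Gen \<alpha>)
    then show ?case using eq by (simp only: nilpotent_vertex_eq)
  qed
  then show "F v = G v" by (simp add: f)
qed

text \<open>The choice of a representative does not matter because relabelling preserves
  \<open>N\<close>. Relabelling along the inverse bijection yields injectivity and
  surjectivity.\<close>

lemma graph_aut_induces:
  assumes pq: "admissible id S p q" and qp: "admissible id S q p"
  defines "F \<equiv> restrict (\<lambda>v. cls (subst id S q (SOME f. f \<in> M \<and> v = cls f)))
    (carrier NLA)"
  shows "F \<in> algebra_aut K NLA"
    and "\<And>f. f \<in> M \<Longrightarrow> F (cls f) = cls (subst id S q f)"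
proof -
  show F: "F (cls f) = cls (subst id S q f)" if f: "f \<in> M" for f
  proof -
    let ?g = "SOME g. g \<in> M \<and> cls f = cls g"
    have g: "?g \<in> M \<and> cls f = cls ?g" by (rule someI[of _ f]) (simp add: f)
    then have "f - ?g \<in> N" using f nil_class_eq_iff by blast
    then have "subst id S q f - subst id S q ?g \<in> N"
      using subst_N[OF pq, of "f - ?g"] subst_M_diff[OF pq f, of ?g] g by simp
    then have "cls (subst id S q f) = cls (subst id S q ?g)"
      using nil_class_eq_iff subst_M[OF pq] f g by blast
    then show ?thesis using f nil.image_closed by (simp add: F_def)
  qed
  have inv: "subst id S q (subst id S p f) = f" "subst id S p (subst id S q f) = f" if "f \<in> M" for f
  proof -
    have "set_magma t \<subseteq> S \<Longrightarrow> map_magma p (map_magma q t) = t"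
      "set_magma t \<subseteq> S \<Longrightarrow> map_magma q (map_magma p t) = t"
      "set_magma t \<subseteq> S \<Longrightarrow> set_magma (map_magma q t) \<subseteq> S"
      "set_magma t \<subseteq> S \<Longrightarrow> set_magma (map_magma p t) \<subseteq> S" for t
      using map_magma_inverse_on[of S p q t] map_magma_inverse_on[of S q p t] pq qp
      by (auto simp: admissible_def)
    moreover have "\<not> set_magma t \<subseteq> S \<Longrightarrow> f t = 0" for t
      using free_carrierD(2)[OF that] by blast
    ultimately show "subst id S q (subst id S p f) = f" "subst id S p (subst id S q f) = f"
      by (auto simp: subst_def fun_eq_iff simp del: subset_iff)
  qed
  show "F \<in> algebra_aut K NLA"
    unfolding algebra_aut_def
  proof (intro CollectI conjI ballI)
    have "inj_on F (carrier NLA)"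
    proof (rule inj_onI)
      fix x y assume xy: "x \<in> carrier NLA" "y \<in> carrier NLA" and eq: "F x = F y"
      then obtain f g where fg: "f \<in> M" "x = cls f" "g \<in> M" "y = cls g" by (metis nil.carrier_cases)
      then have "subst id S q (f - g) \<in> N"
        using eq subst_M[OF pq] by (simp add: F nil_class_eq_iff subst_M_diff[OF pq])
      then have "subst id S p (subst id S q (f - g)) \<in> N" by (rule subst_N[OF qp])
      then show "x = y" using fg by (simp add: inv M_diff nil_class_eq_iff)
    qed
    moreover have "F ` carrier NLA = carrier NLA"
    proof
      show "F ` carrier NLA \<subseteq> carrier NLA"
        using F subst_M[OF pq] nil.image_closed by (auto elim!: nil.carrier_cases)
      show "carrier NLA \<subseteq> F ` carrier NLA"
      proof
        fix x assume "x \<in> carrier NLA"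
        then obtain f where f: "f \<in> M" "x = cls f" by (metis nil.carrier_cases)
        then have "x = F (cls (subst id S p f))" using subst_M[OF qp] by (simp add: F inv)
        then show "x \<in> F ` carrier NLA" using f subst_M[OF qp] nil.image_closed by blast
      qed
    qed
    ultimately show "F \<in> Bij (carrier NLA)" by (auto simp: Bij_def bij_betw_def F_def)
  next
    fix x y assume "x \<in> carrier NLA" "y \<in> carrier NLA"
    then obtain f g where fg: "f \<in> M" "x = cls f" "g \<in> M" "y = cls g" by (metis nil.carrier_cases)
    show "F (x \<oplus>\<^bsub>NLA\<^esub> y) = F x \<oplus>\<^bsub>NLA\<^esub> F y" "F (x \<otimes>\<^bsub>NLA\<^esub> y) = F x \<otimes>\<^bsub>NLA\<^esub> F y"
      using fg subst_M[OF pq]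
      by (simp_all add: F nil.map_add[symmetric] nil.map_mult[symmetric] subst_M_add[OF pq] subst_M_conv[OF pq])
  next
    fix a x assume "a \<in> K" "x \<in> carrier NLA"
    then obtain f where fg: "f \<in> M" "x = cls f" by (metis nil.carrier_cases)
    with \<open>a \<in> K\<close> show "F (a \<odot>\<^bsub>NLA\<^esub> x) = a \<odot>\<^bsub>NLA\<^esub> F x"
      using subst_M[OF pq] by (simp add: F nil.map_smult[symmetric] subst_M_scale[OF pq])
  qed
qed

end

section \<open>Automorphisms of the quotient graph\<close>

definition coherent_rel :: "'a set \<Rightarrow> 'a set set \<Rightarrow> ('a \<times> 'a) set" where
  "coherent_rel S E = {(\<alpha>, \<beta>) \<in> S \<times> S. dominated S E \<alpha> \<beta> \<and> dominated S E \<beta> \<alpha>}"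

definition connected_rel :: "'a set \<Rightarrow> 'a set set \<Rightarrow> ('a \<times> 'a) set" where
  "connected_rel S E = {(\<alpha>, \<beta>) \<in> S \<times> S. (\<alpha>, \<beta>) \<in> {(x, y). {x, y} \<in> E}\<^sup>*}"

text \<open>The permutation of \<open>S\<close> that underlies the automorphism attached to
  \<open>\<phi>\<close>: a vertex goes to the vertex in the same position of the image
  class.\<close>

definition vertex_perm :: "'a set \<Rightarrow> 'a set set \<Rightarrow> ('a set \<Rightarrow> nat \<Rightarrow> 'a) \<Rightarrow> ('a set \<Rightarrow> 'a set) \<Rightarrow> 'a \<Rightarrow> 'a" where
  "vertex_perm S E vtx \<phi> \<alpha> = (let l = coherent_rel S E `` {\<alpha>} in
     vtx (\<phi> l) (inv_into {1..card l} (vtx l) \<alpha>))"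

locale enumerated_graph =
  fixes S :: "'a set" and E :: "'a set set" and vtx :: "'a set \<Rightarrow> nat \<Rightarrow> 'a"
  assumes simple: "simple_graph S E" and enum: "vertex_enumeration S E vtx"
begin

abbreviation \<Lambda> where "\<Lambda> \<equiv> coherent_components S E"
abbreviation coh where "coh \<equiv> coherent_rel S E"
abbreviation conn where "conn \<equiv> connected_rel S E"

lemma finite_S: "finite S"
  using simple by (auto simp: simple_graph_def)

lemma edge_sym: "{\<alpha>, \<beta>} \<in> E \<Longrightarrow> {\<beta>, \<alpha>} \<in> E"
  by (simp add: insert_commute)

lemma edgeD:
  assumes "{\<alpha>, \<beta>} \<in> E" shows "\<alpha> \<in> S" "\<beta> \<in> S" "\<alpha> \<noteq> \<beta>"
  using assms simple by (auto simp: simple_graph_def card_2_iff')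

lemma dominated_iff: "dominated S E \<alpha> \<beta> \<longleftrightarrow> (\<forall>\<gamma>. {\<alpha>, \<gamma>} \<in> E \<longrightarrow> \<gamma> = \<beta> \<or> {\<beta>, \<gamma>} \<in> E)"
  unfolding dominated_def open_nbhd_def closed_nbhd_def using edgeD(2) by blast

text \<open>The delicate neighbour of \<open>\<alpha>\<close> is \<open>\<beta>\<close> itself. Then
  \<open>\<alpha>\<close> is a neighbour of \<open>\<beta>\<close>, so it equals
  \<open>\<gamma>\<close> or is adjacent to it; in the latter case the first hypothesis is applied
  to the neighbour \<open>\<gamma>\<close> of \<open>\<alpha>\<close>.\<close>

lemma dominated_trans:
  assumes "dominated S E \<alpha> \<beta>" "dominated S E \<beta> \<gamma>" shows "dominated S E \<alpha> \<gamma>"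
  using assms unfolding dominated_iff by (metis edge_sym)

lemma equiv_coh: "equiv S coh"
proof (rule equivI)
  show "coh \<subseteq> S \<times> S" by (auto simp: coherent_rel_def)
  show "refl_on S coh" by (auto simp: refl_on_def coherent_rel_def dominated_iff)
  show "sym coh" by (auto simp: sym_def coherent_rel_def)
  show "trans coh" unfolding trans_def coherent_rel_def using dominated_trans by blast
qed

lemma \<Lambda>_eq: "\<Lambda> = S // coh"
  by (simp add: coherent_components_def coherent_rel_def)

lemma comps_eq: "connected_comps S E = S // conn"
  by (simp add: connected_comps_def connected_rel_def)

lemma equiv_conn: "equiv S conn"
proof (rule equivI)
  show "conn \<subseteq> S \<times> S" by (auto simp: connected_rel_def)
  show "refl_on S conn" by (auto simp: refl_on_def connected_rel_def)
  have "sym ({(x, y). {x, y} \<in> E}\<^sup>*)" by (rule sym_rtrancl) (auto simp: sym_def edge_sym)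
  then show "sym conn" by (auto simp: sym_def connected_rel_def)
  show "trans conn" by (auto simp: trans_def connected_rel_def)
qed

lemma coh_adjacent: "(\<alpha>, \<alpha>') \<in> coh \<Longrightarrow> {\<alpha>, \<beta>} \<in> E \<Longrightarrow> \<beta> \<noteq> \<alpha>' \<Longrightarrow> {\<alpha>', \<beta>} \<in> E"
  by (auto simp: coherent_rel_def dominated_iff)

text \<open>The endpoints are replaced one at a time. If the intermediate pair collapses because
  \<open>\<alpha>' = \<beta>\<close>, they are replaced in the other order; if that collapses as
  well, the new pair is the old one with its ends exchanged.\<close>

lemma coh_block:
  assumes a: "(\<alpha>, \<alpha>') \<in> coh" and b: "(\<beta>, \<beta>') \<in> coh" and e: "{\<alpha>, \<beta>} \<in> E" and ne: "\<alpha>' \<noteq> \<beta>'"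
  shows "{\<alpha>', \<beta>'} \<in> E"
proof (cases "\<alpha>' = \<beta>")
  case False
  then have "{\<alpha>', \<beta>} \<in> E" using coh_adjacent[OF a e] by auto
  then show ?thesis using coh_adjacent[OF b, of \<alpha>'] ne by (auto simp: insert_commute)
next
  case True
  show ?thesis
  proof (cases "\<beta>' = \<alpha>")
    case False
    then have "{\<beta>', \<alpha>} \<in> E" using coh_adjacent[OF b edge_sym[OF e]] by auto
    then show ?thesis using coh_adjacent[OF a edge_sym] ne by auto
  qed (use True e in \<open>simp add: insert_commute\<close>)
qed

lemma class_in_\<Lambda>: "\<alpha> \<in> S \<Longrightarrow> coh `` {\<alpha>} \<in> \<Lambda>" "\<alpha> \<in> S \<Longrightarrow> \<alpha> \<in> coh `` {\<alpha>}"
  using equiv_class_self[OF equiv_coh] by (auto simp: \<Lambda>_eq quotientI)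

lemma class_unique: "l \<in> \<Lambda> \<Longrightarrow> \<alpha> \<in> l \<Longrightarrow> coh `` {\<alpha>} = l"
  unfolding \<Lambda>_eq using equiv_coh by (metis Image_singleton_iff equiv_class_eq quotientE)

lemma \<Lambda>_subset: "l \<in> \<Lambda> \<Longrightarrow> l \<subseteq> S"
  unfolding \<Lambda>_eq using equiv_coh in_quotient_imp_subset by blast

lemma vtx_bij: "l \<in> \<Lambda> \<Longrightarrow> bij_betw (vtx l) {1..card l} l"
  using enum by (auto simp: vertex_enumeration_def)

lemma vtx_mem: "l \<in> \<Lambda> \<Longrightarrow> j \<in> {1..card l} \<Longrightarrow> vtx l j \<in> l"
  using vtx_bij bij_betwE by blast

lemma vtx_cases:
  assumes "\<alpha> \<in> S"
  obtains l j where "l \<in> \<Lambda>" "j \<in> {1..card l}" "\<alpha> = vtx l j"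
proof -
  have "\<alpha> \<in> vtx (coh `` {\<alpha>}) ` {1..card (coh `` {\<alpha>})}"
    using vtx_bij[OF class_in_\<Lambda>(1)[OF assms]] class_in_\<Lambda>(2)[OF assms] by (simp add: bij_betw_def)
  then show ?thesis using that class_in_\<Lambda>(1)[OF assms] by blast
qed

lemma vertex_perm_vtx:
  assumes "l \<in> \<Lambda>" "j \<in> {1..card l}"
  shows "vertex_perm S E vtx \<phi> (vtx l j) = vtx (\<phi> l) j"
proof -
  have "coh `` {vtx l j} = l" using class_unique vtx_mem assms by blast
  moreover have "inv_into {1..card l} (vtx l) (vtx l j) = j"
    using assms vtx_bij[OF assms(1)] by (intro inv_into_f_f) (auto simp: bij_betw_def)
  ultimately show ?thesis by (simp add: vertex_perm_def)
qed

section \<open>The vertex permutation induced by an automorphism of the quotient graph\<close>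

context
  fixes \<phi> assumes \<phi>: "\<phi> \<in> carrier (quotient_graph_aut S E)"
begin

abbreviation p where "p \<equiv> vertex_perm S E vtx \<phi>"
abbreviation q where "q \<equiv> inv_into S p"

lemma \<phi>_facts:
  shows \<phi>_bij: "bij_betw \<phi> \<Lambda> \<Lambda>"
    and \<phi>_\<Lambda>: "l \<in> \<Lambda> \<Longrightarrow> \<phi> l \<in> \<Lambda>"
    and \<phi>_card: "l \<in> \<Lambda> \<Longrightarrow> card (\<phi> l) = card l"
    and \<phi>_edges: "e \<subseteq> \<Lambda> \<Longrightarrow> \<phi> ` e \<in> quotient_edges S E \<longleftrightarrow> e \<in> quotient_edges S E"
  using \<phi> by (auto simp: quotient_graph_aut_def Bij_def bij_betwE)

lemma p_image: "l \<in> \<Lambda> \<Longrightarrow> p ` l = \<phi> l"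
proof -
  assume l: "l \<in> \<Lambda>"
  have "p ` l = p ` (vtx l ` {1..card l})" using vtx_bij[OF l] by (simp add: bij_betw_def)
  also have "\<dots> = vtx (\<phi> l) ` {1..card (\<phi> l)}"
    by (auto simp: image_image vertex_perm_vtx[OF l] \<phi>_card[OF l])
  also have "\<dots> = \<phi> l" using vtx_bij[OF \<phi>_\<Lambda>[OF l]] by (simp add: bij_betw_def)
  finally show ?thesis .
qed

lemma Union_\<Lambda>: "\<Union>\<Lambda> = S"
  unfolding \<Lambda>_eq using Union_quotient[OF equiv_coh] .

text \<open>Surjective because \<open>\<phi>\<close> permutes the classes, which cover
  \<open>S\<close>; injective by finiteness.\<close>

lemma p_bij: "bij_betw p S S"
proof -
  have "p ` S = p ` \<Union>\<Lambda>" by (simp add: Union_\<Lambda>)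
  also have "\<dots> = (\<Union>l\<in>\<Lambda>. \<phi> l)" by (auto simp: p_image[symmetric])
  also have "\<dots> = \<Union>\<Lambda>" using \<phi>_bij by (simp add: bij_betw_def)
  finally have "p ` S = S" by (simp add: Union_\<Lambda>)
  then show ?thesis using finite_S by (simp add: bij_betw_def finite_surj_inj)
qed

lemma p_S: "\<alpha> \<in> S \<Longrightarrow> p \<alpha> \<in> S"
  using p_bij bij_betwE by blast

lemma p_inj: "\<alpha> \<in> S \<Longrightarrow> \<beta> \<in> S \<Longrightarrow> p \<alpha> = p \<beta> \<longleftrightarrow> \<alpha> = \<beta>"
  using p_bij by (auto simp: bij_betw_def inj_on_eq_iff)

lemma q_facts: "\<alpha> \<in> S \<Longrightarrow> q \<alpha> \<in> S" "\<alpha> \<in> S \<Longrightarrow> p (q \<alpha>) = \<alpha>" "\<alpha> \<in> S \<Longrightarrow> q (p \<alpha>) = \<alpha>"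
  using p_bij by (auto simp: bij_betw_def inv_into_into f_inv_into_f inv_into_f_f)

text \<open>Adjacency of two distinct vertices depends only on their classes. Distinctness matters,
  since a class may carry a loop although no vertex does.\<close>

lemma quotient_edge_iff:
  assumes "\<alpha> \<in> S" "\<beta> \<in> S" "\<alpha> \<noteq> \<beta>"
  shows "{coh `` {\<alpha>}, coh `` {\<beta>}} \<in> quotient_edges S E \<longleftrightarrow> {\<alpha>, \<beta>} \<in> E"
proof
  assume "{\<alpha>, \<beta>} \<in> E"
  then show "{coh `` {\<alpha>}, coh `` {\<beta>}} \<in> quotient_edges S E"
    using class_in_\<Lambda>[OF assms(1)] class_in_\<Lambda>[OF assms(2)] unfolding quotient_edges_def by blast
next
  assume "{coh `` {\<alpha>}, coh `` {\<beta>}} \<in> quotient_edges S E"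
  then obtain l m \<gamma> \<delta> where lm: "{coh `` {\<alpha>}, coh `` {\<beta>}} = {l, m}" "\<gamma> \<in> l" "\<delta> \<in> m" "{\<gamma>, \<delta>} \<in> E"
    unfolding quotient_edges_def by blast
  then consider "\<gamma> \<in> coh `` {\<alpha>}" "\<delta> \<in> coh `` {\<beta>}" | "\<delta> \<in> coh `` {\<alpha>}" "\<gamma> \<in> coh `` {\<beta>}"
    by (auto simp: doubleton_eq_iff)
  then obtain \<gamma>' \<delta>' where "(\<alpha>, \<gamma>') \<in> coh" "(\<beta>, \<delta>') \<in> coh" "{\<gamma>', \<delta>'} \<in> E"
    using lm(4) edge_sym by cases auto
  then show "{\<alpha>, \<beta>} \<in> E"
    using coh_block[of \<gamma>' \<alpha> \<delta>' \<beta>] assms(3) equiv_coh by (meson equiv_def symE)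
qed

lemma p_class: "\<alpha> \<in> S \<Longrightarrow> coh `` {p \<alpha>} = \<phi> (coh `` {\<alpha>})"
  using class_in_\<Lambda>[of \<alpha>] p_image[of "coh `` {\<alpha>}"] class_unique[OF \<phi>_\<Lambda>, of "coh `` {\<alpha>}" "p \<alpha>"] by blast

lemma p_edge_iff:
  assumes "\<alpha> \<in> S" "\<beta> \<in> S"
  shows "{p \<alpha>, p \<beta>} \<in> E \<longleftrightarrow> {\<alpha>, \<beta>} \<in> E"
proof (cases "\<alpha> = \<beta>")
  case True
  then show ?thesis using edgeD(3)[of \<alpha> \<alpha>] edgeD(3)[of "p \<alpha>" "p \<alpha>"] by auto
next
  case False
  have "{p \<alpha>, p \<beta>} \<in> E \<longleftrightarrow> {coh `` {p \<alpha>}, coh `` {p \<beta>}} \<in> quotient_edges S E"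
    using quotient_edge_iff[of "p \<alpha>" "p \<beta>"] assms False by (simp add: p_S p_inj)
  also have "{coh `` {p \<alpha>}, coh `` {p \<beta>}} = \<phi> ` {coh `` {\<alpha>}, coh `` {\<beta>}}" by (simp add: p_class assms)
  also have "\<dots> \<in> quotient_edges S E \<longleftrightarrow> {\<alpha>, \<beta>} \<in> E"
    using quotient_edge_iff[OF assms False] class_in_\<Lambda>(1) assms by (subst \<phi>_edges) auto
  finally show ?thesis .
qed

lemma conn_map:
  assumes edge: "\<And>\<alpha> \<beta>. {\<alpha>, \<beta>} \<in> E \<Longrightarrow> {f \<alpha>, f \<beta>} \<in> E" and "f ` S \<subseteq> S" and c: "(\<alpha>, \<beta>) \<in> conn"
  shows "(f \<alpha>, f \<beta>) \<in> conn"
proof -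
  have "(\<alpha>, \<beta>) \<in> {(x, y). {x, y} \<in> E}\<^sup>*" using c by (auto simp: connected_rel_def)
  then have "(f \<alpha>, f \<beta>) \<in> {(x, y). {x, y} \<in> E}\<^sup>*"
    by (induction rule: rtrancl_induct) (auto intro: rtrancl_into_rtrancl edge)
  then show ?thesis using c assms(2) by (auto simp: connected_rel_def)
qed

lemma p_connected: "(\<alpha>, \<beta>) \<in> conn \<Longrightarrow> (p \<alpha>, p \<beta>) \<in> conn"
proof (erule conn_map[rotated 2])
  show "{p \<alpha>, p \<beta>} \<in> E" if "{\<alpha>, \<beta>} \<in> E" for \<alpha> \<beta>
    using p_edge_iff[of \<alpha> \<beta>] edgeD(1,2)[OF that] that by simp
  show "p ` S \<subseteq> S" using p_S by blast
qed

lemma q_connected: "(\<alpha>, \<beta>) \<in> conn \<Longrightarrow> (q \<alpha>, q \<beta>) \<in> conn"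
proof (erule conn_map[rotated 2])
  show "{q \<alpha>, q \<beta>} \<in> E" if "{\<alpha>, \<beta>} \<in> E" for \<alpha> \<beta>
    using p_edge_iff[of "q \<alpha>" "q \<beta>"] q_facts edgeD(1,2)[OF that] that by simp
  show "q ` S \<subseteq> S" using q_facts(1) by blast
qed

lemma p_comp: "C \<in> connected_comps S E \<Longrightarrow> p ` C \<in> connected_comps S E"
proof -
  assume "C \<in> connected_comps S E"
  then obtain \<alpha> where \<alpha>: "\<alpha> \<in> S" "C = conn `` {\<alpha>}" unfolding comps_eq by (elim quotientE) auto
  have "p ` C = conn `` {p \<alpha>}"
  proof
    show "p ` C \<subseteq> conn `` {p \<alpha>}" using p_connected \<alpha> by auto
    show "conn `` {p \<alpha>} \<subseteq> p ` C"
    proof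
      fix \<beta> assume b: "\<beta> \<in> conn `` {p \<alpha>}"
      then have "\<beta> \<in> S" by (auto simp: connected_rel_def)
      moreover have "q \<beta> \<in> C" using b q_connected[of "p \<alpha>" \<beta>] \<alpha> by (simp add: q_facts)
      ultimately show "\<beta> \<in> p ` C" using q_facts(2)[of \<beta>] by force
    qed
  qed
  then show ?thesis using \<alpha> p_S by (auto simp: comps_eq quotientI)
qed

text \<open>Isolated vertices are coherent with each other, and \<open>p \<alpha>\<close> is
  isolated along with \<open>\<alpha>\<close>. So their class is mapped to itself, and positions in
  the enumeration are kept. This matches the convention of \<open>comp_perm\<close> for
  singletons.\<close>

lemma p_isolated:
  assumes "\<alpha> \<in> S" "\<And>\<beta>. {\<alpha>, \<beta>} \<notin> E"
  shows "p \<alpha> = \<alpha>"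
proof -
  have "{p \<alpha>, \<beta>} \<notin> E" for \<beta>
    using p_edge_iff[of \<alpha> "q \<beta>"] q_facts[of \<beta>] edgeD(2)[of "p \<alpha>" \<beta>] assms by auto
  then have "(\<alpha>, p \<alpha>) \<in> coh" using assms p_S by (auto simp: coherent_rel_def dominated_iff)
  then have *: "\<phi> (coh `` {\<alpha>}) = coh `` {\<alpha>}"
    using p_class[OF assms(1)] equiv_class_eq[OF equiv_coh, of \<alpha> "p \<alpha>"] by simp
  obtain l j where lj: "l \<in> \<Lambda>" "j \<in> {1..card l}" "\<alpha> = vtx l j" by (rule vtx_cases[OF assms(1)])
  then have "coh `` {\<alpha>} = l" using class_unique vtx_mem by blast
  then show ?thesis using * lj by (simp add: vertex_perm_vtx)
qed

text \<open>In a component with at least two vertices every vertex has a neighbour, and that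
  neighbour equals or is adjacent to each vertex coherent with it. Such a component is thus a union
  of coherent classes. A singleton consists of an isolated vertex, which \<open>p\<close>
  fixes.\<close>

lemma comp_perm_eq:
  assumes C: "C \<in> connected_comps S E"
  shows "comp_perm S E \<phi> C = p ` C"
proof -
  obtain \<alpha>0 where "\<alpha>0 \<in> S" and C0: "C = conn `` {\<alpha>0}" using C unfolding comps_eq by (elim quotientE) auto
  have sub: "C \<subseteq> S" by (auto simp: C0 connected_rel_def)
  have C_eq: "C = conn `` {\<alpha>}" if "\<alpha> \<in> C" for \<alpha>
    using that equiv_class_eq[OF equiv_conn] by (auto simp: C0)
  have adj: "\<beta> \<in> C" if "\<alpha> \<in> C" "{\<alpha>, \<beta>} \<in> E" for \<alpha> \<beta>
    using that C_eq[OF that(1)] edgeD[OF that(2)] by (auto simp: connected_rel_def)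
  have neighbour: "\<exists>\<gamma>. {\<alpha>, \<gamma>} \<in> E" if "\<alpha> \<in> C" "\<beta> \<in> C" "\<beta> \<noteq> \<alpha>" for \<alpha> \<beta>
  proof -
    have "(\<alpha>, \<beta>) \<in> {(x, y). {x, y} \<in> E}\<^sup>*" using that C_eq[OF that(1)] by (auto simp: connected_rel_def)
    then show ?thesis using that(3) by (cases rule: converse_rtranclE) auto
  qed
  show ?thesis
  proof (cases "2 \<le> card C")
    case True
    have closed: "coh `` {\<alpha>} \<subseteq> C" if "\<alpha> \<in> C" for \<alpha>
    proof
      fix \<alpha>' assume a: "\<alpha>' \<in> coh `` {\<alpha>}"
      have "\<not> C \<subseteq> {\<alpha>}" using True card_mono[of "{\<alpha>}" C] by auto
      then obtain \<beta> where "\<beta> \<in> C" "\<beta> \<noteq> \<alpha>" by blast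
      with neighbour[OF that] obtain \<gamma> where g: "{\<alpha>, \<gamma>} \<in> E" by blast
      then have "\<gamma> \<in> C" by (rule adj[OF that])
      then show "\<alpha>' \<in> C" using coh_adjacent[of \<alpha> \<alpha>' \<gamma>] a g adj[of \<gamma> \<alpha>'] by (auto simp: insert_commute)
    qed
    have "\<Union>{l \<in> \<Lambda>. l \<subseteq> C} = C" using closed class_in_\<Lambda> sub by blast
    moreover have "comp_perm S E \<phi> C = \<Union>(\<phi> ` {l \<in> \<Lambda>. l \<subseteq> C})"
      using True by (auto simp: comp_perm_def)
    moreover have "\<Union>(\<phi> ` {l \<in> \<Lambda>. l \<subseteq> C}) = p ` \<Union>{l \<in> \<Lambda>. l \<subseteq> C}"
      by (auto simp: p_image[symmetric])
    ultimately show ?thesis by simp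
  next
    case False
    have "\<alpha>0 \<in> C" using \<open>\<alpha>0 \<in> S\<close> by (auto simp: C0 connected_rel_def)
    moreover have "\<beta> = \<alpha>0" if "\<beta> \<in> C" for \<beta>
      using False card_mono[OF finite_subset[OF sub finite_S], of "{\<alpha>0, \<beta>}"] that \<open>\<alpha>0 \<in> C\<close>
      by (cases "\<beta> = \<alpha>0") auto
    ultimately have C1: "C = {\<alpha>0}" by blast
    have "{\<alpha>0, \<beta>} \<notin> E" for \<beta> using adj[of \<alpha>0 \<beta>] edgeD(3)[of \<alpha>0 \<beta>] C1 by auto
    then have "p \<alpha>0 = \<alpha>0" using p_isolated \<open>\<alpha>0 \<in> S\<close> by blast
    then show ?thesis using False C1 by (simp add: comp_perm_def)
  qed
qed

end

text \<open>Both sides keep the position in the enumeration, which is why one ordering is fixed for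
  all classes.\<close>

lemma vertex_perm_compose:
  assumes "\<psi> \<in> carrier (quotient_graph_aut S E)" "\<alpha> \<in> S"
  shows "vertex_perm S E vtx (compose \<Lambda> \<phi> \<psi>) \<alpha> = vertex_perm S E vtx \<phi> (vertex_perm S E vtx \<psi> \<alpha>)"
proof -
  obtain l j where lj: "l \<in> \<Lambda>" "j \<in> {1..card l}" "\<alpha> = vtx l j" by (rule vtx_cases[OF assms(2)])
  then have "\<psi> l \<in> \<Lambda>" "j \<in> {1..card (\<psi> l)}" using \<phi>_\<Lambda>[OF assms(1)] \<phi>_card[OF assms(1)] by auto
  then show ?thesis using lj by (simp add: vertex_perm_vtx compose_def)
qed

end

section \<open>The Galois group\<close>

text \<open>The list representation puts the leading coefficient first, hence the reversal.\<close>

lemma eval_complex_eq_poly: "ring.eval \<C> ps x = poly (Poly (rev ps)) x"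
  by (induction ps) (auto simp: ring.eval.simps[OF ring_complex] Poly_snoc poly_monom algebra_simps)

text \<open>Each step of the dimension count adjoins one vector \<open>v\<close>, which joins
  \<open>T\<close>; on the scalars in \<open>K\<close> all the maps agree. The claim
  \<open>0 \<in> F\<close> is carried along in order to find \<open>v\<close> and its multiples
  inside the extended space.\<close>

lemma dimension_determined:
  assumes hom: "\<And>\<sigma> x y. P \<sigma> \<Longrightarrow> x \<in> L \<Longrightarrow> y \<in> L \<Longrightarrow> \<sigma> (x + y) = \<sigma> x + \<sigma> y \<and> \<sigma> (x * y) = \<sigma> x * \<sigma> y"
    and "ring.dimension \<C> n K F" "subfield K \<C>" "K \<subseteq> L" "F \<subseteq> L"
    "\<forall>\<sigma> \<tau> x. P \<sigma> \<longrightarrow> P \<tau> \<longrightarrow> x \<in> K \<longrightarrow> \<sigma> x = \<tau> (x::complex)"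
  shows "0 \<in> F \<and> (\<exists>T. finite T \<and> T \<subseteq> L \<and>
    (\<forall>\<sigma> \<tau>. P \<sigma> \<longrightarrow> P \<tau> \<longrightarrow> (\<forall>t\<in>T. \<sigma> t = \<tau> t) \<longrightarrow> (\<forall>x\<in>F. \<sigma> x = \<tau> x)))"
  using assms(2-)
proof (induction rule: ring.dimension.induct[OF ring_complex, consumes 1, case_names zero Suc])
  case (zero K)
  have "0 \<in> K" using zero subfield_complex_closed(1) by blast
  then show ?case using zero(4) by (intro conjI exI[of _ "{}"]) auto
next
  case (Suc v F n K)
  note K = subfield_complex_closed[OF Suc.prems(1)]
  have mem: "u \<in> ring.line_extension \<C> K v F \<longleftrightarrow> (\<exists>k\<in>K. \<exists>w\<in>F. u = k * v + w)" for u
    using ring.line_extension_mem_iff[OF ring_complex, of u K v F] by simp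
  have FL: "F \<subseteq> L"
    using Suc.prems(3) K(1) mem by (metis add.left_neutral mult_zero_left subset_iff)
  note IH = Suc.IH[OF Suc.prems(1,2) FL Suc.prems(4)]
  then have IH0: "0 \<in> F" by blast
  then have v: "v \<in> L" using Suc.prems(3) K(2) mem[of v] by (metis add.right_neutral mult_1 subset_iff)
  obtain T where T: "finite T" "T \<subseteq> L"
    "\<And>\<sigma> \<tau>. P \<sigma> \<Longrightarrow> P \<tau> \<Longrightarrow> \<forall>t\<in>T. \<sigma> t = \<tau> t \<Longrightarrow> \<forall>x\<in>F. \<sigma> x = \<tau> x"
    using IH by blast
  show ?case
  proof (intro conjI exI[of _ "insert v T"] allI impI ballI)
    show "0 \<in> ring.line_extension \<C> K v F" using K(1) IH0 mem[of 0] by force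
    show "finite (insert v T)" "insert v T \<subseteq> L" using T v by auto
    fix \<sigma> \<tau> u
    assume st: "P \<sigma>" "P \<tau>" "\<forall>t\<in>insert v T. \<sigma> t = \<tau> t" and u: "u \<in> ring.line_extension \<C> K v F"
    then obtain k w where kw: "k \<in> K" "w \<in> F" "u = k * v + w" using mem by blast
    have L: "k \<in> L" "w \<in> L" using kw Suc.prems(2) FL by auto
    have kv: "k * v \<in> L" using Suc.prems(3) kw(1) IH0 mem[of "k * v"] by (metis add.right_neutral subset_iff)
    have "\<sigma> u = \<sigma> k * \<sigma> v + \<sigma> w" "\<tau> u = \<tau> k * \<tau> v + \<tau> w"
      unfolding kw(3) using hom[OF st(1) kv L(2)] hom[OF st(2) kv L(2)] hom[OF st(1) L(1) v] hom[OF st(2) L(1) v]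
      by simp_all
    moreover have "\<sigma> k = \<tau> k" using Suc.prems(4) st(1,2) kw(1) by blast
    ultimately show "\<sigma> u = \<tau> u" using st kw(2) T(3)[OF st(1,2)] by simp
  qed
qed

locale galois_setting =
  fixes L K :: "complex set"
  assumes galois: "galois_extension L K"
begin

abbreviation G where "G \<equiv> carrier (galois_group L K)"

lemma fields: "subfield K \<C>" "subfield L \<C>" "K \<subseteq> L"
  using galois by (auto simp: galois_extension_def)

lemmas L_closed = subfield_complex_closed[OF fields(2)]

lemma G_iff: "\<sigma> \<in> G \<longleftrightarrow> \<sigma> \<in> Bij L \<and> (\<forall>x\<in>L. \<forall>y\<in>L. \<sigma> (x + y) = \<sigma> x + \<sigma> y \<and> \<sigma> (x * y) = \<sigma> x * \<sigma> y) \<and>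
    \<sigma> 1 = 1 \<and> (\<forall>x\<in>K. \<sigma> x = x)"
  by (auto simp: galois_group_def ring_hom_def Bij_def bij_betwE)

lemma G_mult: "\<sigma> \<in> G \<Longrightarrow> \<tau> \<in> G \<Longrightarrow> \<sigma> \<otimes>\<^bsub>galois_group L K\<^esub> \<tau> = compose L \<sigma> \<tau>"
  by (auto simp: galois_group_def BijGroup_def)

lemma G_bij: "\<sigma> \<in> G \<Longrightarrow> bij_betw \<sigma> L L"
  by (auto simp: G_iff Bij_def)

lemma G_mem: "\<sigma> \<in> G \<Longrightarrow> x \<in> L \<Longrightarrow> \<sigma> x \<in> L"
  using G_bij bij_betwE by blast

lemma G_add: "\<sigma> \<in> G \<Longrightarrow> x \<in> L \<Longrightarrow> y \<in> L \<Longrightarrow> \<sigma> (x + y) = \<sigma> x + \<sigma> y"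
  and G_times: "\<sigma> \<in> G \<Longrightarrow> x \<in> L \<Longrightarrow> y \<in> L \<Longrightarrow> \<sigma> (x * y) = \<sigma> x * \<sigma> y"
  and G_one: "\<sigma> \<in> G \<Longrightarrow> \<sigma> 1 = 1"
  and G_fix: "\<sigma> \<in> G \<Longrightarrow> x \<in> K \<Longrightarrow> \<sigma> x = x"
  by (auto simp: G_iff)

lemma G_zero: "\<sigma> \<in> G \<Longrightarrow> \<sigma> 0 = 0"
  using G_fix subfield_complex_closed(1)[OF fields(1)] by blast

lemma G_inj: "\<sigma> \<in> G \<Longrightarrow> x \<in> L \<Longrightarrow> y \<in> L \<Longrightarrow> \<sigma> x = \<sigma> y \<longleftrightarrow> x = y"
  using G_bij[of \<sigma>] by (auto simp: bij_betw_def inj_on_eq_iff)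

lemma G_compose: "\<sigma> \<in> G \<Longrightarrow> \<tau> \<in> G \<Longrightarrow> compose L \<sigma> \<tau> \<in> G"
proof -
  assume st: "\<sigma> \<in> G" "\<tau> \<in> G"
  then have "compose L \<sigma> \<tau> \<in> Bij L" by (auto simp: G_iff compose_Bij)
  moreover have "\<forall>x\<in>L. \<forall>y\<in>L. compose L \<sigma> \<tau> (x + y) = compose L \<sigma> \<tau> x + compose L \<sigma> \<tau> y \<and>
      compose L \<sigma> \<tau> (x * y) = compose L \<sigma> \<tau> x * compose L \<sigma> \<tau> y"
    using st L_closed by (simp add: compose_eq G_add G_times G_mem)
  moreover have "compose L \<sigma> \<tau> 1 = 1" "\<forall>x\<in>K. compose L \<sigma> \<tau> x = x"
    using st L_closed subsetD[OF fields(3)] by (simp_all add: compose_eq G_one G_fix)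
  ultimately show ?thesis unfolding G_iff by blast
qed

definition G_inv where "G_inv \<sigma> = restrict (inv_into L \<sigma>) L"

lemma G_inv_apply:
  assumes "\<sigma> \<in> G" "x \<in> L"
  shows "\<sigma> (G_inv \<sigma> x) = x" "G_inv \<sigma> (\<sigma> x) = x" "G_inv \<sigma> x \<in> L"
proof -
  have b: "bij_betw \<sigma> L L" using G_bij assms by blast
  show "\<sigma> (G_inv \<sigma> x) = x" "G_inv \<sigma> x \<in> L"
    using b assms by (auto simp: G_inv_def bij_betw_def f_inv_into_f inv_into_into)
  show "G_inv \<sigma> (\<sigma> x) = x"
    using b assms G_mem by (auto simp: G_inv_def bij_betw_def inv_into_f_f)
qed

lemma G_inv_G: "\<sigma> \<in> G \<Longrightarrow> G_inv \<sigma> \<in> G"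
proof -
  assume \<sigma>: "\<sigma> \<in> G"
  have eqI: "G_inv \<sigma> y = x" if "x \<in> L" "y = \<sigma> x" for x y
    using G_inv_apply(2)[OF \<sigma>] that by blast
  have "G_inv \<sigma> \<in> Bij L"
    unfolding G_inv_def using \<sigma> by (intro restrict_inv_into_Bij) (auto simp: G_iff)
  moreover have "G_inv \<sigma> (x + y) = G_inv \<sigma> x + G_inv \<sigma> y" "G_inv \<sigma> (x * y) = G_inv \<sigma> x * G_inv \<sigma> y"
    if "x \<in> L" "y \<in> L" for x y
    using that \<sigma> by (auto intro!: eqI simp: G_inv_apply L_closed G_add G_times)
  moreover have "G_inv \<sigma> 1 = 1" using \<sigma> by (intro eqI) (auto simp: G_one L_closed)
  moreover have "G_inv \<sigma> x = x" if "x \<in> K" for x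
    using \<sigma> that fields(3) by (intro eqI) (auto simp: G_fix)
  ultimately show ?thesis by (simp add: G_iff)
qed

lemma G_id: "restrict id L \<in> G"
proof -
  have "restrict id L \<in> Bij L" by (auto simp: Bij_def bij_betw_def inj_on_def)
  then show ?thesis using L_closed fields(3) by (auto simp: G_iff subset_iff)
qed

lemma fixed_field: "x \<in> L \<Longrightarrow> (\<And>\<sigma>. \<sigma> \<in> G \<Longrightarrow> \<sigma> x = x) \<Longrightarrow> x \<in> K"
  using galois by (auto simp: galois_extension_def)

text \<open>The conjugates of \<open>t\<close> are roots of any polynomial over \<open>K\<close>
  that vanishes at \<open>t\<close>.\<close>

lemma finite_orbit:
  assumes "t \<in> L"
  shows "finite ((\<lambda>\<sigma>. \<sigma> t) ` G)"
proof -
  have "(ring.algebraic \<C> over K) t" using galois assms by (auto simp: galois_extension_def)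
  moreover have "domain \<C>" using field_complex by (simp add: field_def)
  moreover have "subring K \<C>" using subfieldE(1)[OF fields(1)] .
  ultimately obtain p where p: "p \<in> carrier (univ_poly \<C> K)" "p \<noteq> []" "ring.eval \<C> p t = \<zero>\<^bsub>\<C>\<^esub>"
    using domain.algebraicE[of \<C> K t] by auto
  then have K: "set p \<subseteq> K" and lc: "hd p \<noteq> 0"
    unfolding univ_poly_carrier[symmetric] polynomial_def by auto
  have "Poly (rev p) \<noteq> 0"
    using lc p(2) by (auto simp: Poly_eq_0) (metis hd_in_set in_set_replicate set_rev)
  then have fin: "finite {x. poly (Poly (rev p)) x = 0}" by (rule poly_roots_finite)
  have "ring.eval \<C> p (\<sigma> t) = \<sigma> (ring.eval \<C> p t) \<and> ring.eval \<C> p t \<in> L" if "\<sigma> \<in> G" for \<sigma>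
    using K
  proof (induction p)
    case Nil
    then show ?case using G_zero that L_closed by (simp add: ring.eval.simps[OF ring_complex])
  next
    case (Cons a p)
    have pow: "t ^ n \<in> L \<and> \<sigma> (t ^ n) = \<sigma> t ^ n" for n
      using that assms by (induction n) (auto simp: L_closed G_one G_times)
    have a: "a \<in> L" "\<sigma> a = a" using Cons.prems fields(3) G_fix[OF that] by auto
    have m: "a * t ^ length p \<in> L" using a pow L_closed by blast
    have IH: "ring.eval \<C> p (\<sigma> t) = \<sigma> (ring.eval \<C> p t)" "ring.eval \<C> p t \<in> L" using Cons by auto
    show ?case
      using a m IH pow L_closed(3)[OF m IH(2)]
      by (simp add: ring.eval.simps[OF ring_complex] G_add[OF that] G_times[OF that])
  qed
  then have "(\<lambda>\<sigma>. \<sigma> t) ` G \<subseteq> {x. poly (Poly (rev p)) x = 0}"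
    using p(3) G_zero by (auto simp: eval_complex_eq_poly[symmetric])
  then show ?thesis using fin finite_subset by blast
qed

section \<open>The Krull topology in terms of finitely many values\<close>

lemma finite_dimension_determined:
  assumes "ring.finite_dimension \<C> K F" "F \<subseteq> L"
  shows "\<exists>T. finite T \<and> T \<subseteq> L \<and> (\<forall>\<sigma>\<in>G. \<forall>\<tau>\<in>G. (\<forall>t\<in>T. \<sigma> t = \<tau> t) \<longrightarrow> (\<forall>x\<in>F. \<sigma> x = \<tau> x))"
proof -
  obtain n where "ring.dimension \<C> n K F" using assms(1) by (auto simp: ring.finite_dimension_def[OF ring_complex])
  moreover have "\<forall>\<sigma> \<tau> x. \<sigma> \<in> G \<longrightarrow> \<tau> \<in> G \<longrightarrow> x \<in> K \<longrightarrow> \<sigma> x = \<tau> x" by (simp add: G_fix)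
  ultimately obtain T where T: "finite T" "T \<subseteq> L" and
      eq: "\<forall>\<sigma> \<tau>. \<sigma> \<in> G \<longrightarrow> \<tau> \<in> G \<longrightarrow> (\<forall>t\<in>T. \<sigma> t = \<tau> t) \<longrightarrow> (\<forall>x\<in>F. \<sigma> x = \<tau> x)"
    using dimension_determined[where P = "\<lambda>\<sigma>. \<sigma> \<in> G" and L = L and K = K and n = n and F = F]
      G_add G_times fields(1,3) assms(2) by (simp, elim exE conjE)
  have "\<forall>\<sigma>\<in>G. \<forall>\<tau>\<in>G. (\<forall>t\<in>T. \<sigma> t = \<tau> t) \<longrightarrow> (\<forall>x\<in>F. \<sigma> x = \<tau> x)"
    by (intro ballI) (rule eq[THEN spec, THEN spec, THEN mp, THEN mp])
  then show ?thesis using T by (intro exI[of _ T] conjI)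
qed

text \<open>A basic open set prescribes an automorphism on a finite extension, hence by finitely
  many values. The test set of an intersection is the union of the two test sets.\<close>

lemma krull_open_determined:
  assumes "openin (krull_topology L K) U" "\<tau> \<in> U"
  shows "\<tau> \<in> G \<and> (\<exists>T. finite T \<and> T \<subseteq> L \<and> (\<forall>\<sigma>\<in>G. (\<forall>t\<in>T. \<sigma> t = \<tau> t) \<longrightarrow> \<sigma> \<in> U))"
  using assms unfolding krull_topology_def openin_topology_generated_by_iff
proof (induction U rule: generate_topology_on.induct)
  case (Int A B)
  then obtain T T' where "finite T" "T \<subseteq> L" "\<forall>\<sigma>\<in>G. (\<forall>t\<in>T. \<sigma> t = \<tau> t) \<longrightarrow> \<sigma> \<in> A"
    "finite T'" "T' \<subseteq> L" "\<forall>\<sigma>\<in>G. (\<forall>t\<in>T'. \<sigma> t = \<tau> t) \<longrightarrow> \<sigma> \<in> B" "\<tau> \<in> G" by blast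
  then show ?case by (intro conjI exI[of _ "T \<union> T'"]) auto
next
  case (UN \<K>)
  then obtain k where k: "k \<in> \<K>" "\<tau> \<in> k" by blast
  with UN.IH[OF this] show ?case by blast
next
  case (Basis A)
  then obtain \<sigma> F where A: "A = {\<tau> \<in> G. \<forall>x\<in>F. \<tau> x = \<sigma> x}" "\<sigma> \<in> G" "F \<subseteq> L" "ring.finite_dimension \<C> K F"
    by blast
  then obtain T where "finite T" "T \<subseteq> L"
    and det: "\<forall>\<sigma>\<in>G. \<forall>\<tau>\<in>G. (\<forall>t\<in>T. \<sigma> t = \<tau> t) \<longrightarrow> (\<forall>x\<in>F. \<sigma> x = \<tau> x)"
    using finite_dimension_determined[OF A(4,3)] by (elim exE conjE)
  have "\<tau> \<in> G" "\<forall>x\<in>F. \<tau> x = \<sigma> x" using A(1) Basis.prems by blast+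
  then have "\<sigma>' \<in> A" if "\<sigma>' \<in> G" "\<forall>t\<in>T. \<sigma>' t = \<tau> t" for \<sigma>'
    using that det[THEN bspec, THEN bspec, THEN mp, of \<sigma>' \<tau>] unfolding A(1) by simp
  then show ?case using \<open>finite T\<close> \<open>T \<subseteq> L\<close> \<open>\<tau> \<in> G\<close> by blast
qed auto

lemma topspace_krull: "topspace (krull_topology L K) = G"
proof
  show "topspace (krull_topology L K) \<subseteq> G"
    using krull_open_determined[OF openin_topspace] by blast
  show "G \<subseteq> topspace (krull_topology L K)"
  proof
    fix \<sigma> assume \<sigma>: "\<sigma> \<in> G"
    \<comment> \<open>\<open>K\<close> itself is a finite extension of \<open>K\<close>, and its
      basic set is all of \<open>G\<close>.\<close>
    have "ring.finite_dimension \<C> K K"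
      using ring.dimension_one[OF ring_complex fields(1)] by (rule ring.finite_dimensionI[OF ring_complex])
    then have "{\<tau> \<in> G. \<forall>x\<in>K. \<tau> x = \<sigma> x} \<in> {{\<tau> \<in> G. \<forall>x\<in>F. \<tau> x = \<sigma> x} | \<sigma> F.
        \<sigma> \<in> G \<and> subfield F \<C> \<and> K \<subseteq> F \<and> F \<subseteq> L \<and> ring.finite_dimension \<C> K F}"
      using \<sigma> fields by blast
    moreover have "\<sigma> \<in> {\<tau> \<in> G. \<forall>x\<in>K. \<tau> x = \<sigma> x}" using \<sigma> by simp
    ultimately show "\<sigma> \<in> topspace (krull_topology L K)"
      unfolding krull_topology_def topology_generated_by_topspace by (rule UnionI)
  qed
qed

text \<open>The preimage of one point of the discrete target is open.\<close>

lemma locally_constant: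
  assumes cont: "continuous_map (krull_topology L K) (discrete_topology D) \<rho>" and "\<tau> \<in> G"
  obtains T where "finite T" "T \<subseteq> L" "\<And>\<sigma>. \<sigma> \<in> G \<Longrightarrow> (\<And>t. t \<in> T \<Longrightarrow> \<sigma> t = \<tau> t) \<Longrightarrow> \<rho> \<sigma> = \<rho> \<tau>"
proof -
  have "\<rho> \<in> topspace (krull_topology L K) \<rightarrow> topspace (discrete_topology D)"
    using cont by (simp add: continuous_map_def)
  then have "\<rho> \<tau> \<in> D" using assms(2) by (auto simp: topspace_krull)
  then have "openin (krull_topology L K) {\<sigma> \<in> G. \<rho> \<sigma> \<in> {\<rho> \<tau>}}"
    using openin_continuous_map_preimage[OF cont, of "{\<rho> \<tau>}"] by (simp add: topspace_krull)
  from krull_open_determined[OF this, of \<tau>] assms(2) obtain T where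
    "finite T" "T \<subseteq> L" "\<forall>\<sigma>\<in>G. (\<forall>t\<in>T. \<sigma> t = \<tau> t) \<longrightarrow> \<sigma> \<in> {\<sigma> \<in> G. \<rho> \<sigma> \<in> {\<rho> \<tau>}}" by blast
  then show ?thesis using that[of T] by simp
qed

text \<open>\<open>R\<close> represents the left cosets of the pointwise stabiliser of
  \<open>T\<close> and replaces a finite Galois quotient; \<open>T\<close> is arbitrary, so this
  stabiliser may fail to be normal. It is finite because the restrictions to \<open>T\<close> lie in
  a finite product of finite orbits.\<close>

lemma restriction_representatives:
  assumes "finite T" "T \<subseteq> L"
  obtains R where "finite R" "R \<subseteq> G" "\<And>\<sigma>. \<sigma> \<in> G \<Longrightarrow> \<exists>!s. s \<in> R \<and> (\<forall>t\<in>T. \<sigma> t = s t)"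
proof -
  let ?r = "\<lambda>\<sigma>. restrict \<sigma> T"
  have "?r ` G \<subseteq> (\<Pi>\<^sub>E t\<in>T. (\<lambda>\<sigma>. \<sigma> t) ` G)" by auto
  moreover have "finite (\<Pi>\<^sub>E t\<in>T. (\<lambda>\<sigma>. \<sigma> t) ` G)"
    using assms finite_orbit by (intro finite_PiE) auto
  ultimately have fin: "finite (?r ` G)" using finite_subset by blast
  let ?R = "inv_into G ?r ` (?r ` G)"
  have eq: "?r s = ?r \<sigma> \<longleftrightarrow> (\<forall>t\<in>T. \<sigma> t = s t)" for s \<sigma> :: "complex \<Rightarrow> complex"
    by (auto simp: fun_eq_iff restrict_def)
  have uniq: "\<exists>!s. s \<in> ?R \<and> (\<forall>t\<in>T. \<sigma> t = s t)" if "\<sigma> \<in> G" for \<sigma>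
  proof (rule ex1I[of _ "inv_into G ?r (?r \<sigma>)"])
    show "inv_into G ?r (?r \<sigma>) \<in> ?R \<and> (\<forall>t\<in>T. \<sigma> t = inv_into G ?r (?r \<sigma>) t)"
      using that f_inv_into_f[of "?r \<sigma>" ?r G] unfolding eq[symmetric] by blast
    fix s assume s: "s \<in> ?R \<and> (\<forall>t\<in>T. \<sigma> t = s t)"
    then obtain \<sigma>' where "\<sigma>' \<in> G" "s = inv_into G ?r (?r \<sigma>')" by blast
    moreover from this have "?r s = ?r \<sigma>'" using f_inv_into_f[of "?r \<sigma>'" ?r G] by blast
    ultimately show "s = inv_into G ?r (?r \<sigma>)" using s eq by metis
  qed
  have "?R \<subseteq> G" by (auto intro: inv_into_into)
  from that[OF finite_imageI[OF fin] this uniq] show ?thesis .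
qed

end

section \<open>Decompositions seen through a surjection\<close>

text \<open>Both ideals are pulled back to the source. Being nonzero becomes being strictly larger
  than \<open>ker\<close>, and a zero intersection becomes the intersection
  \<open>ker\<close>.\<close>

lemma (in algebra_epi) decomposable_iff:
  "decomposable K B \<longleftrightarrow> (\<exists>H J. alg_ideal K A H \<and> alg_ideal K A J \<and> ker \<subset> H \<and> ker \<subset> J \<and> H \<inter> J = ker \<and>
     (\<forall>x\<in>carrier A. \<exists>h\<in>H. \<exists>j\<in>J. x = h \<oplus> j))"
proof
  assume "decomposable K B"
  then obtain H J where HJ: "alg_ideal K B H" "alg_ideal K B J" "H \<noteq> {\<zero>\<^bsub>B\<^esub>}" "J \<noteq> {\<zero>\<^bsub>B\<^esub>}"
    "H \<inter> J = {\<zero>\<^bsub>B\<^esub>}" "H <+>\<^bsub>B\<^esub> J = carrier B"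
    unfolding decomposable_def by blast
  let ?V = "\<lambda>H. {x \<in> carrier A. \<pi> x \<in> H}"
  have strict: "ker \<subset> ?V H" if id: "alg_ideal K B H" and ne: "H \<noteq> {\<zero>\<^bsub>B\<^esub>}" for H
  proof -
    have H: "\<zero>\<^bsub>B\<^esub> \<in> H" "H \<subseteq> carrier B" using id by (auto simp: B.alg_ideal_iff)
    then obtain y where y: "y \<in> H" "y \<noteq> \<zero>\<^bsub>B\<^esub>" using ne by blast
    then obtain x where "x \<in> carrier A" "y = \<pi> x" using H(2) by (auto elim: carrier_cases)
    then have "x \<in> ?V H" "x \<notin> ker" using y by (auto simp: ker_def)
    moreover have "ker \<subseteq> ?V H" using H by (auto simp: ker_def)
    ultimately show ?thesis by blast
  qed
  have "\<exists>h\<in>?V H. \<exists>j\<in>?V J. x = h \<oplus> j" if x: "x \<in> carrier A" for x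
  proof -
    have "\<pi> x \<in> H <+>\<^bsub>B\<^esub> J" using HJ(6) x by auto
    then obtain h j where hj: "h \<in> H" "j \<in> J" "\<pi> x = h \<oplus>\<^bsub>B\<^esub> j" by (auto simp: set_add_def')
    have "h \<in> carrier B" "j \<in> carrier B" using hj HJ(1,2) by (auto simp: B.alg_ideal_iff)
    then obtain h' j' where hj': "h' \<in> carrier A" "j' \<in> carrier A" "h = \<pi> h'" "j = \<pi> j'"
      by (auto elim!: carrier_cases)
    \<comment> \<open>The lifted components sum to \<open>x\<close> only modulo \<open>ker\<close>;
      the error is absorbed by the second one.\<close>
    let ?k = "x \<oplus> A.neg (h' \<oplus> j')"
    have k: "?k \<in> ker" using hj hj' x by (subst map_eq_iff[symmetric]) (auto simp: map_add)
    then have "?k \<in> ?V J" using strict[OF HJ(2,4)] by blast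
    then have "j' \<oplus> ?k \<in> ?V J"
      using hj hj' HJ(2) by (auto simp: B.alg_ideal_iff map_add simp del: A.neg_closed)
    moreover have "h' \<oplus> (j' \<oplus> ?k) = x"
    proof -
      have "h' \<oplus> (j' \<oplus> ?k) = (h' \<oplus> j') \<oplus> (A.neg (h' \<oplus> j') \<oplus> x)"
        using x hj' A.add_commute[of x "A.neg (h' \<oplus> j')"] by (simp add: A.add_assoc)
      also have "\<dots> = x" using x hj' by (simp add: A.add_assoc[symmetric] A.add_neg del: A.smult_closed)
      finally show ?thesis .
    qed
    moreover have "h' \<in> ?V H" using hj hj' by auto
    ultimately show ?thesis by (intro bexI[of _ h'] bexI[of _ "j' \<oplus> ?k"]) simp_all
  qed
  moreover have "?V H \<inter> ?V J = ker" using HJ(5) by (auto simp: ker_def)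
  ultimately show "\<exists>H J. alg_ideal K A H \<and> alg_ideal K A J \<and> ker \<subset> H \<and> ker \<subset> J \<and> H \<inter> J = ker \<and>
     (\<forall>x\<in>carrier A. \<exists>h\<in>H. \<exists>j\<in>J. x = h \<oplus> j)"
    using strict[OF HJ(1,3)] strict[OF HJ(2,4)] alg_ideal_vimage[OF HJ(1)] alg_ideal_vimage[OF HJ(2)]
    by (intro exI[of _ "?V H"] exI[of _ "?V J"] conjI ballI)
next
  assume "\<exists>H J. alg_ideal K A H \<and> alg_ideal K A J \<and> ker \<subset> H \<and> ker \<subset> J \<and> H \<inter> J = ker \<and>
     (\<forall>x\<in>carrier A. \<exists>h\<in>H. \<exists>j\<in>J. x = h \<oplus> j)"
  then obtain H J where HJ: "alg_ideal K A H" "alg_ideal K A J" "ker \<subset> H" "ker \<subset> J" "H \<inter> J = ker"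
    and sum: "\<forall>x\<in>carrier A. \<exists>h\<in>H. \<exists>j\<in>J. x = h \<oplus> j" by (elim exE conjE)
  have sub: "H \<subseteq> carrier A" "J \<subseteq> carrier A" using HJ by (auto simp: A.alg_ideal_iff)
  have ne: "\<pi> ` I \<noteq> {\<zero>\<^bsub>B\<^esub>}" if "ker \<subset> I" "I \<subseteq> carrier A" for I
    using that by (auto simp: ker_def)
  have "\<pi> ` H \<inter> \<pi> ` J = {\<zero>\<^bsub>B\<^esub>}"
  proof
    show "\<pi> ` H \<inter> \<pi> ` J \<subseteq> {\<zero>\<^bsub>B\<^esub>}"
    proof
      fix y assume "y \<in> \<pi> ` H \<inter> \<pi> ` J"
      then obtain h j where hj: "h \<in> H" "j \<in> J" "y = \<pi> h" "\<pi> h = \<pi> j" by auto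
      then have "h \<oplus> A.neg j \<in> ker" using sub map_eq_iff[of h j] by blast
      then have "h \<oplus> A.neg j \<in> J" using HJ(4) by blast
      then have "h \<oplus> A.neg j \<oplus> j \<in> J" using HJ(2) hj(2) unfolding A.alg_ideal_iff by blast
      moreover have "h \<in> carrier A" "j \<in> carrier A" using hj sub by auto
      ultimately have "h \<in> J" by (simp add: A.add_assoc A.neg_add)
      then have "h \<in> ker" using hj(1) HJ(5) by blast
      then show "y \<in> {\<zero>\<^bsub>B\<^esub>}" using hj(3) by (simp add: ker_def)
    qed
    show "{\<zero>\<^bsub>B\<^esub>} \<subseteq> \<pi> ` H \<inter> \<pi> ` J"
      using alg_ideal_image[OF HJ(1)] alg_ideal_image[OF HJ(2)] by (auto simp: B.alg_ideal_iff)
  qed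
  moreover have "\<pi> ` H <+>\<^bsub>B\<^esub> \<pi> ` J = carrier B"
  proof
    show "\<pi> ` H <+>\<^bsub>B\<^esub> \<pi> ` J \<subseteq> carrier B" using sub by (auto simp: set_add_def' subset_iff)
    show "carrier B \<subseteq> \<pi> ` H <+>\<^bsub>B\<^esub> \<pi> ` J"
    proof
      fix y assume "y \<in> carrier B"
      then obtain x where x: "x \<in> carrier A" "y = \<pi> x" by (rule carrier_cases)
      then obtain h j where hj: "h \<in> H" "j \<in> J" "x = h \<oplus> j" using sum by blast
      then have "h \<in> carrier A" "j \<in> carrier A" using sub by auto
      then have "y = \<pi> h \<oplus>\<^bsub>B\<^esub> \<pi> j" using x(2) hj(3) by (simp add: map_add)
      then show "y \<in> \<pi> ` H <+>\<^bsub>B\<^esub> \<pi> ` J" using hj by (auto simp: set_add_def')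
    qed
  qed
  ultimately show "decomposable K B"
    unfolding decomposable_def
    using alg_ideal_image[OF HJ(1)] alg_ideal_image[OF HJ(2)] ne[OF HJ(3) sub(1)] ne[OF HJ(4) sub(2)]
    by (intro exI[of _ "\<pi> ` H"] exI[of _ "\<pi> ` J"] conjI)
qed

section \<open>The rational form on the level of the magma algebra\<close>

locale rational_form_setting =
  galois_setting L K + enumerated_graph S E vtx + nilpotent_graph_algebra L S E c
  for L K :: "complex set" and S :: "'a set" and E vtx c +
  fixes \<rho> :: "(complex \<Rightarrow> complex) \<Rightarrow> 'a set \<Rightarrow> 'a set"
  assumes \<rho>_hom: "\<rho> \<in> hom (galois_group L K) (quotient_graph_aut S E)"
    and \<rho>_continuous: "continuous_map (krull_topology L K)
           (discrete_topology (carrier (quotient_graph_aut S E))) \<rho>"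
begin

abbreviation perm where "perm \<sigma> \<equiv> vertex_perm S E vtx (\<rho> \<sigma>)"
abbreviation iperm where "iperm \<sigma> \<equiv> inv_into S (perm \<sigma>)"

text \<open>A lift, to coefficient functions, of the action whose fixed points make up the rational
  form.\<close>

definition act where "act \<sigma> f = subst \<sigma> S (iperm \<sigma>) f"

text \<open>Invariance is required modulo \<open>N\<close> only, so these are all representatives of
  all elements of the form.\<close>

definition Fixed where "Fixed = {f \<in> M. \<forall>\<sigma>\<in>G. act \<sigma> f - f \<in> N}"

lemma \<rho>_mem: "\<sigma> \<in> G \<Longrightarrow> \<rho> \<sigma> \<in> carrier (quotient_graph_aut S E)"
  using \<rho>_hom by (auto simp: hom_def)

lemma perm_compose:
  assumes "\<sigma> \<in> G" "\<tau> \<in> G" "\<alpha> \<in> S"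
  shows "perm (compose L \<sigma> \<tau>) \<alpha> = perm \<sigma> (perm \<tau> \<alpha>)"
proof -
  have "\<rho> (compose L \<sigma> \<tau>) = \<rho> \<sigma> \<otimes>\<^bsub>quotient_graph_aut S E\<^esub> \<rho> \<tau>"
    using hom_mult[OF \<rho>_hom assms(1,2)] G_mult[OF assms(1,2)] by simp
  also have "\<dots> = compose \<Lambda> (\<rho> \<sigma>) (\<rho> \<tau>)"
    using \<rho>_mem[OF assms(1)] \<rho>_mem[OF assms(2)] by (simp add: quotient_graph_aut_def BijGroup_def)
  finally have "\<rho> (compose L \<sigma> \<tau>) = compose \<Lambda> (\<rho> \<sigma>) (\<rho> \<tau>)" .
  then show ?thesis using vertex_perm_compose[OF \<rho>_mem[OF assms(2)] assms(3)] by simp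
qed

text \<open>The identity is idempotent, and an injective map that equals its own square is the
  identity.\<close>

lemma perm_id:
  assumes "\<alpha> \<in> S"
  shows "perm (restrict id L) \<alpha> = \<alpha>"
proof -
  let ?i = "restrict id L"
  have "compose L ?i ?i = ?i" by (auto simp: compose_def fun_eq_iff restrict_def)
  then have "perm ?i (perm ?i \<alpha>) = perm ?i \<alpha>" using perm_compose[OF G_id G_id assms] by simp
  then show ?thesis using p_inj[OF \<rho>_mem[OF G_id]] p_S[OF \<rho>_mem[OF G_id]] assms by blast
qed

lemma inverse_on_perm: "\<sigma> \<in> G \<Longrightarrow> inverse_on S (perm \<sigma>) (iperm \<sigma>)"
  using p_S[OF \<rho>_mem] q_facts[OF \<rho>_mem] by (auto simp: inverse_on_def)

lemma endo_on_G: "\<sigma> \<in> G \<Longrightarrow> endo_on L \<sigma>"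
  by (auto simp: endo_on_def G_mem G_add G_times G_one G_zero)

lemma endo_on_id: "endo_on L id"
  by (auto simp: endo_on_def)

lemma admissible_perm: "\<sigma> \<in> G \<Longrightarrow> endo_on L \<tau> \<Longrightarrow> admissible \<tau> S (perm \<sigma>) (iperm \<sigma>)"
  using p_edge_iff[OF \<rho>_mem] inverse_on_perm by (auto simp: admissible_def)

lemma admissible_iperm: "\<sigma> \<in> G \<Longrightarrow> endo_on L \<tau> \<Longrightarrow> admissible \<tau> S (iperm \<sigma>) (perm \<sigma>)"
proof -
  assume a: "\<sigma> \<in> G" "endo_on L \<tau>"
  have "{iperm \<sigma> \<alpha>, iperm \<sigma> \<beta>} \<in> E \<longleftrightarrow> {\<alpha>, \<beta>} \<in> E" if "\<alpha> \<in> S" "\<beta> \<in> S" for \<alpha> \<beta>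
    using p_edge_iff[OF \<rho>_mem[OF a(1)], of "iperm \<sigma> \<alpha>" "iperm \<sigma> \<beta>"] q_facts[OF \<rho>_mem[OF a(1)]] that
    by simp
  then show ?thesis using a inverse_on_perm by (simp add: admissible_def inverse_on_sym)
qed

text \<open>This evaluates the definite description: relabelling has the prescribed values at the
  vertices, and they determine an automorphism.\<close>

lemma lift_aut_nil_class:
  assumes \<sigma>: "\<sigma> \<in> G" and f: "f \<in> M"
  shows "lift_aut L S E c vtx (\<rho> \<sigma>) (cls f) = cls (subst id S (iperm \<sigma>) f)"
proof -
  note adm = admissible_perm[OF \<sigma> endo_on_id]
  note F = graph_aut_induces[OF adm admissible_iperm[OF \<sigma> endo_on_id]]
  let ?P = "\<lambda>f. f \<in> algebra_aut L NLA \<and>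
     (\<forall>l\<in>\<Lambda>. \<forall>j\<in>{1..card l}.
        f (nilpotent_vertex L S E c (vtx l j)) = nilpotent_vertex L S E c (vtx (\<rho> \<sigma> l) j))"
  let ?F = "restrict (\<lambda>v. cls (subst id S (iperm \<sigma>) (SOME f. f \<in> M \<and> v = cls f)))
    (carrier NLA)"
  have vertex: "?F (nilpotent_vertex L S E c \<alpha>) = nilpotent_vertex L S E c (perm \<sigma> \<alpha>)" if "\<alpha> \<in> S" for \<alpha>
    using that F(2)[of "single (Gen \<alpha>)"] p_S[OF \<rho>_mem[OF \<sigma>]]
    by (simp add: nilpotent_vertex_eq subfield subst_M_single[OF adm] del: restrict_apply)
  have "lift_aut L S E c vtx (\<rho> \<sigma>) = ?F"
    unfolding lift_aut_def
  proof (rule the_equality)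
    have "vtx l j \<in> S" if "l \<in> \<Lambda>" "j \<in> {1..card l}" for l j using that vtx_mem \<Lambda>_subset by blast
    then show P: "?P ?F"
      using F(1) vertex by (simp add: vertex_perm_vtx del: restrict_apply)
    fix g assume g: "?P g"
    show "g = ?F"
    proof (rule algebra_aut_eqI)
      fix \<alpha> assume "\<alpha> \<in> S"
      then obtain l j where "l \<in> \<Lambda>" "j \<in> {1..card l}" "\<alpha> = vtx l j" by (rule vtx_cases)
      then show "g (nilpotent_vertex L S E c \<alpha>) = ?F (nilpotent_vertex L S E c \<alpha>)" using g P by simp
    qed (use g F(1) in blast)+
  qed
  then show ?thesis using F(2)[OF f] by simp
qed

lemma twisted_action:
  assumes "\<sigma> \<in> G" "f \<in> M"
  shows "lift_aut L S E c vtx (\<rho> \<sigma>) (galois_action \<sigma> (cls f)) = cls (act \<sigma> f)"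
proof -
  have inv: "inverse_on L \<sigma> (G_inv \<sigma>)" using assms(1) by (auto simp: inverse_on_def G_inv_apply G_mem)
  have "subst id S (iperm \<sigma>) (\<sigma> \<circ> f) = act \<sigma> f" by (auto simp: act_def subst_def)
  then show ?thesis
    using galois_action_nil_class[OF endo_on_G[OF assms(1)] endo_on_G[OF G_inv_G[OF assms(1)]] inv assms(2)]
      lift_aut_nil_class[OF assms(1) conjugation_M[OF endo_on_G[OF assms(1)] endo_on_G[OF G_inv_G[OF assms(1)]] inv assms(2)]]
    by simp
qed

lemmas act_adm = admissible_perm[OF _ endo_on_G]

lemma act_M [simp]: "\<sigma> \<in> G \<Longrightarrow> f \<in> M \<Longrightarrow> act \<sigma> f \<in> M"
  and act_N: "\<sigma> \<in> G \<Longrightarrow> f \<in> N \<Longrightarrow> act \<sigma> f \<in> N"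
  and act_add: "\<sigma> \<in> G \<Longrightarrow> f \<in> M \<Longrightarrow> g \<in> M \<Longrightarrow> act \<sigma> (f + g) = act \<sigma> f + act \<sigma> g"
  and act_diff: "\<sigma> \<in> G \<Longrightarrow> f \<in> M \<Longrightarrow> g \<in> M \<Longrightarrow> act \<sigma> (f - g) = act \<sigma> f - act \<sigma> g"
  and act_conv: "\<sigma> \<in> G \<Longrightarrow> f \<in> M \<Longrightarrow> g \<in> M \<Longrightarrow> act \<sigma> (conv f g) = conv (act \<sigma> f) (act \<sigma> g)"
  and act_scale: "\<sigma> \<in> G \<Longrightarrow> a \<in> L \<Longrightarrow> f \<in> M \<Longrightarrow> act \<sigma> (scale a f) = scale (\<sigma> a) (act \<sigma> f)"
  and act_zero: "\<sigma> \<in> G \<Longrightarrow> act \<sigma> 0 = 0"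
  and act_single: "\<sigma> \<in> G \<Longrightarrow> \<alpha> \<in> S \<Longrightarrow> act \<sigma> (single (Gen \<alpha>)) = single (Gen (perm \<sigma> \<alpha>))"
  unfolding act_def
  using subst_M[OF act_adm] subst_N[OF act_adm] subst_M_add[OF act_adm] subst_M_diff[OF act_adm]
    subst_M_conv[OF act_adm] subst_M_scale[OF act_adm] subst_M_zero[OF act_adm]
    subst_M_single[OF act_adm] p_S[OF \<rho>_mem] by simp_all

lemma act_Gen: "\<sigma> \<in> G \<Longrightarrow> \<alpha> \<in> S \<Longrightarrow> act \<sigma> f (Gen (perm \<sigma> \<alpha>)) = \<sigma> (f (Gen \<alpha>))"
  using p_S[OF \<rho>_mem, of \<sigma> \<alpha>] q_facts(3)[OF \<rho>_mem, of \<sigma> \<alpha>] by (simp add: act_def subst_def)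

lemma Fixed_M: "f \<in> Fixed \<Longrightarrow> f \<in> M"
  and N_Fixed: "f \<in> N \<Longrightarrow> f \<in> Fixed"
  by (auto simp: Fixed_def N_subset act_N N_diff)

lemma K_L: "a \<in> K \<Longrightarrow> a \<in> L"
  using fields(3) by blast

lemma Fixed_closed:
  shows Fixed_add: "f \<in> Fixed \<Longrightarrow> g \<in> Fixed \<Longrightarrow> f + g \<in> Fixed"
    and Fixed_scale: "a \<in> K \<Longrightarrow> f \<in> Fixed \<Longrightarrow> scale a f \<in> Fixed"
    and Fixed_conv: "f \<in> Fixed \<Longrightarrow> g \<in> Fixed \<Longrightarrow> conv f g \<in> Fixed"
proof -
  assume f: "f \<in> Fixed"
  show "scale a f \<in> Fixed" if "a \<in> K"
  proof -
    have "act \<sigma> (scale a f) - scale a f = scale a (act \<sigma> f - f)" if "\<sigma> \<in> G" for \<sigma>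
      using f \<open>a \<in> K\<close> that by (auto simp: act_scale K_L Fixed_M G_fix fun_eq_iff algebra_simps)
    then show ?thesis using f that by (auto simp: Fixed_def K_L intro: N_scale)
  qed
  assume g: "g \<in> Fixed"
  have M: "f \<in> M" "g \<in> M" using f g Fixed_M by auto
  have "act \<sigma> (f + g) - (f + g) \<in> N" if "\<sigma> \<in> G" for \<sigma>
  proof -
    have "act \<sigma> (f + g) - (f + g) = (act \<sigma> f - f) + (act \<sigma> g - g)"
      using M that by (simp add: act_add)
    also have "\<dots> \<in> N" using f g that by (intro N_add) (auto simp: Fixed_def)
    finally show ?thesis .
  qed
  then show "f + g \<in> Fixed" using M by (simp add: Fixed_def)
  \<comment> \<open>One factor is changed at a time, so that each summand contains a factor in
    \<open>N\<close>.\<close>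
  have "act \<sigma> (conv f g) - conv f g = conv (act \<sigma> f - f) (act \<sigma> g) + conv f (act \<sigma> g - g)" if "\<sigma> \<in> G" for \<sigma>
    using M that by (simp add: act_conv) (rule magma_fun_eqI; simp add: algebra_simps)
  moreover have "conv (act \<sigma> f - f) (act \<sigma> g) + conv f (act \<sigma> g - g) \<in> N" if "\<sigma> \<in> G" for \<sigma>
  proof -
    have "act \<sigma> f - f \<in> N" "act \<sigma> g - g \<in> N" using f g that by (auto simp: Fixed_def)
    then show ?thesis using M that by (intro N_add N_conv_left[OF _ act_M] N_conv_right) auto
  qed
  ultimately show "conv f g \<in> Fixed" using M by (auto simp: Fixed_def)
qed

text \<open>The coefficients lie in \<open>L\<close>, but the scalars are those of \<open>K\<close>,
  because \<open>act\<close> is only semilinear over \<open>L\<close>.\<close>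

lemma complex_algebra_Fixed: "complex_algebra K (MA \<lparr>carrier := Fixed\<rparr>)"
proof (rule complex_algebra.intro)
  show "subfield K \<C>" by (rule fields)
  show "\<zero>\<^bsub>MA \<lparr>carrier := Fixed\<rparr>\<^esub> \<in> carrier (MA \<lparr>carrier := Fixed\<rparr>)"
    by (simp add: N_Fixed)
qed (simp_all add: Fixed_add Fixed_conv Fixed_scale add.assoc add.commute conv_add_left conv_add_right
      conv_scale_left conv_scale_right scale_add scale_add_left scale_scale)

lemma rational_form_epi:
  "algebra_epi K (MA \<lparr>carrier := Fixed\<rparr>) (rational_form L K S E c vtx \<rho>) (cls)"
proof -
  have "cls ` Fixed = carrier (rational_form L K S E c vtx \<rho>)"
  proof -
    have eq: "cls (act \<sigma> f) = cls f \<longleftrightarrow> act \<sigma> f - f \<in> N" if "\<sigma> \<in> G" "f \<in> M" for \<sigma> f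
      using that by (intro nil_class_eq_iff) auto
    show ?thesis
    proof
      show "cls ` Fixed \<subseteq> carrier (rational_form L K S E c vtx \<rho>)"
        using nil.image_closed eq by (auto simp: rational_form_def twisted_action Fixed_M) (auto simp: Fixed_def)
      show "carrier (rational_form L K S E c vtx \<rho>) \<subseteq> cls ` Fixed"
      proof
        fix v assume v: "v \<in> carrier (rational_form L K S E c vtx \<rho>)"
        then have "v \<in> carrier NLA" by (auto simp: rational_form_def)
        then obtain f where f: "f \<in> M" "v = cls f" by (rule nil.carrier_cases)
        then have "f \<in> Fixed" using v eq by (auto simp: rational_form_def twisted_action Fixed_def)
        then show "v \<in> cls ` Fixed" using f by blast
      qed
    qed
  qed
  then show ?thesis
    using K_L Fixed_M
    by (intro algebra_epi.intro complex_algebra_Fixed algebra_epi_axioms.intro)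
      (simp_all add: rational_form_def nil.map_zero nil.map_add nil.map_smult nil.map_mult)
qed

definition fixed_ideal where
  "fixed_ideal H \<longleftrightarrow> H \<subseteq> Fixed \<and> 0 \<in> H \<and> (\<forall>f\<in>H. \<forall>g\<in>H. f + g \<in> H) \<and> (\<forall>a\<in>K. \<forall>f\<in>H. scale a f \<in> H) \<and>
     (\<forall>f\<in>Fixed. \<forall>g\<in>H. conv f g \<in> H \<and> conv g f \<in> H)"

lemma decomposable_rational_form_iff:
  "decomposable K (rational_form L K S E c vtx \<rho>) \<longleftrightarrow>
   (\<exists>H J. fixed_ideal H \<and> fixed_ideal J \<and> N \<subset> H \<and> N \<subset> J \<and> H \<inter> J = N \<and>
     (\<forall>f\<in>Fixed. \<exists>h\<in>H. \<exists>j\<in>J. f = h + j))"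
proof -
  interpret p: algebra_epi K "MA \<lparr>carrier := Fixed\<rparr>" "rational_form L K S E c vtx \<rho>" cls
    by (rule rational_form_epi)
  have ker: "p.ker = N"
  proof -
    have "N = {f \<in> M. cls f = \<zero>\<^bsub>NLA\<^esub>}"
      using algebra_epi.ker_def[OF nil_epi] nil_epi_ker by simp
    moreover have "p.ker = {f \<in> Fixed. cls f = \<zero>\<^bsub>NLA\<^esub>}"
      unfolding p.ker_def by (simp add: rational_form_def)
    ultimately show ?thesis using N_Fixed Fixed_M by blast
  qed
  have id: "alg_ideal K (MA \<lparr>carrier := Fixed\<rparr>) H \<longleftrightarrow> fixed_ideal H" for H
    unfolding p.A.alg_ideal_iff fixed_ideal_def by simp
  show ?thesis unfolding p.decomposable_iff id ker by simp
qed

end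

section \<open>A separation stable under the group decomposes the form\<close>

lemma set_magma_ne [simp]: "set_magma t \<noteq> {}"
  by (induction t) auto

context rational_form_setting
begin

abbreviation proj where "proj V \<equiv> subst id V id"

definition stable_separation where
  "stable_separation V \<longleftrightarrow> V \<subseteq> S \<and> V \<noteq> {} \<and> (\<forall>\<alpha>\<in>V. \<forall>\<beta>\<in>S - V. {\<alpha>, \<beta>} \<notin> E) \<and> (\<forall>\<sigma>\<in>G. perm \<sigma> ` V = V)"

text \<open>Elements of the form that are carried, up to \<open>N\<close>, by the monomials in
  \<open>V\<close>.\<close>

definition summand where "summand V = {f \<in> Fixed. f - proj V f \<in> N}"

lemma proj_apply: "proj V f t = (if set_magma t \<subseteq> V then f t else 0)"
  by (simp add: subst_def magma.map_id)

lemma proj_adm: "V \<subseteq> S \<Longrightarrow> admissible id V id id"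
  using endo_on_id by (auto simp: admissible_def inverse_on_def)

lemmas proj_facts = subst_M[OF proj_adm] subst_N[OF proj_adm] subst_M_add[OF proj_adm] subst_M_diff[OF proj_adm]
  subst_M_conv[OF proj_adm]

lemma stable_separation_complement:
  assumes "stable_separation V" "V \<noteq> S"
  shows "stable_separation (S - V)"
proof -
  have "perm \<sigma> ` (S - V) = S - V" if "\<sigma> \<in> G" for \<sigma>
  proof -
    have "inj_on (perm \<sigma>) S" "perm \<sigma> ` S = S"
      using p_bij[OF \<rho>_mem[OF that]] by (auto simp: bij_betw_def)
    then show ?thesis using assms(1) that by (auto simp: stable_separation_def inj_on_image_set_diff[of _ S S V])
  qed
  moreover have "{\<alpha>, \<beta>} \<notin> E" if "\<alpha> \<in> S - V" "\<beta> \<in> S - (S - V)" for \<alpha> \<beta>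
    using assms(1) that edge_sym[of \<alpha> \<beta>] by (auto simp: stable_separation_def)
  ultimately show ?thesis using assms by (auto simp: stable_separation_def)
qed

lemma iperm_stable:
  assumes "stable_separation V" "\<sigma> \<in> G" "\<alpha> \<in> S"
  shows "iperm \<sigma> \<alpha> \<in> V \<longleftrightarrow> \<alpha> \<in> V"
proof -
  have V: "perm \<sigma> ` V = V" "V \<subseteq> S" using assms by (auto simp: stable_separation_def)
  note q = q_facts[OF \<rho>_mem[OF assms(2)]]
  show ?thesis
  proof
    assume "iperm \<sigma> \<alpha> \<in> V"
    then have "perm \<sigma> (iperm \<sigma> \<alpha>) \<in> V" using V by blast
    then show "\<alpha> \<in> V" using q assms(3) by simp
  next
    assume "\<alpha> \<in> V"
    then obtain \<beta> where "\<beta> \<in> V" "\<alpha> = perm \<sigma> \<beta>" using V by blast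
    then show "iperm \<sigma> \<alpha> \<in> V" using q(3)[of \<beta>] V by auto
  qed
qed

text \<open>The relabelling preserves \<open>V\<close>, so projecting commutes with the action;
  moreover the projection preserves \<open>N\<close>.\<close>

lemma proj_Fixed:
  assumes V: "stable_separation V" and f: "f \<in> Fixed"
  shows "proj V f \<in> Fixed"
proof -
  have VS: "V \<subseteq> S" using V by (auto simp: stable_separation_def)
  have "act \<sigma> (proj V f) - proj V f = proj V (act \<sigma> f - f)" if \<sigma>: "\<sigma> \<in> G" for \<sigma>
  proof (rule ext)
    fix t
    have "set_magma (map_magma (iperm \<sigma>) t) \<subseteq> V \<longleftrightarrow> set_magma t \<subseteq> V" if "set_magma t \<subseteq> S"
      using iperm_stable[OF V \<sigma>] that by (auto simp: magma.set_map)
    then show "(act \<sigma> (proj V f) - proj V f) t = proj V (act \<sigma> f - f) t"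
      using VS \<sigma> by (auto simp: act_def proj_apply subst_def[of \<sigma>] G_zero)
  qed
  then show ?thesis
    using f VS proj_facts(1,2) by (auto simp: Fixed_def)
qed

text \<open>Every monomial contains a vertex, so it cannot lie on both sides. Removing the two
  projections therefore leaves exactly the monomials that mix the sides.\<close>

lemma proj_sum:
  assumes V: "stable_separation V" and f: "f \<in> M"
  shows "f - proj V f - proj (S - V) f \<in> N"
proof (rule N_mixed[of V])
  have VS: "V \<subseteq> S" using V by (auto simp: stable_separation_def)
  then show "f - proj V f - proj (S - V) f \<in> M" using f by (intro M_diff proj_facts(1)) auto
  show "V \<subseteq> S" by fact
  show "\<And>\<alpha> \<beta>. \<alpha> \<in> V \<Longrightarrow> \<beta> \<in> S - V \<Longrightarrow> {\<alpha>, \<beta>} \<notin> E" using V by (auto simp: stable_separation_def)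
  fix t assume "(f - proj V f - proj (S - V) f) t \<noteq> 0"
  moreover have "set_magma t \<subseteq> V \<Longrightarrow> \<not> set_magma t \<subseteq> S - V" using set_magma_ne[of t] by blast
  ultimately show "\<not> set_magma t \<subseteq> V \<and> \<not> set_magma t \<subseteq> S - V"
    by (auto simp: proj_apply split: if_splits)
qed

lemma proj_cross:
  assumes V: "stable_separation V" and f: "f \<in> M" "g \<in> M"
  shows "conv (proj (S - V) f) (proj V g) \<in> N" "conv (proj V g) (proj (S - V) f) \<in> N"
proof -
  have VS: "V \<subseteq> S" using V by (auto simp: stable_separation_def)
  have M: "proj (S - V) f \<in> M" "proj V g \<in> M" using f VS by (auto intro!: proj_facts(1))
  have "\<not> set_magma t \<subseteq> V \<and> \<not> set_magma t \<subseteq> S - V" if "conv (proj (S - V) f) (proj V g) t \<noteq> 0" for t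
  proof (cases t)
    case (Mul u v)
    then have "set_magma u \<subseteq> S - V" "set_magma v \<subseteq> V"
      using that by (auto simp: proj_apply split: if_splits)
    then show ?thesis using set_magma_ne[of u] set_magma_ne[of v] unfolding Mul magma.set by blast
  qed (use that in simp)
  then show *: "conv (proj (S - V) f) (proj V g) \<in> N"
    using V M by (intro N_mixed[of V]) (auto simp: stable_separation_def)
  show "conv (proj V g) (proj (S - V) f) \<in> N" by (rule N_swap[OF M *])
qed

lemma summand_conv:
  assumes V: "stable_separation V" and f: "f \<in> Fixed" and g: "g \<in> summand V"
  shows "conv f g \<in> summand V" "conv g f \<in> summand V"
proof -
  have VS: "V \<subseteq> S" using V by (auto simp: stable_separation_def)
  have g': "g \<in> Fixed" "g - proj V g \<in> N" using g by (auto simp: summand_def)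
  have M: "f \<in> M" "g \<in> M" "proj V f \<in> M" "proj V g \<in> M" "proj (S - V) f \<in> M"
    using f g' VS by (auto simp: Fixed_M intro!: proj_facts(1))
  note s = proj_sum[OF V M(1)] and x = proj_cross[OF V M(1,2)]
  \<comment> \<open>First \<open>g\<close> is replaced by its projection, then \<open>f\<close> by
    the sum of its two projections; the last term is the cross term. Each of these lies in
    \<open>N\<close>.\<close>
  have "conv f g - proj V (conv f g) =
    conv f (g - proj V g) + conv (f - proj V f - proj (S - V) f) (proj V g) + conv (proj (S - V) f) (proj V g)"
    unfolding proj_facts(5)[OF VS M(1,2)] by (rule magma_fun_eqI) (simp_all add: algebra_simps)
  also have "\<dots> \<in> N"
    by (rule N_add[OF N_add[OF N_conv_right[OF M(1) g'(2)] N_conv_left[OF s M(4)]] x(1)])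
  finally show "conv f g \<in> summand V" using Fixed_conv[OF f g'(1)] by (simp add: summand_def)
  have "conv g f - proj V (conv g f) =
    conv (g - proj V g) f + conv (proj V g) (f - proj V f - proj (S - V) f) + conv (proj V g) (proj (S - V) f)"
    unfolding proj_facts(5)[OF VS M(2,1)] by (rule magma_fun_eqI) (simp_all add: algebra_simps)
  also have "\<dots> \<in> N"
    by (rule N_add[OF N_add[OF N_conv_left[OF g'(2) M(1)] N_conv_right[OF M(4) s]] x(2)])
  finally show "conv g f \<in> summand V" using Fixed_conv[OF g'(1) f] by (simp add: summand_def)
qed

lemma fixed_ideal_summand:
  assumes V: "stable_separation V"
  shows "fixed_ideal (summand V)"
  unfolding fixed_ideal_def
proof (intro conjI ballI)
  have VS: "V \<subseteq> S" using V by (auto simp: stable_separation_def)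
  show "summand V \<subseteq> Fixed" by (auto simp: summand_def)
  have "proj V 0 = 0" by (simp add: subst_def fun_eq_iff)
  then show "0 \<in> summand V" by (simp add: summand_def N_Fixed)
  fix f assume f: "f \<in> summand V"
  then have fM: "f \<in> M" by (auto simp: summand_def Fixed_M)
  show "f + g \<in> summand V" if g: "g \<in> summand V" for g
  proof -
    have "(f - proj V f) + (g - proj V g) \<in> N" using f g by (intro N_add) (auto simp: summand_def)
    moreover have "proj V (f + g) = proj V f + proj V g" by (auto simp: proj_apply fun_eq_iff)
    ultimately show ?thesis using f g by (simp add: summand_def Fixed_add algebra_simps)
  qed
  show "scale a f \<in> summand V" if "a \<in> K" for a
  proof -
    have "scale a (f - proj V f) \<in> N" using f that K_L by (intro N_scale) (auto simp: summand_def)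
    moreover have "scale a f - proj V (scale a f) = scale a (f - proj V f)"
      by (auto simp: proj_apply fun_eq_iff algebra_simps)
    ultimately show ?thesis using f that by (simp add: summand_def Fixed_scale)
  qed
qed (use summand_conv[OF V] in auto)

lemma N_psubset_summand:
  assumes V: "stable_separation V"
  shows "N \<subset> summand V"
proof -
  have VS: "V \<subseteq> S" "V \<noteq> {}" using V by (auto simp: stable_separation_def)
  \<comment> \<open>The sum of the vertices in \<open>V\<close>: fixed because the group permutes
    \<open>V\<close>, and outside \<open>N\<close> because of its linear part.\<close>
  let ?v = "\<lambda>t. case t of Gen \<alpha> \<Rightarrow> if \<alpha> \<in> V then 1 else 0 | Mul _ _ \<Rightarrow> (0::complex)"
  have "{t. ?v t \<noteq> 0} \<subseteq> Gen ` V"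
  proof
    fix t assume "t \<in> {t. ?v t \<noteq> 0}"
    then show "t \<in> Gen ` V" by (cases t) (auto split: if_splits)
  qed
  moreover have "finite V" using VS finite_S finite_subset by blast
  ultimately have "finite {t. ?v t \<noteq> 0}" using finite_subset by blast
  then have M: "?v \<in> M" using L_closed VS by (auto simp: free_carrier_def split: magma.splits)
  have "act \<sigma> ?v = ?v" if \<sigma>: "\<sigma> \<in> G" for \<sigma>
  proof (rule magma_fun_eqI)
    show "act \<sigma> ?v (Gen \<alpha>) = ?v (Gen \<alpha>)" for \<alpha>
      using iperm_stable[OF V \<sigma>, of \<alpha>] \<sigma> VS by (auto simp: act_def subst_def G_zero G_one)
    show "act \<sigma> ?v (Mul u w) = ?v (Mul u w)" for u w
      using \<sigma> by (simp add: act_def subst_def G_zero)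
  qed
  then have "?v \<in> Fixed" using M by (simp add: Fixed_def)
  moreover have "proj V ?v = ?v"
    by (rule magma_fun_eqI) (auto simp: proj_apply)
  ultimately have "?v \<in> summand V" by (simp add: summand_def)
  moreover obtain \<alpha> where "\<alpha> \<in> V" using VS by blast
  then have "?v \<notin> N" using N_low_degree(1)[of ?v \<alpha>] by auto
  moreover have "f \<in> summand V" if "f \<in> N" for f
    using N_diff[OF that proj_facts(2)[OF VS(1) that]] that by (simp add: summand_def N_Fixed)
  ultimately show ?thesis by blast
qed

lemma decomposable_if_separated:
  assumes V: "stable_separation V" and ne: "V \<noteq> S"
  shows "decomposable K (rational_form L K S E c vtx \<rho>)"
proof -
  let ?W = "S - V"
  have W: "stable_separation ?W" using stable_separation_complement[OF V ne] .
  have VS: "V \<subseteq> S" "?W \<subseteq> S" using V by (auto simp: stable_separation_def)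
  have disj: "set_magma t \<subseteq> V \<Longrightarrow> \<not> set_magma t \<subseteq> ?W" for t :: "'a magma" using set_magma_ne[of t] by blast
  have pp: "proj V (proj ?W f) = 0" "proj ?W (proj V f) = 0" "proj V (proj V f) = proj V f" for f
    using disj by (auto simp: proj_apply fun_eq_iff)
  have "summand V \<inter> summand ?W = N"
  proof
    show "summand V \<inter> summand ?W \<subseteq> N"
    proof
      fix f assume "f \<in> summand V \<inter> summand ?W"
      then have f: "f \<in> M" "f - proj V f \<in> N" "f - proj ?W f \<in> N" by (auto simp: summand_def Fixed_M)
      have "proj V (f - proj ?W f) \<in> N" using f VS by (intro proj_facts(2))
      then have "proj V f \<in> N"
        using proj_facts(4)[OF VS(1) f(1) proj_facts(1)[OF VS(2) f(1)]] pp by simp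
      from N_add[OF f(2) this] show "f \<in> N" by simp
    qed
  qed (use N_psubset_summand[OF V] N_psubset_summand[OF W] in blast)
  moreover have "\<exists>h\<in>summand V. \<exists>j\<in>summand ?W. f = h + j" if f: "f \<in> Fixed" for f
  proof (intro bexI)
    have M: "f \<in> M" using f Fixed_M by blast
    show "f = proj V f + (f - proj V f)" by simp
    show "proj V f \<in> summand V" using proj_Fixed[OF V f] pp by (simp add: summand_def)
    have "f - proj V f \<in> Fixed"
      using Fixed_add[OF f Fixed_scale[OF subfield_complex_closed(9)[OF fields(1)] proj_Fixed[OF V f]]]
      by (simp add: scale_minus_one)
    moreover have "proj ?W (f - proj V f) = proj ?W f"
      using proj_facts(4)[OF VS(2) M proj_facts(1)[OF VS(1) M]] pp by simp
    ultimately show "f - proj V f \<in> summand ?W" using proj_sum[OF V M] by (simp add: summand_def)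
  qed
  ultimately show ?thesis
    unfolding decomposable_rational_form_iff
    using fixed_ideal_summand[OF V] fixed_ideal_summand[OF W] N_psubset_summand[OF V] N_psubset_summand[OF W]
    by (intro exI[of _ "summand V"] exI[of _ "summand ?W"] conjI ballI)
qed

text \<open>The union of the translates of \<open>C\<close> is a union of components, so no edge
  leaves it. If it were all of \<open>S\<close>, some translate would meet \<open>C'\<close> and
  hence be equal to it.\<close>

lemma stable_separation_orbit:
  assumes C: "C \<in> connected_comps S E" "C' \<in> connected_comps S E" and no: "\<And>\<sigma>. \<sigma> \<in> G \<Longrightarrow> perm \<sigma> ` C \<noteq> C'"
  obtains V where "stable_separation V" "V \<noteq> S"
proof -
  let ?V = "\<Union>\<sigma>\<in>G. perm \<sigma> ` C"
  have comp: "perm \<sigma> ` C \<in> connected_comps S E" if "\<sigma> \<in> G" for \<sigma> using p_comp[OF \<rho>_mem[OF that] C(1)] .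
  have sub: "D \<subseteq> S" "D \<noteq> {}" if "D \<in> connected_comps S E" for D
    using that equiv_conn in_quotient_imp_subset in_quotient_imp_non_empty unfolding comps_eq by blast+
  have disj: "D = D'" if "D \<in> connected_comps S E" "D' \<in> connected_comps S E" "\<alpha> \<in> D" "\<alpha> \<in> D'" for D D' \<alpha>
    using that quotient_disj[OF equiv_conn] unfolding comps_eq by blast
  have "?V \<subseteq> S" using comp sub by blast
  moreover have "?V \<noteq> {}" using G_id sub[OF C(1)] by blast
  moreover have "{\<alpha>, \<beta>} \<notin> E" if ab: "\<alpha> \<in> ?V" "\<beta> \<in> S - ?V" for \<alpha> \<beta>
  proof
    assume e: "{\<alpha>, \<beta>} \<in> E"
    obtain \<sigma> where \<sigma>: "\<sigma> \<in> G" "\<alpha> \<in> perm \<sigma> ` C" using ab by blast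
    have "(\<alpha>, \<beta>) \<in> conn" using e edgeD[OF e] by (auto simp: connected_rel_def)
    then have "\<beta> \<in> perm \<sigma> ` C"
      using in_quotient_imp_closed[OF equiv_conn _ \<sigma>(2)] comp[OF \<sigma>(1)] unfolding comps_eq by blast
    then show False using ab \<sigma> by blast
  qed
  moreover have "perm \<tau> ` ?V = ?V" if \<tau>: "\<tau> \<in> G" for \<tau>
  proof -
    have "perm \<tau> ` ?V \<subseteq> ?V"
    proof clarify
      fix \<sigma> \<alpha> assume "\<sigma> \<in> G" "\<alpha> \<in> C"
      then have "perm \<tau> (perm \<sigma> \<alpha>) = perm (compose L \<tau> \<sigma>) \<alpha>" using perm_compose[OF \<tau>] sub[OF C(1)] by auto
      then show "perm \<tau> (perm \<sigma> \<alpha>) \<in> ?V" using G_compose[OF \<tau> \<open>\<sigma> \<in> G\<close>] \<open>\<alpha> \<in> C\<close> by blast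
    qed
    moreover have "inj_on (perm \<tau>) ?V"
      using p_bij[OF \<rho>_mem[OF \<tau>]] \<open>?V \<subseteq> S\<close> by (auto simp: bij_betw_def intro: inj_on_subset)
    moreover have "finite ?V" using \<open>?V \<subseteq> S\<close> finite_S finite_subset by blast
    ultimately show ?thesis by (intro endo_inj_surj)
  qed
  ultimately have "stable_separation ?V" by (simp add: stable_separation_def)
  moreover have "?V \<noteq> S"
  proof
    assume "?V = S"
    obtain \<alpha> where "\<alpha> \<in> C'" using sub[OF C(2)] by blast
    then have "\<alpha> \<in> ?V" using sub[OF C(2)] \<open>?V = S\<close> by blast
    then obtain \<sigma> where "\<sigma> \<in> G" "\<alpha> \<in> perm \<sigma> ` C" by blast
    then show False using disj[OF comp C(2)] \<open>\<alpha> \<in> C'\<close> no by blast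
  qed
  ultimately show ?thesis using that by blast
qed

end

section \<open>Descent\<close>

lemma sum_fun_apply: "(\<Sum>i\<in>I. f i) t = (\<Sum>i\<in>I. f i t)"
  by (induction I rule: infinite_finite_induct) simp_all

lemma scale_sum: "scale a (\<Sum>i\<in>I. f i) = (\<Sum>i\<in>I. scale a (f i))"
  by (rule ext) (simp add: sum_fun_apply sum_distrib_left)

lemma scale_diff: "scale a (f - g) = scale a f - scale a g"
  by (auto simp: fun_eq_iff algebra_simps)

lemma scale_diff_left: "scale (a - b) f = scale a f - scale b f"
  by (auto simp: fun_eq_iff algebra_simps)

context rational_form_setting
begin

section \<open>Spans over the large field\<close>

inductive_set Lspan :: "('a magma \<Rightarrow> complex) set \<Rightarrow> ('a magma \<Rightarrow> complex) set" for A where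
  zero: "0 \<in> Lspan A"
| step: "f \<in> Lspan A \<Longrightarrow> a \<in> L \<Longrightarrow> h \<in> A \<Longrightarrow> f + scale a h \<in> Lspan A"

lemma Lspan_base: "h \<in> A \<Longrightarrow> h \<in> Lspan A"
  using Lspan.step[OF Lspan.zero, of 1 h A] L_closed by simp

lemma Lspan_add:
  assumes "f \<in> Lspan A" "g \<in> Lspan A" shows "f + g \<in> Lspan A"
  using assms(2)
proof (induction g rule: Lspan.induct)
  case zero
  then show ?case using assms(1) by (simp only: add_0_right)
next
  case (step g a h)
  then show ?case unfolding add.assoc[symmetric] by (intro Lspan.step)
qed

lemma Lspan_scale:
  assumes "b \<in> L" "f \<in> Lspan A" shows "scale b f \<in> Lspan A"
  using assms(2)
proof (induction f rule: Lspan.induct)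
  case zero
  show ?case unfolding scale_zero_right by (rule Lspan.zero)
next
  case (step f a h)
  then show ?case
    unfolding scale_add scale_scale using assms(1) L_closed(4) by (intro Lspan.step)
qed

lemma Lspan_least:
  assumes "f \<in> Lspan A" "A \<subseteq> Z" "0 \<in> Z" "\<And>f g. f \<in> Z \<Longrightarrow> g \<in> Z \<Longrightarrow> f + g \<in> Z"
    "\<And>a f. a \<in> L \<Longrightarrow> f \<in> Z \<Longrightarrow> scale a f \<in> Z"
  shows "f \<in> Z"
  using assms(1) by induction (use assms(2-) in blast)+

lemma Lspan_M: "A \<subseteq> M \<Longrightarrow> f \<in> Lspan A \<Longrightarrow> f \<in> M"
  by (erule Lspan_least) auto

lemma Lspan_conv:
  assumes "\<And>f g. f \<in> A \<Longrightarrow> g \<in> A \<Longrightarrow> conv f g \<in> A" and f: "f \<in> Lspan A" and g: "g \<in> Lspan A"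
  shows "conv f g \<in> Lspan A"
proof -
  have *: "conv f g \<in> Lspan A" if "f \<in> A" for f
  proof -
    have "g \<in> {g. conv f g \<in> Lspan A}"
      using g by (rule Lspan_least)
        (auto simp: conv_add_right conv_scale_right that assms(1) intro: Lspan.zero Lspan_base Lspan_add Lspan_scale)
    then show ?thesis by simp
  qed
  have "f \<in> {f. conv f g \<in> Lspan A}"
    using f by (rule Lspan_least)
      (auto simp: conv_add_left conv_scale_left * intro: Lspan.zero Lspan_base Lspan_add Lspan_scale)
  then show ?thesis by simp
qed

lemma Lspan_sum_repr:
  assumes "f \<in> Lspan A"
  shows "\<exists>(n::nat) a h. (\<forall>i<n. a i \<in> L \<and> h i \<in> A) \<and> f = (\<Sum>i<n. scale (a i) (h i))"
  using assms
proof (induction f rule: Lspan.induct)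
  case zero
  show ?case by (rule exI[of _ "0::nat"]) (simp only: lessThan_0 sum.empty, simp)
next
  case (step f b g)
  then obtain n :: nat and a h where ah: "\<forall>i<n. a i \<in> L \<and> h i \<in> A" and f: "f = (\<Sum>i<n. scale (a i) (h i))"
    by (elim exE conjE)
  have "(\<Sum>i<n. scale ((a(n := b)) i) ((h(n := g)) i)) = f"
    unfolding f by (intro sum.cong) auto
  then have "f + scale b g = (\<Sum>i<Suc n. scale ((a(n := b)) i) ((h(n := g)) i))" by simp
  moreover have "\<forall>i<Suc n. (a(n := b)) i \<in> L \<and> (h(n := g)) i \<in> A" using ah step by (auto simp: less_Suc_eq)
  ultimately show ?case by (intro exI conjI)
qed

lemma sum_scale_M:
  assumes "\<And>i. i < n \<Longrightarrow> a i \<in> L" "\<And>i. i < n \<Longrightarrow> h i \<in> M"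
  shows "(\<Sum>i<(n::nat). scale (a i) (h i)) \<in> M"
  using assms
proof (induction n)
  case 0
  show ?case unfolding lessThan_0 sum.empty by (rule M.zero_closed)
next
  case (Suc n)
  have "(\<Sum>i<n. scale (a i) (h i)) \<in> M" by (rule Suc.IH) (use Suc.prems in auto)
  moreover have "scale (a n) (h n) \<in> M" using Suc.prems by (intro M.smult_closed) auto
  ultimately show ?case unfolding sum.lessThan_Suc by (rule M.add_closed)
qed

text \<open>The vectors \<open>h i\<close> are fixed modulo \<open>N\<close>, so the action is felt
  only by the coefficients.\<close>

lemma act_sum_scale:
  assumes \<sigma>: "\<sigma> \<in> G" and "\<And>i. i < n \<Longrightarrow> a i \<in> L" "\<And>i. i < n \<Longrightarrow> h i \<in> Fixed"
  shows "act \<sigma> (\<Sum>i<(n::nat). scale (a i) (h i)) - (\<Sum>i<n. scale (\<sigma> (a i)) (h i)) \<in> N"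
  using assms(2,3)
proof (induction n)
  case 0
  have "act \<sigma> 0 - 0 \<in> N" using act_zero[OF \<sigma>] by simp
  then show ?case by (simp only: lessThan_0 sum.empty)
next
  case (Suc n)
  let ?s = "\<Sum>i<n. scale (a i) (h i)"
  have s: "?s \<in> M" using Suc.prems by (intro sum_scale_M) (auto simp: Fixed_M)
  have h: "h n \<in> Fixed" "h n \<in> M" "a n \<in> L" using Suc.prems Fixed_M by auto
  have eq: "act \<sigma> (?s + scale (a n) (h n)) = act \<sigma> ?s + scale (\<sigma> (a n)) (act \<sigma> (h n))"
    using \<sigma> s h by (simp add: act_add act_scale)
  have IH: "act \<sigma> ?s - (\<Sum>i<n. scale (\<sigma> (a i)) (h i)) \<in> N"
    by (rule Suc.IH) (use Suc.prems in auto)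
  have last: "scale (\<sigma> (a n)) (act \<sigma> (h n) - h n) \<in> N"
    by (rule N_scale[OF G_mem[OF \<sigma> h(3)]]) (use h(1) \<sigma> in \<open>auto simp: Fixed_def\<close>)
  have "act \<sigma> (?s + scale (a n) (h n)) - ((\<Sum>i<n. scale (\<sigma> (a i)) (h i)) + scale (\<sigma> (a n)) (h n)) =
      (act \<sigma> ?s - (\<Sum>i<n. scale (\<sigma> (a i)) (h i))) + scale (\<sigma> (a n)) (act \<sigma> (h n) - h n)"
    unfolding eq scale_diff by (simp only: add_diff_add)
  then have "act \<sigma> (?s + scale (a n) (h n)) - ((\<Sum>i<n. scale (\<sigma> (a i)) (h i)) + scale (\<sigma> (a n)) (h n)) \<in> N"
    using N_add[OF IH last] by (simp only:)
  then show ?case unfolding sum.lessThan_Suc .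
qed

text \<open>Induction on the length of a relation over \<open>L\<close>: subtracting a Galois conjugate shortens it.\<close>

lemma fixed_in_Lspan:
  assumes H: "H \<subseteq> Fixed" "N \<subseteq> H" "\<And>f g. f \<in> H \<Longrightarrow> g \<in> H \<Longrightarrow> f + g \<in> H"
      "\<And>a f. a \<in> K \<Longrightarrow> f \<in> H \<Longrightarrow> scale a f \<in> H"
    and v: "v \<in> Fixed" and g: "g \<in> Lspan H" "v - g \<in> N"
  shows "v \<in> H"
proof -
  have main: "v \<in> H" if "\<And>i. i < n \<Longrightarrow> a i \<in> L" "\<And>i. i < n \<Longrightarrow> h i \<in> H" "v \<in> Fixed"
    "v - (\<Sum>i<n. scale (a i) (h i)) \<in> N" for n :: nat and a h v
    using that
  proof (induction n arbitrary: a v)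
    case 0
    then have "v - 0 \<in> N" by (simp only: lessThan_0 sum.empty)
    then show ?case using H(2) by auto
  next
    case (Suc n)
    let ?s = "\<lambda>a. \<Sum>i<n. scale (a i) (h i)"
    let ?b = "a n"
    have b: "?b \<in> L" and hn: "h n \<in> H" "h n \<in> Fixed" "h n \<in> M" using Suc.prems H(1) Fixed_M by auto
    have vs: "v - ?s a - scale ?b (h n) \<in> N"
      using Suc.prems(4) unfolding sum.lessThan_Suc diff_diff_eq .
    \<comment> \<open>A last coefficient in \<open>K\<close> can be moved over to \<open>v\<close>,
      since \<open>K\<close>-multiples of \<open>h n\<close> are fixed and lie in
      \<open>H\<close>.\<close>
    show ?case
    proof (cases "?b \<in> K")
      case True
      then have "-?b \<in> K" using subfield_complex_closed(5)[OF fields(1)] by blast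
      have eq: "v + scale (-?b) (h n) - ?s a = v - ?s a - scale ?b (h n)"
        by (rule ext) simp
      have "v + scale (-?b) (h n) \<in> H"
      proof (rule Suc.IH[of a])
        show "v + scale (-?b) (h n) \<in> Fixed"
          by (rule Fixed_add[OF Suc.prems(3) Fixed_scale[OF \<open>-?b \<in> K\<close> hn(2)]])
        show "v + scale (-?b) (h n) - ?s a \<in> N" unfolding eq by (rule vs)
      qed (use Suc.prems in auto)
      from H(3)[OF this H(4)[OF True hn(1)]] have "v + scale (-?b) (h n) + scale ?b (h n) \<in> H" .
      also have "v + scale (-?b) (h n) + scale ?b (h n) = v" by (rule ext) simp
      finally show ?thesis .
    next
      case False
      then obtain \<sigma> where \<sigma>: "\<sigma> \<in> G" "\<sigma> ?b \<noteq> ?b" using fixed_field[OF b] by blast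
      \<comment> \<open>Subtracting the conjugate by \<open>\<sigma>\<close> eliminates
        \<open>v\<close> and leaves a relation among the \<open>h i\<close>; division by
        \<open>d\<close> makes its last coefficient 1.\<close>
      define d where "d = \<sigma> ?b - ?b"
      have d: "d \<noteq> 0" "d \<in> L" using \<sigma> b L_closed G_mem by (auto simp: d_def)
      define e where "e i = (\<sigma> (a i) - a i) / d" for i
      have e: "e i \<in> L" if "i < n" for i using Suc.prems(1)[of i] that d \<sigma> L_closed G_mem by (auto simp: e_def)
      have hF: "h i \<in> Fixed" if "i < Suc n" for i using Suc.prems(2)[OF that] H(1) by blast
      have vM: "v \<in> M" using Suc.prems(3) Fixed_M by blast
      let ?S = "\<lambda>a. \<Sum>i<Suc n. scale (a i) (h i)"
      have SM: "?S a \<in> M" using Suc.prems(1) hF Fixed_M by (intro sum_scale_M) auto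
      have "act \<sigma> (v - ?S a) \<in> N" using Suc.prems(4) by (intro act_N \<sigma>)
      moreover have "act \<sigma> v - v \<in> N" using Suc.prems(3) \<sigma> by (auto simp: Fixed_def)
      moreover have "act \<sigma> (?S a) - ?S (\<lambda>i. \<sigma> (a i)) \<in> N"
        using Suc.prems(1) hF by (intro act_sum_scale \<sigma>) auto
      ultimately have "act \<sigma> (v - ?S a) - (act \<sigma> v - v) + (act \<sigma> (?S a) - ?S (\<lambda>i. \<sigma> (a i))) \<in> N"
        by (rule N_add[OF N_diff])
      also have "act \<sigma> (v - ?S a) - (act \<sigma> v - v) + (act \<sigma> (?S a) - ?S (\<lambda>i. \<sigma> (a i))) = v - ?S (\<lambda>i. \<sigma> (a i))"
        unfolding act_diff[OF \<sigma>(1) vM SM] by (rule ext) (simp del: sum.lessThan_Suc)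
      finally have "(v - ?S a) - (v - ?S (\<lambda>i. \<sigma> (a i))) \<in> N" by (rule N_diff[OF Suc.prems(4)])
      also have "(v - ?S a) - (v - ?S (\<lambda>i. \<sigma> (a i))) = ?S (\<lambda>i. \<sigma> (a i)) - ?S a"
        by (rule ext) (simp del: sum.lessThan_Suc)
      also have "?S (\<lambda>i. \<sigma> (a i)) - ?S a = ?S (\<lambda>i. \<sigma> (a i) - a i)"
        by (simp only: scale_diff_left sum_subtractf)
      finally have "scale (1 / d) (?S (\<lambda>i. \<sigma> (a i) - a i)) \<in> N"
        by (rule N_scale[rotated]) (use d L_closed in auto)
      also have "scale (1 / d) (?S (\<lambda>i. \<sigma> (a i) - a i)) = ?s e + h n"
      proof -
        have "scale (1 / d) (scale (\<sigma> (a i) - a i) (h i)) = scale (e i) (h i)" for i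
          by (simp only: scale_scale e_def) (simp only: times_divide_eq_left mult_1)
        moreover have "scale (e n) (h n) = h n" using d by (simp only: e_def d_def[symmetric]) simp
        ultimately show ?thesis by (simp only: scale_sum sum.lessThan_Suc scale_add)
      qed
      finally have "scale ?b (?s e + h n) \<in> N" by (rule N_scale[OF b])
      \<comment> \<open>Adding \<open>?b\<close> times the relation cancels \<open>h n\<close>, so
        \<open>v\<close> is expressed by the first \<open>n\<close> vectors.\<close>
      then have "v - ?s a - scale ?b (h n) + scale ?b (?s e + h n) \<in> N" by (intro N_add vs)
      also have "v - ?s a - scale ?b (h n) + scale ?b (?s e + h n) = v - (?s a - scale ?b (?s e))"
        by (rule ext) (simp add: algebra_simps)
      also have "?s a - scale ?b (?s e) = ?s (\<lambda>i. a i - ?b * e i)"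
        by (simp only: scale_sum scale_scale scale_diff_left sum_subtractf)
      finally show ?thesis
      proof (rule Suc.IH[of "\<lambda>i. a i - ?b * e i", rotated 3])
        show "a i - ?b * e i \<in> L" if "i < n" for i
          using Suc.prems(1)[of i] that e[OF that] b L_closed by auto
      qed (use Suc.prems in auto)
    qed
  qed
  obtain n :: nat and a h where "\<forall>i<n. a i \<in> L \<and> h i \<in> H" "g = (\<Sum>i<n. scale (a i) (h i))"
    using Lspan_sum_repr[OF g(1)] by (elim exE conjE)
  then show ?thesis using main[of n a h v] v g(2) by simp
qed

text \<open>The trace-like vectors \<open>\<Sum>s. s x e\<^sub>s\<^sub>\<alpha>\<close> are fixed, and a Lagrange interpolation
  polynomial in the conjugates combines them to a single generator.\<close>

lemma single_in_Lspan:
  assumes \<alpha>: "\<alpha> \<in> S"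
  shows "single (Gen \<alpha>) \<in> Lspan Fixed"
proof -
  let ?i = "restrict id L"
  obtain T where T: "finite T" "T \<subseteq> L" and \<rho>T: "\<And>\<sigma>. \<sigma> \<in> G \<Longrightarrow> (\<And>t. t \<in> T \<Longrightarrow> \<sigma> t = ?i t) \<Longrightarrow> \<rho> \<sigma> = \<rho> ?i"
    by (rule locally_constant[OF \<rho>_continuous G_id]) blast
  obtain R where R: "finite R" "R \<subseteq> G" and uniq: "\<And>\<sigma>. \<sigma> \<in> G \<Longrightarrow> \<exists>!s. s \<in> R \<and> (\<forall>t\<in>T. \<sigma> t = s t)"
    by (rule restriction_representatives[OF T]) blast
  have perm_T: "perm \<sigma> \<beta> = perm \<tau> \<beta>" if st: "\<sigma> \<in> G" "\<tau> \<in> G" "\<forall>t\<in>T. \<sigma> t = \<tau> t" and \<beta>: "\<beta> \<in> S" for \<sigma> \<tau> \<beta>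
  proof -
    \<comment> \<open>\<open>?k\<close> agrees with the identity on \<open>T\<close>, so it acts
      trivially on the vertices, and \<open>\<sigma>\<close> is \<open>\<tau>\<close> composed with
      \<open>?k\<close>.\<close>
    let ?k = "compose L (G_inv \<tau>) \<sigma>"
    have k: "?k \<in> G" using st G_compose G_inv_G by blast
    have "?k t = ?i t" if "t \<in> T" for t
      using that st T by (auto simp: compose_eq G_inv_apply subset_iff)
    then have "perm ?k \<beta> = \<beta>" using \<rho>T[OF k] perm_id[OF \<beta>] by simp
    moreover have "compose L \<tau> ?k x = \<sigma> x" for x
      using st G_mem by (cases "x \<in> L") (auto simp: compose_def G_inv_apply G_iff Bij_def extensional_def)
    then have "compose L \<tau> ?k = \<sigma>" by (rule ext)
    ultimately show ?thesis using perm_compose[OF st(2) k \<beta>] by simp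
  qed
  \<comment> \<open>For \<open>x\<close> in \<open>Z\<close> the value \<open>\<sigma> x\<close>
    depends only on the values of \<open>\<sigma>\<close> on \<open>T\<close>, so the sum
    \<open>v x\<close> does not depend on the choice of representatives.\<close>
  define Z where "Z = {x \<in> L. \<forall>\<sigma>\<in>G. \<forall>\<tau>\<in>G. (\<forall>t\<in>T. \<sigma> t = \<tau> t) \<longrightarrow> \<sigma> x = \<tau> x}"
  have Z_L: "x \<in> Z \<Longrightarrow> x \<in> L" for x by (simp add: Z_def)
  have Z_eq: "\<sigma> x = \<tau> x" if "x \<in> Z" "\<sigma> \<in> G" "\<tau> \<in> G" "\<forall>t\<in>T. \<sigma> t = \<tau> t" for x \<sigma> \<tau>
    using that by (simp add: Z_def)
  have Z_times: "t * x \<in> Z" if "t \<in> T" "x \<in> Z" for t x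
    using that T L_closed by (auto simp: Z_def G_times subset_iff)
  have Z_one: "1 \<in> Z" using L_closed by (auto simp: Z_def G_one)
  let ?e = "\<lambda>s. single (Gen (perm s \<alpha>))"
  define v where "v x = (\<Sum>s\<in>R. scale (s x) (?e s))" for x
  have eM: "?e s \<in> M" if "s \<in> G" for s
    using p_S[OF \<rho>_mem[OF that] \<alpha>] by (simp add: subfield)
  have sumM: "(\<Sum>s\<in>R'. scale (f s) (?e s)) \<in> M" if "R' \<subseteq> R" "\<And>s. s \<in> R' \<Longrightarrow> f s \<in> L" for f R'
  proof -
    have "finite R'" using that(1) R(1) finite_subset by blast
    then show ?thesis using that
    proof (induction R')
      case empty
      show ?case unfolding sum.empty by (rule M.zero_closed)
    next
      case (insert s R')
      have "?e s \<in> M" using insert.prems R eM by blast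
      then have "scale (f s) (?e s) \<in> M" using insert.prems by (intro M.smult_closed) auto
      moreover have "(\<Sum>s\<in>R'. scale (f s) (?e s)) \<in> M"
        by (rule insert.IH) (use insert.prems in auto)
      ultimately show ?case unfolding sum.insert[OF insert.hyps] by (rule M.add_closed)
    qed
  qed
  have v_fixed: "v x \<in> Fixed" if x: "x \<in> Z" for x
  proof -
    have act_v: "act \<tau> (v x) = v x" if \<tau>: "\<tau> \<in> G" for \<tau>
    proof -
      \<comment> \<open>Left translation by \<open>\<tau>\<close> permutes the classes of
        automorphisms that agree on \<open>T\<close>. \<open>r\<close> is this permutation on the
        representatives, and it reindexes the sum.\<close>
      define r where "r s = (THE s'. s' \<in> R \<and> (\<forall>t\<in>T. compose L \<tau> s t = s' t))" for s
      have r: "r s \<in> R" "\<forall>t\<in>T. compose L \<tau> s t = r s t" if "s \<in> R" for s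
        using theI'[OF uniq[OF G_compose[OF \<tau>, of s]]] that R unfolding r_def by blast+
      have "inj_on r R"
      proof (rule inj_onI)
        fix s s' assume ss: "s \<in> R" "s' \<in> R" "r s = r s'"
        have "s t = s' t" if "t \<in> T" for t
        proof -
          have "compose L \<tau> s t = compose L \<tau> s' t" using r(2)[OF ss(1)] r(2)[OF ss(2)] ss(3) that by simp
          then have "\<tau> (s t) = \<tau> (s' t)" using that T by (auto simp: compose_eq subset_iff)
          then show ?thesis using G_inj[OF \<tau>] G_mem ss R T that by (meson subsetD)
        qed
        then show "s = s'" using uniq[of s] ss R by blast
      qed
      then have bij: "bij_betw r R R"
        using endo_inj_surj[OF R(1), of r] r(1) by (auto simp: bij_betw_def)
      have act_term: "act \<tau> (scale (s x) (?e s)) = scale (r s x) (?e (r s))" if s: "s \<in> R" for s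
      proof -
        have sG: "s \<in> G" "r s \<in> G" "compose L \<tau> s \<in> G" using s r(1)[OF s] R G_compose[OF \<tau>] by blast+
        have "\<tau> (s x) = r s x" using Z_eq[OF x sG(3,2) r(2)[OF s]] Z_L[OF x] by (simp add: compose_eq)
        moreover have "perm \<tau> (perm s \<alpha>) = perm (r s) \<alpha>"
          using perm_T[OF sG(3,2) r(2)[OF s] \<alpha>] perm_compose[OF \<tau> sG(1) \<alpha>] by simp
        ultimately show ?thesis
          using act_scale[OF \<tau> G_mem[OF sG(1) Z_L[OF x]] eM[OF sG(1)]]
            act_single[OF \<tau> p_S[OF \<rho>_mem[OF sG(1)] \<alpha>]] by simp
      qed
      have "act \<tau> (\<Sum>s\<in>R'. scale (s x) (?e s)) = (\<Sum>s\<in>R'. act \<tau> (scale (s x) (?e s)))" if "R' \<subseteq> R" for R'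
      proof -
        have "finite R'" using that R(1) finite_subset by blast
        then show ?thesis using that
        proof (induction R')
          case empty
          show ?case using act_zero[OF \<tau>] by (simp only: sum.empty)
        next
          case (insert s R')
          have "s \<in> G" using insert.prems R by blast
          then have "scale (s x) (?e s) \<in> M" using eM G_mem Z_L[OF x] by (intro M.smult_closed) auto
          moreover have "(\<Sum>s\<in>R'. scale (s x) (?e s)) \<in> M"
            using insert.prems R G_mem Z_L[OF x] by (intro sumM) blast+
          ultimately show ?case
            using insert by (simp only: sum.insert act_add[OF \<tau>] insert_subset simp_thms)
        qed
      qed
      then have "act \<tau> (v x) = (\<Sum>s\<in>R. scale (r s x) (?e (r s)))" by (simp add: v_def act_term)
      also have "\<dots> = v x" unfolding v_def using bij by (rule sum.reindex_bij_betw)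
      finally show ?thesis .
    qed
    have "v x \<in> M" unfolding v_def using R Z_L[OF x] G_mem by (intro sumM) auto
    then show ?thesis using act_v by (simp add: Fixed_def)
  qed
  obtain s0 where s0: "s0 \<in> R" "\<forall>t\<in>T. ?i t = s0 t" using uniq[OF G_id] by blast
  \<comment> \<open>\<open>g\<close> is the interpolation polynomial with value 1 at
    \<open>s0\<close>, the representative of the identity, and zeros on \<open>D\<close>. All
    \<open>x\<close> in \<open>Z\<close> are treated at once because the next linear factor
    multiplies \<open>x\<close> by an element of \<open>T\<close>.\<close>
  have "\<exists>g. g s0 = 1 \<and> (\<forall>s\<in>D. g s = 0) \<and> (\<forall>x\<in>Z. (\<Sum>s\<in>R. scale (g s * s x) (?e s)) \<in> Lspan Fixed)"
    if "finite D" "D \<subseteq> R - {s0}" for D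
    using that
  proof (induction D)
    case empty
    have "(\<Sum>s\<in>R. scale (1 * s x) (?e s)) \<in> Lspan Fixed" if "x \<in> Z" for x
      using Lspan_base[OF v_fixed[OF that]] by (simp add: v_def)
    then show ?case by (intro exI[of _ "\<lambda>_. 1"] conjI ballI) (simp_all only: empty_iff)
  next
    case (insert d D)
    then obtain g where g: "g s0 = 1" "\<forall>s\<in>D. g s = 0"
      "\<forall>x\<in>Z. (\<Sum>s\<in>R. scale (g s * s x) (?e s)) \<in> Lspan Fixed"
      using insert.IH by (elim meta_impE exE conjE) blast+
    have dR: "d \<in> R" "d \<noteq> s0" using insert.prems by auto
    have "\<not> (\<forall>t\<in>T. s0 t = d t)" using uniq[of s0] dR s0(1) R by blast
    then obtain t where t: "t \<in> T" "s0 t \<noteq> d t" by blast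
    have tL: "t \<in> L" "s0 t \<in> L" "d t \<in> L" using t T dR s0(1) R G_mem by blast+
    \<comment> \<open>Normalises the factor \<open>s t - d t\<close>, which vanishes at
      \<open>d\<close>, to the value 1 at \<open>s0\<close>.\<close>
    define k where "k = 1 / (s0 t - d t)"
    have k: "k \<in> L" "k * (s0 t - d t) = 1" using tL t(2) L_closed by (auto simp: k_def)
    let ?g = "\<lambda>s. g s * (k * (s t - d t))"
    have "(\<Sum>s\<in>R. scale (?g s * s x) (?e s)) \<in> Lspan Fixed" if x: "x \<in> Z" for x
    proof -
      have "scale (?g s * s x) (?e s) =
          scale k (scale (g s * s (t * x)) (?e s)) + scale (- k * d t) (scale (g s * s x) (?e s))" if "s \<in> R" for s
        using that R tL(1) Z_L[OF x] by (auto simp: fun_eq_iff G_times subset_iff algebra_simps)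
      then have "(\<Sum>s\<in>R. scale (?g s * s x) (?e s)) =
          scale k (\<Sum>s\<in>R. scale (g s * s (t * x)) (?e s)) + scale (- k * d t) (\<Sum>s\<in>R. scale (g s * s x) (?e s))"
        by (simp add: scale_sum sum.distrib)
      also have "\<dots> \<in> Lspan Fixed"
        using g(3) x Z_times[OF t(1) x] k(1) tL(3) L_closed by (intro Lspan_add Lspan_scale) auto
      finally show ?thesis .
    qed
    moreover have "?g s0 = 1" using g(1) k(2) by simp
    moreover have "?g s = 0" if "s \<in> insert d D" for s using g(2) that by auto
    ultimately show ?case by (intro exI[of _ ?g] conjI ballI)
  qed
  from this[OF finite_Diff[OF R(1)] order_refl] obtain g where g: "g s0 = 1" "\<forall>s\<in>R - {s0}. g s = 0"
    "\<forall>x\<in>Z. (\<Sum>s\<in>R. scale (g s * s x) (?e s)) \<in> Lspan Fixed" by (elim exE conjE)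
  \<comment> \<open>With zeros at all other representatives and \<open>x = 1\<close>, only the term
    of \<open>s0\<close> survives.\<close>
  have "(\<Sum>s\<in>R. scale (g s * s 1) (?e s)) = (\<Sum>s\<in>R. if s = s0 then ?e s0 else 0)"
    using g(1,2) s0(1) R by (intro sum.cong) (auto simp: G_one subset_iff)
  also have "\<dots> = ?e s0" using R(1) s0(1) by simp
  also have "perm s0 \<alpha> = \<alpha>"
    using perm_T[OF G_id _ s0(2) \<alpha>] s0(1) R perm_id[OF \<alpha>] by (metis subsetD)
  finally show ?thesis using bspec[OF g(3) Z_one] by (simp only:)
qed

end

section \<open>Transitivity makes the form indecomposable\<close>

context rational_form_setting
begin

text \<open>With a single generator, every monomial that is a product contains the square of the
  generator, so it lies in \<open>N\<close>.\<close>

lemma one_vertex_linear_mod_N: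
  assumes S: "S = {\<alpha>}" and f: "f \<in> M"
  shows "f - scale (f (Gen \<alpha>)) (single (Gen \<alpha>)) \<in> N"
  using subfield f
proof (induction rule: free_carrier_span_induct)
  case zero
  have "(0::'a magma \<Rightarrow> complex) - scale ((0::'a magma \<Rightarrow> complex) (Gen \<alpha>)) (single (Gen \<alpha>)) = 0"
    by (rule ext) simp
  then show ?case using N_zero by (simp only:)
next
  case (add f g)
  have "(f + g) - scale ((f + g) (Gen \<alpha>)) (single (Gen \<alpha>)) =
    (f - scale (f (Gen \<alpha>)) (single (Gen \<alpha>))) + (g - scale (g (Gen \<alpha>)) (single (Gen \<alpha>)))"
    by (rule ext) (simp add: algebra_simps)
  then show ?case using N_add[OF add(3,4)] by (simp only:)
next
  case (scale a f)
  have "scale a f - scale ((scale a f) (Gen \<alpha>)) (single (Gen \<alpha>)) = scale a (f - scale (f (Gen \<alpha>)) (single (Gen \<alpha>)))"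
    by (rule ext) (simp add: algebra_simps)
  then show ?case using N_scale[OF scale(1,3)] by (simp only:)
next
  case (single t)
  have "\<exists>u v. t = Mul u v \<Longrightarrow> single t \<in> N" using single(1)
  proof (induction t)
    case (Mul u v)
    have M: "single u \<in> M" "single v \<in> M" using Mul.prems by (auto intro!: single_in_carrier subfield)
    consider "u = Gen \<alpha>" "v = Gen \<alpha>" | "\<exists>u1 u2. u = Mul u1 u2" | "\<exists>v1 v2. v = Mul v1 v2"
      using Mul.prems S by (cases u; cases v) auto
    then show ?case
    proof cases
      case 1
      then show ?thesis unfolding single_Mul using M by (auto intro: N_square)
    next
      case 2
      then show ?thesis unfolding single_Mul using Mul M by (intro N_conv_left) auto
    next
      case 3
      then show ?thesis unfolding single_Mul using Mul M by (intro N_conv_right) auto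
    qed
  qed simp
  then have single_N: "single t \<in> N" if "t \<noteq> Gen \<alpha>" using that single(1) S by (cases t) auto
  show ?case
  proof (cases "t = Gen \<alpha>")
    case True
    have "single t - scale (single t (Gen \<alpha>)) (single (Gen \<alpha>)) = 0"
      by (rule ext) (simp add: single_def True)
    then show ?thesis using N_zero by (simp only:)
  next
    case False
    have "single t - scale (single t (Gen \<alpha>)) (single (Gen \<alpha>)) = single t"
      by (rule ext) (use False in \<open>simp add: single_def\<close>)
    then show ?thesis using single_N[OF False] by (simp only:)
  qed
qed

section \<open>Generation modulo the lower central series\<close>

lemma LC_closed:
  "LC k \<subseteq> M" "0 \<in> LC k" "x \<in> LC k \<Longrightarrow> y \<in> LC k \<Longrightarrow> x + y \<in> LC k"
  "a \<in> L \<Longrightarrow> x \<in> LC k \<Longrightarrow> scale a x \<in> LC k"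
  using M.submodule_lower_central[of k] unfolding M.submodule_iff by blast+

lemma no_linear_part_in_lower_central:
  assumes e: "e \<in> M" "\<And>\<alpha>. e (Gen \<alpha>) = 0"
  shows "e \<in> LC 2"
proof -
  have sub: "submodule (LC 2) (\<C>\<lparr>carrier := L\<rparr>) MA"
    by (rule M.submodule_lower_central)
  show ?thesis
    using subfield e(1)
  proof (induction rule: free_carrier_span_induct)
    case (single t)
    then obtain u v where t: "t = Mul u v" using e(2) by (cases t) auto
    have M: "single u \<in> M" "single v \<in> M" using single t by (auto intro!: single_in_carrier subfield)
    have "conv (single u) (single v) \<in> LC (Suc 1)"
      using M by (intro M.lower_central_mult) auto
    then show ?case by (simp only: t single_Mul numeral_2_eq_2 One_nat_def)
  next
    case zero
    show ?case using sub unfolding M.submodule_iff by blast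
  next
    case (add f g)
    then show ?case using sub unfolding M.submodule_iff by blast
  next
    case (scale a f)
    then show ?case using sub unfolding M.submodule_iff by blast
  qed
qed

text \<open>If \<open>M = A + \<gamma>\<^sub>k + N\<close>, then \<open>\<gamma>\<^sub>2 \<subseteq> A + \<gamma>\<^sub>k\<^sub>+\<^sub>1 + N\<close>; the iteration
  ends because \<open>\<gamma>\<^sub>c\<^sub>+\<^sub>1 \<subseteq> N\<close>.\<close>

lemma generated_mod_lower_central:
  assumes A_M: "A \<subseteq> M" and A_zero: "0 \<in> A" and A_add: "\<And>f g. f \<in> A \<Longrightarrow> g \<in> A \<Longrightarrow> f + g \<in> A"
    and A_scale: "\<And>a f. a \<in> L \<Longrightarrow> f \<in> A \<Longrightarrow> scale a f \<in> A"
    and A_conv: "\<And>f g. f \<in> A \<Longrightarrow> g \<in> A \<Longrightarrow> conv f g \<in> A"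
    and gen: "\<And>f. f \<in> M \<Longrightarrow> \<exists>g\<in>A. f - g \<in> LC 2"
    and f: "f \<in> M"
  shows "\<exists>g\<in>A. f - g \<in> N"
proof -
  have "\<exists>g\<in>A. \<exists>e\<in>LC (k + 2). f - g - e \<in> N" if "f \<in> M" for k f
    using that
  proof (induction k arbitrary: f)
    case 0
    then obtain g where g: "g \<in> A" "f - g \<in> LC 2" using gen by blast
    have "f - g - (f - g) \<in> N" by simp
    then show ?case using g by (auto simp only: add_0)
  next
    case (Suc k)
    \<comment> \<open>The elements that can be approximated to the next order form a subspace, so it
      suffices to treat products.\<close>
    let ?Y = "{x \<in> M. \<exists>g\<in>A. \<exists>e\<in>LC (Suc k + 2). x - g - e \<in> N}"
    have "LC (Suc 1) \<subseteq> ?Y"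
      unfolding M.lower_central_Suc[OF one_neq_zero]
    proof (rule M.span_in_least)
      show "submodule ?Y (\<C>\<lparr>carrier := L\<rparr>) MA"
        unfolding M.submodule_iff
      proof (intro conjI ballI)
        have "0 - 0 - 0 \<in> N" by simp
        then show "0 \<in> ?Y" using A_zero LC_closed(2)[of "Suc k + 2"] M.zero_closed by blast
        fix x assume "x \<in> ?Y"
        then obtain g e where ge: "x \<in> M" "g \<in> A" "e \<in> LC (Suc k + 2)" "x - g - e \<in> N" by blast
        {
          fix y assume "y \<in> ?Y"
          then obtain g' e' where ge': "y \<in> M" "g' \<in> A" "e' \<in> LC (Suc k + 2)" "y - g' - e' \<in> N" by blast
          have "(x + y) - (g + g') - (e + e') = (x - g - e) + (y - g' - e')" by simp
          then have "(x + y) - (g + g') - (e + e') \<in> N" using N_add[OF ge(4) ge'(4)] by (simp only:)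
          then show "x + y \<in> ?Y" using A_add[OF ge(2) ge'(2)] LC_closed(3)[OF ge(3) ge'(3)] M.add_closed[OF ge(1) ge'(1)] by blast
        }
        fix a assume a: "a \<in> L"
        have "scale a x - scale a g - scale a e = scale a (x - g - e)" by (simp only: scale_diff)
        then have "scale a x - scale a g - scale a e \<in> N" using N_scale[OF a ge(4)] by (simp only:)
        then show "scale a x \<in> ?Y" using A_scale[OF a ge(2)] LC_closed(4)[OF a ge(3)] M.smult_closed[OF a ge(1)] by blast
      qed auto
      show "{conv x y |x y. x \<in> M \<and> y \<in> LC 1} \<subseteq> ?Y"
      proof clarify
        fix x y assume x: "x \<in> M" and "y \<in> LC 1"
        then have y: "y \<in> M" using LC_closed(1) by blast
        obtain g e where ge: "g \<in> A" "e \<in> LC (k + 2)" "x - g - e \<in> N" using Suc.IH[OF x] by blast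
        obtain g' e' where ge': "g' \<in> A" "e' \<in> LC (k + 2)" "y - g' - e' \<in> N" using Suc.IH[OF y] by blast
        have M: "g \<in> M" "e \<in> M" "g' \<in> M" "e' \<in> M" using ge ge' A_M LC_closed(1) by blast+
        \<comment> \<open>With \<open>x = g + e\<close> and \<open>y = g' + e'\<close> modulo
          \<open>N\<close>, the product is \<open>g g'\<close> plus the errors \<open>g e'\<close>
          and \<open>e y\<close>. The latter is rewritten as \<open>- y e\<close>, because
          multiplication from the left is what raises the index of the series.\<close>
        let ?e = "conv g e' + scale (-1) (conv y e)"
        have "conv g e' \<in> LC (Suc k + 2)" "conv y e \<in> LC (Suc k + 2)"
          using M.lower_central_mult[of "k + 2" g e'] M.lower_central_mult[of "k + 2" y e] M y ge(2) ge'(2)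
          by simp_all
        then have e: "?e \<in> LC (Suc k + 2)" using LC_closed(3,4) L_closed(9) by blast
        have "conv x y - conv g g' - ?e =
            conv (x - g - e) y + (conv e y + conv y e) + conv g (y - g' - e')"
          by (rule magma_fun_eqI) (simp_all add: algebra_simps)
        also have "\<dots> \<in> N"
          by (rule N_add[OF N_add[OF N_conv_left[OF ge(3) y] N_anticommute[OF M(2) y]] N_conv_right[OF M(1) ge'(3)]])
        finally show "conv x y \<in> M \<and> (\<exists>g\<in>A. \<exists>e\<in>LC (Suc k + 2). conv x y - g - e \<in> N)"
          using A_conv[OF ge(1) ge'(1)] e M.mult_closed[OF x y] by blast
      qed
    qed
    moreover obtain g where g: "g \<in> A" "f - g \<in> LC (Suc 1)"
      using gen[OF Suc.prems] by (auto simp only: numeral_2_eq_2 One_nat_def)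
    ultimately obtain g' e where ge: "g' \<in> A" "e \<in> LC (Suc k + 2)" "f - g - g' - e \<in> N" by blast
    have "f - (g + g') - e \<in> N" using ge(3) by (simp only: diff_diff_eq)
    then show ?case using A_add[OF g(1) ge(1)] ge(2) by blast
  qed
  \<comment> \<open>At this stage the error lies in the term with index \<open>c + 1\<close>, which
    is contained in \<open>N\<close>.\<close>
  from this[OF f, of "c - 1"] obtain g e where ge: "g \<in> A" "e \<in> LC (c - 1 + 2)" "f - g - e \<in> N" by blast
  have "c - 1 + 2 = c + 1" using c_gt_1 by simp
  then have "e \<in> N" using ge(2) N_lower_central by (simp only:)
  from N_add[OF ge(3) this] have "f - g \<in> N" by simp
  then show ?thesis using ge(1) by blast
qed

text \<open>Applied to the two summands in both orders, so that each of them has a nonzero linear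
  coefficient somewhere.\<close>

lemma linear_part_nonzero:
  assumes H: "fixed_ideal H" "N \<subseteq> H" and J: "fixed_ideal J" "N \<subset> J" "H \<inter> J = N"
    and sum: "\<forall>f\<in>Fixed. \<exists>h\<in>H. \<exists>j\<in>J. f = h + j"
  shows "\<exists>j\<in>J. \<exists>\<alpha>\<in>S. j (Gen \<alpha>) \<noteq> 0"
proof (rule ccontr)
  assume "\<not> ?thesis"
  moreover have JM: "j \<in> M" if "j \<in> J" for j using that J(1) Fixed_M by (auto simp: fixed_ideal_def)
  ultimately have J0: "j (Gen \<alpha>) = 0" if "j \<in> J" for j \<alpha>
    using that free_carrierD(2)[OF JM[OF that], of "Gen \<alpha>"] by (cases "\<alpha> \<in> S") auto
  have HF: "H \<subseteq> Fixed" and H_add: "\<And>f g. f \<in> H \<Longrightarrow> g \<in> H \<Longrightarrow> f + g \<in> H"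
    and H_scale: "\<And>a f. a \<in> K \<Longrightarrow> f \<in> H \<Longrightarrow> scale a f \<in> H"
    and H_conv: "\<And>f g. f \<in> H \<Longrightarrow> g \<in> H \<Longrightarrow> conv f g \<in> H"
    using H(1) unfolding fixed_ideal_def by blast+
  then have HM: "H \<subseteq> M" using Fixed_M by blast
  let ?Y = "{f. \<exists>g\<in>Lspan H. f - g \<in> LC 2}"
  have Y_zero: "0 \<in> ?Y"
  proof -
    have "0 - 0 \<in> LC 2" using LC_closed(2) by (simp only: diff_zero)
    then show ?thesis using Lspan.zero by blast
  qed
  have Y_add: "f + f' \<in> ?Y" if ff: "f \<in> ?Y" "f' \<in> ?Y" for f f'
  proof -
    obtain g g' where g: "g \<in> Lspan H" "f - g \<in> LC 2" "g' \<in> Lspan H" "f' - g' \<in> LC 2" using ff by blast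
    have "(f + f') - (g + g') \<in> LC 2" using LC_closed(3)[OF g(2,4)] by (simp only: add_diff_add)
    then show ?thesis using Lspan_add[OF g(1,3)] by blast
  qed
  have Y_scale: "scale a f \<in> ?Y" if a: "a \<in> L" and ff: "f \<in> ?Y" for a f
  proof -
    obtain g where g: "g \<in> Lspan H" "f - g \<in> LC 2" using ff by blast
    have "scale a f - scale a g \<in> LC 2" using LC_closed(4)[OF a g(2)] by (simp only: scale_diff)
    then show ?thesis using Lspan_scale[OF a g(1)] by blast
  qed
  have "Fixed \<subseteq> ?Y"
  proof
    fix f assume "f \<in> Fixed"
    then obtain h j where hj: "h \<in> H" "j \<in> J" "f = h + j" using sum by blast
    have "j \<in> LC 2" using no_linear_part_in_lower_central[OF JM[OF hj(2)] J0[OF hj(2)]] .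
    moreover have "f - h = j" using hj(3) by simp
    ultimately show "f \<in> ?Y" using Lspan_base[OF hj(1)] by blast
  qed
  then have "Lspan Fixed \<subseteq> ?Y" using Lspan_least[OF _ _ Y_zero Y_add Y_scale] by blast
  then have gen_single: "single (Gen \<alpha>) \<in> ?Y" if "\<alpha> \<in> S" for \<alpha> using single_in_Lspan[OF that] by blast
  have gen: "f \<in> ?Y" if "f \<in> M" for f
    using subfield that
  proof (induction rule: free_carrier_induct)
    case (conv f g)
    have "conv f g \<in> LC (Suc 1)"
      using conv by (intro M.lower_central_mult) auto
    then have "conv f g - 0 \<in> LC 2" by (simp only: diff_zero numeral_2_eq_2 One_nat_def)
    then show ?case using Lspan.zero by blast
  next
    case zero
    show ?case by (rule Y_zero)
  next
    case (add f g)
    show ?case by (rule Y_add[OF add(3,4)])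
  next
    case (scale a f)
    show ?case by (rule Y_scale[OF scale(1,3)])
  next
    case (Gen \<alpha>)
    then show ?case by (rule gen_single)
  qed
  have "J \<subseteq> N"
  proof
    fix j assume j: "j \<in> J"
    then have "j \<in> Fixed" using J(1) unfolding fixed_ideal_def by blast
    have "\<exists>g\<in>Lspan H. j - g \<in> N"
    proof (rule generated_mod_lower_central)
      show "Lspan H \<subseteq> M" using Lspan_M[OF HM] by blast
      show "\<exists>g\<in>Lspan H. f - g \<in> LC 2" if "f \<in> M" for f using gen[OF that] by blast
    qed (use JM[OF j] H_conv in \<open>auto intro: Lspan.zero Lspan_add Lspan_scale Lspan_conv\<close>)
    then obtain g where "g \<in> Lspan H" "j - g \<in> N" by blast
    then have "j \<in> H" using fixed_in_Lspan[OF HF H(2) H_add H_scale \<open>j \<in> Fixed\<close>] by blast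
    then show "j \<in> N" using j J(3) by blast
  qed
  then show False using J(2) by blast
qed

section \<open>Linear parts along edges\<close>

text \<open>The relation survives linear combinations over \<open>L\<close>, so it holds on the span
  of \<open>Fixed\<close>, in particular at the generator of \<open>\<alpha>\<close>.\<close>

lemma functional_zero:
  assumes "\<And>f. f \<in> Fixed \<Longrightarrow> b * f (Gen \<alpha>) = a * f (Gen \<beta>)" and \<alpha>: "\<alpha> \<in> S" "\<alpha> \<noteq> \<beta>"
  shows "b = 0"
proof -
  have "single (Gen \<alpha>) \<in> {f. b * f (Gen \<alpha>) = a * f (Gen \<beta>)}"
    by (rule Lspan_least[OF single_in_Lspan[OF \<alpha>(1)]]) (use assms(1) in \<open>auto simp: algebra_simps\<close>)
  then show ?thesis using \<alpha> by (auto simp: single_def)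
qed

lemma indecomposable_if_transitive:
  assumes trans: "\<And>C C'. C \<in> connected_comps S E \<Longrightarrow> C' \<in> connected_comps S E \<Longrightarrow> \<exists>\<sigma>\<in>G. perm \<sigma> ` C = C'"
  shows "\<not> decomposable K (rational_form L K S E c vtx \<rho>)"
proof
  assume "decomposable K (rational_form L K S E c vtx \<rho>)"
  then obtain H J where H: "fixed_ideal H" "N \<subset> H" and J: "fixed_ideal J" "N \<subset> J" and HJ: "H \<inter> J = N"
    and sum: "\<forall>f\<in>Fixed. \<exists>h\<in>H. \<exists>j\<in>J. f = h + j"
    unfolding decomposable_rational_form_iff by (elim exE conjE)
  \<comment> \<open>A vertex is hot if \<open>H\<close>, and cold if \<open>J\<close>, has a nonzero
    coefficient there.\<close>
  define hot where "hot \<alpha> \<longleftrightarrow> (\<exists>h\<in>H. h (Gen \<alpha>) \<noteq> 0)" for \<alpha>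
  define cold where "cold \<alpha> \<longleftrightarrow> (\<exists>j\<in>J. j (Gen \<alpha>) \<noteq> 0)" for \<alpha>
  have HF: "H \<subseteq> Fixed" and JF: "J \<subseteq> Fixed" using H(1) J(1) by (auto simp: fixed_ideal_def)
  have edge: "hot \<alpha> \<and> hot \<beta> \<and> \<not> cold \<alpha> \<and> \<not> cold \<beta>" if e: "{\<alpha>, \<beta>} \<in> E" and hot: "hot \<alpha> \<or> hot \<beta>" for \<alpha> \<beta>
  proof -
    have ab: "\<alpha> \<in> S" "\<beta> \<in> S" "\<alpha> \<noteq> \<beta>" using edgeD[OF e] by auto
    have par: "h (Gen \<alpha>) * j (Gen \<beta>) = h (Gen \<beta>) * j (Gen \<alpha>)" if "h \<in> H" "j \<in> J" for h j
    proof -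
      have "conv h j \<in> H \<inter> J" using that HF JF H(1) J(1) unfolding fixed_ideal_def by blast
      then have "conv h j \<in> N" using HJ by simp
      from N_low_degree(2)[OF this e] show ?thesis by simp
    qed
    obtain h0 where h0: "h0 \<in> H" "h0 (Gen \<alpha>) \<noteq> 0 \<or> h0 (Gen \<beta>) \<noteq> 0" using hot by (auto simp: hot_def)
    have no_cold: "j (Gen \<alpha>) = 0 \<and> j (Gen \<beta>) = 0" if j: "j \<in> J" for j
    proof (rule ccontr)
      assume ne: "\<not> ?thesis"
      \<comment> \<open>A nonzero linear part of \<open>j\<close> at the edge would make that of
        every \<open>h\<close> parallel to \<open>j\<close>, hence to \<open>h0\<close>. Those of
        \<open>J\<close> are parallel to \<open>h0\<close> anyway, so all of \<open>Fixed\<close>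
        would satisfy one linear relation at this edge.\<close>
      have key: "h0 (Gen \<beta>) * f (Gen \<alpha>) = h0 (Gen \<alpha>) * f (Gen \<beta>)" if "f \<in> Fixed" for f
      proof -
        obtain h j' where f: "h \<in> H" "j' \<in> J" "f = h + j'" using sum \<open>f \<in> Fixed\<close> by blast
        have 1: "h0 (Gen \<alpha>) * j' (Gen \<beta>) = h0 (Gen \<beta>) * j' (Gen \<alpha>)" by (rule par[OF h0(1) f(2)])
        have 2: "h (Gen \<alpha>) * j (Gen \<beta>) = h (Gen \<beta>) * j (Gen \<alpha>)" by (rule par[OF f(1) j])
        have 3: "h0 (Gen \<alpha>) * j (Gen \<beta>) = h0 (Gen \<beta>) * j (Gen \<alpha>)" by (rule par[OF h0(1) j])
        have "(b * x) * c = (a * y) * c" "(b * x) * d = (a * y) * d" if xy: "x * d = y * c" and ab: "a * d = b * c"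
          for a b c d x y :: complex
        proof -
          have "(b * x) * c = x * (b * c)" by (simp only: mult_ac)
          also have "\<dots> = a * (x * d)" unfolding ab[symmetric] by (simp only: mult_ac)
          also have "\<dots> = (a * y) * c" unfolding xy by (simp only: mult_ac)
          finally show "(b * x) * c = (a * y) * c" .
          have "(b * x) * d = b * (x * d)" by (simp only: mult_ac)
          also have "\<dots> = y * (b * c)" unfolding xy by (simp only: mult_ac)
          also have "\<dots> = (a * y) * d" unfolding ab[symmetric] by (simp only: mult_ac)
          finally show "(b * x) * d = (a * y) * d" .
        qed
        note this[OF 2 3]
        then have "h0 (Gen \<beta>) * h (Gen \<alpha>) = h0 (Gen \<alpha>) * h (Gen \<beta>)" using ne by auto
        then show ?thesis using 1 by (simp add: f(3) algebra_simps)
      qed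
      have "h0 (Gen \<beta>) = 0" by (rule functional_zero[OF key ab(1,3)])
      moreover have "h0 (Gen \<alpha>) = 0" by (rule functional_zero[OF key[symmetric] ab(2) ab(3)[symmetric]])
      ultimately show False using h0(2) by simp
    qed
    \<comment> \<open>Otherwise the coefficient at \<open>\<gamma>\<close> would vanish on
      \<open>H\<close> and \<open>J\<close>, hence on all of \<open>Fixed\<close>.\<close>
    have "hot \<gamma>" if g: "\<gamma> \<in> {\<alpha>, \<beta>}" for \<gamma>
    proof (rule ccontr)
      assume no: "\<not> hot \<gamma>"
      have "f (Gen \<gamma>) = 0" if "f \<in> Fixed" for f
      proof -
        obtain h j where f: "h \<in> H" "j \<in> J" "f = h + j" using sum \<open>f \<in> Fixed\<close> by blast
        then show ?thesis using no no_cold[OF f(2)] g by (auto simp: hot_def)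
      qed
      then have "(1::complex) = 0" using functional_zero[of 1 \<gamma> 0 "if \<gamma> = \<alpha> then \<beta> else \<alpha>"] g ab by auto
      then show False by simp
    qed
    then show ?thesis using no_cold by (auto simp: cold_def)
  qed
  \<comment> \<open>Elements of \<open>N\<close> have no linear part, so invariance modulo
    \<open>N\<close> is exact on linear coefficients: the value at the permuted vertex is the Galois
    conjugate of the value at \<open>\<alpha>\<close>.\<close>
  have hot_perm: "hot (perm \<sigma> \<alpha>)" if \<sigma>: "\<sigma> \<in> G" and \<alpha>: "\<alpha> \<in> S" "hot \<alpha>" for \<sigma> \<alpha>
  proof -
    obtain h where h: "h \<in> H" "h (Gen \<alpha>) \<noteq> 0" using \<alpha>(2) by (auto simp: hot_def)
    have hF: "h \<in> Fixed" using h(1) HF by blast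
    then have "act \<sigma> h - h \<in> N" using \<sigma> by (auto simp: Fixed_def)
    from N_low_degree(1)[OF this, of "perm \<sigma> \<alpha>"] have "h (Gen (perm \<sigma> \<alpha>)) = \<sigma> (h (Gen \<alpha>))"
      using act_Gen[OF \<sigma> \<alpha>(1), of h] by simp
    also have "\<dots> \<noteq> 0"
      using G_inj[OF \<sigma>, of "h (Gen \<alpha>)" 0] h(2) G_zero[OF \<sigma>] free_carrierD(1)[OF Fixed_M[OF hF]] L_closed(1) by simp
    finally show ?thesis using h(1) by (auto simp: hot_def)
  qed
  obtain \<alpha> where \<alpha>: "\<alpha> \<in> S" "hot \<alpha>"
    using linear_part_nonzero[OF J(1) _ H(1,2)] J(2) HJ sum
    by (auto simp: hot_def psubset_eq Int_commute) (metis add.commute)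
  obtain \<beta> where \<beta>: "\<beta> \<in> S" "cold \<beta>"
    using linear_part_nonzero[OF H(1) _ J(1,2) HJ sum] H(2) by (auto simp: cold_def psubset_eq)
  have comp: "conn `` {\<gamma>} \<in> connected_comps S E" "\<gamma> \<in> conn `` {\<gamma>}" if "\<gamma> \<in> S" for \<gamma>
    using that equiv_class_self[OF equiv_conn] by (auto simp: comps_eq quotientI)
  obtain \<sigma> where \<sigma>: "\<sigma> \<in> G" "perm \<sigma> ` (conn `` {\<alpha>}) = conn `` {\<beta>}"
    using trans[OF comp(1)[OF \<alpha>(1)] comp(1)[OF \<beta>(1)]] by blast
  let ?\<gamma> = "perm \<sigma> \<alpha>"
  have \<gamma>: "hot ?\<gamma>" using hot_perm \<sigma>(1) \<alpha> by blast
  have "?\<gamma> \<in> conn `` {\<beta>}" using \<sigma>(2) comp(2)[OF \<alpha>(1)] by blast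
  then have "(?\<gamma>, \<beta>) \<in> conn" using equiv_conn by (auto elim: equivE dest: symD)
  then have "(?\<gamma>, \<beta>) \<in> {(x, y). {x, y} \<in> E}\<^sup>*" by (auto simp: connected_rel_def)
  then have "hot \<beta>"
  proof (induction rule: rtrancl_induct)
    case (step y z)
    then show ?case using edge[of y z] by auto
  qed (rule \<gamma>)
  \<comment> \<open>Hotness has spread over the whole component of \<open>\<beta>\<close>, but a
    vertex that lies on an edge cannot be both hot and cold.\<close>
  then have isolated: "{\<beta>, \<delta>} \<notin> E" for \<delta> using edge[of \<beta> \<delta>] \<beta>(2) by blast
  have fix_\<beta>: "perm \<tau> \<beta> = \<beta>" if "\<tau> \<in> G" for \<tau>
    by (rule p_isolated[OF \<rho>_mem[OF that] \<beta>(1) isolated])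
  \<comment> \<open>An isolated vertex is a component that the whole group fixes, so by transitivity
    there is no other component.\<close>
  have "S = {\<beta>}"
  proof -
    have "conn `` {\<beta>} \<subseteq> {\<beta>}"
    proof
      fix \<delta> assume "\<delta> \<in> conn `` {\<beta>}"
      then have "(\<beta>, \<delta>) \<in> {(x, y). {x, y} \<in> E}\<^sup>*" by (auto simp: connected_rel_def)
      then show "\<delta> \<in> {\<beta>}" by (cases rule: converse_rtranclE) (use isolated in auto)
    qed
    then have b: "conn `` {\<beta>} = {\<beta>}" using comp(2)[OF \<beta>(1)] by blast
    have "\<delta> = \<beta>" if "\<delta> \<in> S" for \<delta>
    proof -
      obtain \<tau> where \<tau>: "\<tau> \<in> G" "perm \<tau> ` (conn `` {\<beta>}) = conn `` {\<delta>}"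
        using trans[OF comp(1)[OF \<beta>(1)] comp(1)[OF \<open>\<delta> \<in> S\<close>]] by blast
      then have "conn `` {\<delta>} = {\<beta>}" using fix_\<beta> b by simp
      then show ?thesis using comp(2)[OF that] by blast
    qed
    then show ?thesis using \<beta>(1) by blast
  qed
  obtain h j where h: "h \<in> H" "h (Gen \<beta>) \<noteq> 0" and j: "j \<in> J" "j (Gen \<beta>) \<noteq> 0"
    using \<open>hot \<beta>\<close> \<beta>(2) by (auto simp: hot_def cold_def)
  \<comment> \<open>As every permutation fixes \<open>\<beta>\<close>, the coefficient there is
    invariant under the Galois group.\<close>
  have in_K: "f (Gen \<beta>) \<in> K" if f: "f \<in> Fixed" for f
  proof (rule fixed_field)
    show "f (Gen \<beta>) \<in> L" using free_carrierD(1)[OF Fixed_M[OF f]] .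
    fix \<tau> assume \<tau>: "\<tau> \<in> G"
    then have "act \<tau> f - f \<in> N" using f by (auto simp: Fixed_def)
    from N_low_degree(1)[OF this, of \<beta>] show "\<tau> (f (Gen \<beta>)) = f (Gen \<beta>)"
      using act_Gen[OF \<tau> \<beta>(1), of f] fix_\<beta>[OF \<tau>] by simp
  qed
  \<comment> \<open>With one vertex, elements are determined modulo \<open>N\<close> by their linear
    coefficient. So \<open>j\<close> is congruent to the multiple of \<open>h\<close> by this ratio,
    which lies in \<open>K\<close>.\<close>
  define k where "k = j (Gen \<beta>) / h (Gen \<beta>)"
  have hj: "h \<in> Fixed" "j \<in> Fixed" using h(1) j(1) HF JF by auto
  then have "k \<in> K" using in_K subfield_complex_closed(8)[OF fields(1)] by (auto simp: k_def)
  then have kh: "scale k h \<in> H" using H(1) h(1) by (auto simp: fixed_ideal_def)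
  then have "scale k h \<in> M" "j \<in> M" using HF hj Fixed_M by auto
  then have "j - scale k h \<in> M" using M_diff by blast
  from one_vertex_linear_mod_N[OF \<open>S = {\<beta>}\<close> this]
  have "(j - scale k h) - scale 0 (single (Gen \<beta>)) \<in> N" using h(2) by (simp add: k_def)
  then have "j - scale k h \<in> N" by simp
  then have "(j - scale k h) + scale k h \<in> H" using H kh unfolding fixed_ideal_def by blast
  then have "j \<in> H" by (simp only: diff_add_cancel)
  then have "j \<in> N" using j(1) HJ by blast
  then show False using N_low_degree(1)[of j \<beta>] j(2) by simp
qed

lemma indecomposable_iff_transitive:
  "\<not> decomposable K (rational_form L K S E c vtx \<rho>) \<longleftrightarrow>
    (\<forall>C\<in>connected_comps S E. \<forall>C'\<in>connected_comps S E. \<exists>\<sigma>\<in>G. comp_perm S E (\<rho> \<sigma>) C = C')"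
proof -
  have eq: "comp_perm S E (\<rho> \<sigma>) C = perm \<sigma> ` C" if "\<sigma> \<in> G" "C \<in> connected_comps S E" for \<sigma> C
    using comp_perm_eq[OF \<rho>_mem] that by blast
  have "(\<forall>C\<in>connected_comps S E. \<forall>C'\<in>connected_comps S E. \<exists>\<sigma>\<in>G. comp_perm S E (\<rho> \<sigma>) C = C') \<longleftrightarrow>
    (\<forall>C\<in>connected_comps S E. \<forall>C'\<in>connected_comps S E. \<exists>\<sigma>\<in>G. perm \<sigma> ` C = C')"
    by (intro ball_cong bex_cong refl) (simp add: eq)
  also have "\<dots> \<longleftrightarrow> \<not> decomposable K (rational_form L K S E c vtx \<rho>)"
  proof
    assume "\<forall>C\<in>connected_comps S E. \<forall>C'\<in>connected_comps S E. \<exists>\<sigma>\<in>G. perm \<sigma> ` C = C'"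
    then show "\<not> decomposable K (rational_form L K S E c vtx \<rho>)" by (intro indecomposable_if_transitive) blast
  next
    assume ind: "\<not> decomposable K (rational_form L K S E c vtx \<rho>)"
    show "\<forall>C\<in>connected_comps S E. \<forall>C'\<in>connected_comps S E. \<exists>\<sigma>\<in>G. perm \<sigma> ` C = C'"
    proof (intro ballI, rule ccontr)
      fix C C' assume C: "C \<in> connected_comps S E" "C' \<in> connected_comps S E" "\<not> (\<exists>\<sigma>\<in>G. perm \<sigma> ` C = C')"
      then have no: "perm \<sigma> ` C \<noteq> C'" if "\<sigma> \<in> G" for \<sigma> using that by blast
      obtain V where "stable_separation V" "V \<noteq> S" by (rule stable_separation_orbit[OF C(1,2) no])
      then show False using decomposable_if_separated ind by blast
    qed
  qed
  finally show ?thesis by blast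
qed

end

theorem theorem1p3:
  fixes S :: "'a set" and E :: "'a set set" and c :: nat and K L :: "complex set"
    and vtx :: "'a set \<Rightarrow> nat \<Rightarrow> 'a" and \<rho> :: "(complex \<Rightarrow> complex) \<Rightarrow> 'a set \<Rightarrow> 'a set"
  assumes "simple_graph S E"
    and "c > 1"
    and "galois_extension L K"
    and "vertex_enumeration S E vtx"
    and "\<rho> \<in> hom (galois_group L K) (quotient_graph_aut S E)"
    and "continuous_map (krull_topology L K)
           (discrete_topology (carrier (quotient_graph_aut S E))) \<rho>"
  shows "\<not> decomposable K (rational_form L K S E c vtx \<rho>) \<longleftrightarrow>
    (\<forall>C\<in>connected_comps S E. \<forall>C'\<in>connected_comps S E.
       \<exists>\<sigma>\<in>carrier (galois_group L K). comp_perm S E (\<rho> \<sigma>) C = C')"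
proof -
  have "subfield L \<C>" using assms(3) by (simp add: galois_extension_def)
  with assms interpret rational_form_setting L K S E vtx c \<rho>
    by (intro rational_form_setting.intro galois_setting.intro enumerated_graph.intro
        nilpotent_graph_algebra.intro rational_form_setting_axioms.intro)
  show ?thesis by (rule indecomposable_iff_transitive)
qed

end
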